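(* For every $n$-dimensional locally finite simplicial complex $K$ and every $0\leq p\leq n$, the measure $\gamma^d_{p,K}$ weakly converges to $q_{p,n}\,d\mathrm{vol}_K$ as $d$ grows to $+\infty$; that is, for every continuous function $\varphi$ with compact support in $|K|$, $\int_K\varphi\, d\gamma^d_{p,K}\to q_{p,n}\int_K\varphi\, d\mathrm{vol}_K$ as $d\to+\infty$.
   Context: $\mathrm{Sd}^d(K)$ is the $d$-th iterated barycentric subdivision of $K$, $K^{[p]}$ is the set of $p$-dimensional simplices of a complex $K$, and $f_p(K)=\#K^{[p]}$ when $K$ is finite. For $d\geq0$, $\gamma^d_{p,K}=\frac{1}{(n+1)!^d}\sum_{\sigma\in \mathrm{Sd}^d(K)^{[p]}}\delta_{\hat\sigma}$, where $\delta_{\hat\sigma}$ is the Dirac measure at the barycenter $\hat\sigma$ of $\sigma$; it is a measure on the underlying space $|K|$. Let $\Delta_n$ be the standard $n$-simplex and $d\mathrm{vol}_{\Delta_n}$ its Lebesgue measure normalized to have total mass $1$; then $d\mathrm{vol}_K=\sum_{\sigma\in K^{[n]}}(f_\sigma)_*(d\mathrm{vol}_{\Delta_n})$, where $f_\sigma:\Delta_n\to\sigma$ is a simplicial isomorphism. For $0\le p\le n$, $q_{p,n}>0$ is defined by $q_{p,n}=\lim_{d\to+\infty}\frac{f_p(\mathrm{Sd}^d(L))}{(n+1)!^d f_n(L)}$, where $L$ is any $n$-dimensional finite simplicial complex; it is a known theorem (Brenti–Welker, Delucchi–Pixton–Sabalka) that this limit exists, is positive and does not depend on $L$. *)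

theory Defs
  imports
    "HOL-Probability.Probability"
    "HOL-Homology.Homology"
    "HOL-Analysis.Finite_Function_Topology"
begin

section \<open>Simplicial complexes and barycentric subdivision\<close>

text \<open>
  Simplicial complexes are geometric, in an arbitrary real vector space, and possibly infinite. A
  simplex is encoded by its finite, affinely independent, nonempty vertex set; the closed simplex
  itself is the convex hull of that set. The vector space only provides the affine structure: its
  dimension is not restricted, and no topology on it is used. Every abstract simplicial complex
  with vertices in a type \<open>'a\<close> is realized in this way in the free vector space \<open>'a \<Rightarrow>\<^sub>0 real\<close>.
\<close>

definition geometric_complex :: "'v::real_vector set set \<Rightarrow> bool" where
  "geometric_complex K \<longleftrightarrow>
     (\<forall>\<sigma>\<in>K. finite \<sigma> \<and> \<sigma> \<noteq> {} \<and> \<not> affine_dependent \<sigma>) \<and>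
     (\<forall>\<sigma>\<in>K. \<forall>\<tau>. \<tau> \<subseteq> \<sigma> \<and> \<tau> \<noteq> {} \<longrightarrow> \<tau> \<in> K) \<and>
     (\<forall>\<sigma>\<in>K. \<forall>\<tau>\<in>K. convex hull \<sigma> \<inter> convex hull \<tau> = convex hull (\<sigma> \<inter> \<tau>))"

definition locally_finite_complex :: "'v set set \<Rightarrow> bool" where
  "locally_finite_complex K \<longleftrightarrow> (\<forall>v. finite {\<sigma>\<in>K. v \<in> \<sigma>})"

definition p_simplices :: "nat \<Rightarrow> 'v set set \<Rightarrow> 'v set set" where
  "p_simplices p K = {\<sigma>\<in>K. card \<sigma> = p + 1}"

definition complex_of_dim :: "nat \<Rightarrow> 'v set set \<Rightarrow> bool" where
  "complex_of_dim n K \<longleftrightarrow> (\<forall>\<sigma>\<in>K. card \<sigma> \<le> n + 1) \<and> p_simplices n K \<noteq> {}"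

definition barycenter :: "'v::real_vector set \<Rightarrow> 'v" where
  "barycenter \<sigma> = (1 / real (card \<sigma>)) *\<^sub>R (\<Sum>v\<in>\<sigma>. v)"

text \<open>The simplices of the subdivision are spanned by the barycenters of flags of simplices.\<close>

definition Sd :: "'v::real_vector set set \<Rightarrow> 'v set set" where
  "Sd K = {barycenter ` C | C. subset.chain K C \<and> finite C \<and> C \<noteq> {}}"

section \<open>The underlying space\<close>

definition underlying_set :: "'v::real_vector set set \<Rightarrow> 'v set" where
  "underlying_set K = (\<Union>\<sigma>\<in>K. convex hull \<sigma>)"

text \<open>
  The simplicial isomorphism from the standard simplex of the appropriate dimension onto the
  convex hull of \<open>\<sigma>\<close>, for an arbitrary but fixed enumeration of the vertices of \<open>\<sigma>\<close>. Another
  enumeration amounts to permuting the coordinates of the standard simplex.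
\<close>

definition vertex_enum :: "'v set \<Rightarrow> nat \<Rightarrow> 'v" where
  "vertex_enum \<sigma> = (SOME v. bij_betw v {..card \<sigma> - 1} \<sigma>)"

definition simplex_iso :: "'v::real_vector set \<Rightarrow> (nat \<Rightarrow> real) \<Rightarrow> 'v" where
  "simplex_iso \<sigma> x = (\<Sum>i\<le>card \<sigma> - 1. x i *\<^sub>R vertex_enum \<sigma> i)"

lemma bij_betw_vertex_enum:
  assumes "finite \<sigma>" "\<sigma> \<noteq> {}"
  shows "bij_betw (vertex_enum \<sigma>) {..card \<sigma> - 1} \<sigma>"
proof -
  have "{..card \<sigma> - 1} = {0..<card \<sigma>}"
    using assms by (simp add: lessThan_Suc_atMost[symmetric] atLeast0LessThan card_gt_0_iff)
  then have "\<exists>v. bij_betw v {..card \<sigma> - 1} \<sigma>"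
    using ex_bij_betw_nat_finite[OF assms(1)] by simp
  then show ?thesis
    unfolding vertex_enum_def by (rule someI_ex)
qed

lemma simplex_iso_image:
  assumes "finite \<sigma>" "\<sigma> \<noteq> {}"
  shows "simplex_iso \<sigma> ` standard_simplex (card \<sigma> - 1) = convex hull \<sigma>"
proof -
  let ?m = "card \<sigma> - 1" and ?v = "vertex_enum \<sigma>"
  have b: "bij_betw ?v {..?m} \<sigma>"
    using assms by (rule bij_betw_vertex_enum)
  have "simplex_iso \<sigma> x \<in> convex hull \<sigma>" if "x \<in> standard_simplex ?m" for x
    unfolding simplex_iso_def
  proof (rule convex_sum)
    fix i assume "i \<in> {..?m}"
    then show "?v i \<in> convex hull \<sigma>"
      by (intro hull_inc bij_betw_apply[OF b])
  qed (use that in \<open>auto simp: standard_simplex_def\<close>)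
  moreover have "y \<in> simplex_iso \<sigma> ` standard_simplex ?m" if y: "y \<in> convex hull \<sigma>" for y
  proof -
    obtain u where u: "\<And>v. v \<in> \<sigma> \<Longrightarrow> 0 \<le> u v" "sum u \<sigma> = 1" "(\<Sum>v\<in>\<sigma>. u v *\<^sub>R v) = y"
      using y unfolding convex_hull_finite[OF assms(1)] by auto
    define x where "x i = (if i \<le> ?m then u (?v i) else 0)" for i
    have s: "(\<Sum>i\<le>?m. x i) = 1"
      using sum.reindex_bij_betw[OF b, of u] u(2) by (simp add: x_def)
    have nn: "0 \<le> x i" for i
      using u(1)[OF bij_betw_apply[OF b, of i]] by (simp add: x_def)
    have "x i \<le> 1" for i
    proof (cases "i \<le> ?m")
      case True
      then have "x i \<le> (\<Sum>j\<le>?m. x j)" by (intro member_le_sum nn) auto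
      with s show ?thesis by linarith
    qed (simp add: x_def)
    then have "x \<in> standard_simplex ?m"
      using nn s unfolding standard_simplex_def by (simp add: x_def)
    moreover have "simplex_iso \<sigma> x = y"
      using sum.reindex_bij_betw[OF b, of "\<lambda>v. u v *\<^sub>R v"] u(3)
      by (simp add: simplex_iso_def x_def)
    ultimately show ?thesis by blast
  qed
  ultimately show ?thesis by blast
qed

text \<open>The underlying space carries the weak (coherent) topology.\<close>

definition underlying_space :: "'v::real_vector set set \<Rightarrow> 'v topology" where
  "underlying_space K = topology (\<lambda>U. U \<subseteq> underlying_set K \<and>
     (\<forall>\<sigma>\<in>K. openin (top_of_set (standard_simplex (card \<sigma> - 1)))
               {x \<in> standard_simplex (card \<sigma> - 1). simplex_iso \<sigma> x \<in> U}))"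

lemma openin_underlying_space:
  "openin (underlying_space K) U \<longleftrightarrow> U \<subseteq> underlying_set K \<and>
     (\<forall>\<sigma>\<in>K. openin (top_of_set (standard_simplex (card \<sigma> - 1)))
               {x \<in> standard_simplex (card \<sigma> - 1). simplex_iso \<sigma> x \<in> U})"
proof -
  let ?P = "\<lambda>\<sigma> U. {x \<in> standard_simplex (card \<sigma> - 1). simplex_iso \<sigma> x \<in> U}"
  have I: "?P \<sigma> (S \<inter> T) = ?P \<sigma> S \<inter> ?P \<sigma> T" for \<sigma> :: "'a set" and S T by auto
  have U: "?P \<sigma> (\<Union>\<U>) = (\<Union>S\<in>\<U>. ?P \<sigma> S)" for \<sigma> :: "'a set" and \<U> by auto
  have "istopology (\<lambda>U. U \<subseteq> underlying_set K \<and>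
     (\<forall>\<sigma>\<in>K. openin (top_of_set (standard_simplex (card \<sigma> - 1))) (?P \<sigma> U)))"
    unfolding istopology_def
  proof (intro conjI allI impI ballI)
    fix \<U> \<sigma>
    assume "\<forall>U\<in>\<U>. U \<subseteq> underlying_set K \<and>
      (\<forall>\<sigma>\<in>K. openin (top_of_set (standard_simplex (card \<sigma> - 1))) (?P \<sigma> U))" "\<sigma> \<in> K"
    then show "openin (top_of_set (standard_simplex (card \<sigma> - 1))) (?P \<sigma> (\<Union>\<U>))"
      unfolding U by (intro openin_Union) auto
  next
    fix S T \<sigma>
    assume "S \<subseteq> underlying_set K \<and>
        (\<forall>\<sigma>\<in>K. openin (top_of_set (standard_simplex (card \<sigma> - 1))) (?P \<sigma> S))"
      "T \<subseteq> underlying_set K \<and>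
        (\<forall>\<sigma>\<in>K. openin (top_of_set (standard_simplex (card \<sigma> - 1))) (?P \<sigma> T))" "\<sigma> \<in> K"
    then show "openin (top_of_set (standard_simplex (card \<sigma> - 1))) (?P \<sigma> (S \<inter> T))"
      unfolding I by (intro openin_Int) auto
  qed auto
  then show ?thesis
    unfolding underlying_space_def by (simp only: topology_inverse')
qed

lemma topspace_underlying_space:
  assumes "geometric_complex K"
  shows "topspace (underlying_space K) = underlying_set K"
proof -
  have "{x \<in> standard_simplex (card \<sigma> - 1). simplex_iso \<sigma> x \<in> underlying_set K}
      = standard_simplex (card \<sigma> - 1)" if "\<sigma> \<in> K" for \<sigma>
  proof -
    have "simplex_iso \<sigma> ` standard_simplex (card \<sigma> - 1) = convex hull \<sigma>"
      using assms that by (intro simplex_iso_image) (auto simp: geometric_complex_def)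
    with that show ?thesis
      unfolding underlying_set_def by blast
  qed
  then have "openin (underlying_space K) (underlying_set K)"
    unfolding openin_underlying_space by simp
  moreover have "topspace (underlying_space K) \<subseteq> underlying_set K"
    using openin_topspace[of "underlying_space K"] unfolding openin_underlying_space by blast
  ultimately show ?thesis
    using openin_subset by blast
qed

definition underlying_borel :: "'v::real_vector set set \<Rightarrow> 'v measure" where
  "underlying_borel K = sigma (underlying_set K) {U. openin (underlying_space K) U}"

lemma space_underlying_borel [simp]: "space (underlying_borel K) = underlying_set K"
  and sets_underlying_borel:
    "sets (underlying_borel K) = sigma_sets (underlying_set K) {U. openin (underlying_space K) U}"
proof -
  have "{U. openin (underlying_space K) U} \<subseteq> Pow (underlying_set K)"
    by (auto simp: openin_underlying_space)
  then show "space (underlying_borel K) = underlying_set K"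
    and "sets (underlying_borel K) = sigma_sets (underlying_set K) {U. openin (underlying_space K) U}"
    by (simp_all add: underlying_borel_def space_measure_of_conv)
qed

section \<open>Measures\<close>

text \<open>The sum, over a possibly infinite index set, of measures on the measurable space of \<open>N\<close>.\<close>

definition sum_measure :: "'a measure \<Rightarrow> 'i set \<Rightarrow> ('i \<Rightarrow> 'a measure) \<Rightarrow> 'a measure" where
  "sum_measure N I M =
     measure_of (space N) (sets N) (\<lambda>A. \<integral>\<^sup>+ i. emeasure (M i) A \<partial>count_space I)"

lemma emeasure_sum_measure:
  assumes "\<And>i. i \<in> I \<Longrightarrow> sets (M i) = sets N" and "A \<in> sets N"
  shows "emeasure (sum_measure N I M) A = (\<integral>\<^sup>+ i. emeasure (M i) A \<partial>count_space I)"
  unfolding sum_measure_def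
proof (rule emeasure_measure_of_sigma)
  show "sigma_algebra (space N) (sets N)" ..
  show "positive (sets N) (\<lambda>A. \<integral>\<^sup>+ i. emeasure (M i) A \<partial>count_space I)"
    by (auto simp: positive_def)
  show "countably_additive (sets N) (\<lambda>A. \<integral>\<^sup>+ i. emeasure (M i) A \<partial>count_space I)"
    unfolding countably_additive_def
  proof (intro allI impI)
    fix B :: "nat \<Rightarrow> _"
    assume B: "range B \<subseteq> sets N" "disjoint_family B"
    have "suminf (\<lambda>j. \<integral>\<^sup>+ i. emeasure (M i) (B j) \<partial>count_space I)
        = (\<integral>\<^sup>+ i. suminf (\<lambda>j. emeasure (M i) (B j)) \<partial>count_space I)"
      by (rule nn_integral_suminf[symmetric]) auto
    also have "\<dots> = (\<integral>\<^sup>+ i. emeasure (M i) (\<Union>(range B)) \<partial>count_space I)"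
      using B assms(1) by (intro nn_integral_cong suminf_emeasure) auto
    finally show "suminf (\<lambda>j. \<integral>\<^sup>+ i. emeasure (M i) (B j) \<partial>count_space I)
        = (\<integral>\<^sup>+ i. emeasure (M i) (\<Union>(range B)) \<partial>count_space I)" .
  qed
qed (rule assms(2))

text \<open>
  Normalized Lebesgue measure on the standard simplex, transported by the affine chart that
  forgets coordinate 0 from the Lebesgue measure of \<open>{t \<in> \<real>\<^sup>n. t \<ge> 0, t\<^sub>1 + \<dots> + t\<^sub>n \<le> 1}\<close>.
\<close>

definition corner_simplex :: "nat \<Rightarrow> (nat \<Rightarrow> real) set" where
  "corner_simplex n = {t \<in> {1..n} \<rightarrow>\<^sub>E UNIV. (\<forall>i\<in>{1..n}. 0 \<le> t i) \<and> (\<Sum>i=1..n. t i) \<le> 1}"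

definition simplex_chart :: "nat \<Rightarrow> (nat \<Rightarrow> real) \<Rightarrow> nat \<Rightarrow> real" where
  "simplex_chart n t = (\<lambda>i. if i = 0 then 1 - (\<Sum>j=1..n. t j) else if i \<le> n then t i else 0)"

definition corner_lebesgue :: "nat \<Rightarrow> (nat \<Rightarrow> real) measure" where
  "corner_lebesgue n = restrict_space (\<Pi>\<^sub>M i\<in>{1..n}. lborel) (corner_simplex n)"

definition simplex_volume :: "nat \<Rightarrow> (nat \<Rightarrow> real) measure" where
  "simplex_volume n =
     distr (uniform_measure (corner_lebesgue n) (space (corner_lebesgue n)))
       (restrict_space borel (standard_simplex n)) (simplex_chart n)"

lemma corner_simplex_sets: "corner_simplex n \<in> sets (\<Pi>\<^sub>M i\<in>{1..n}. (lborel :: real measure))"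
proof -
  have "corner_simplex n =
    {t \<in> space (\<Pi>\<^sub>M i\<in>{1..n}. (lborel :: real measure)). (\<forall>i\<in>{1..n}. 0 \<le> t i) \<and> (\<Sum>i=1..n. t i) \<le> 1}"
    by (auto simp: corner_simplex_def space_PiM)
  also have "\<dots> \<in> sets (\<Pi>\<^sub>M i\<in>{1..n}. (lborel :: real measure))"
    by measurable
  finally show ?thesis .
qed

lemma space_corner_lebesgue: "space (corner_lebesgue n) = corner_simplex n"
  by (auto simp: corner_lebesgue_def space_restrict_space space_PiM corner_simplex_def)

lemma emeasure_corner_lebesgue: "emeasure (corner_lebesgue n) (corner_simplex n) = 1 / fact n"
proof -
  have eq: "{x. (\<forall>i\<in>{1..n}. 0 \<le> x i) \<and> sum x {1..n} \<le> 1} \<inter> space (\<Pi>\<^sub>M i\<in>{1..n}. (lborel :: real measure))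
      = corner_simplex n"
    by (auto simp: corner_simplex_def space_PiM)
  have "emeasure (corner_lebesgue n) (corner_simplex n)
      = emeasure (\<Pi>\<^sub>M i\<in>{1..n}. (lborel :: real measure)) (corner_simplex n)"
    unfolding corner_lebesgue_def using corner_simplex_sets[of n]
    by (subst emeasure_restrict_space) (auto simp: sets.Int_space_eq1 sets.Int_space_eq2)
  also have "\<dots> = ennreal (1 / fact n)"
    using emeasure_std_simplex_aux[of "{1..n}" 1] unfolding eq by simp
  finally show ?thesis
    by (simp add: divide_ennreal[symmetric] ennreal_fact)
qed

lemma simplex_chart_measurable:
  "simplex_chart n \<in> corner_lebesgue n \<rightarrow>\<^sub>M restrict_space borel (standard_simplex n)"
proof (rule measurable_restrict_space2)
  have ins: "{..n} = insert 0 {1..n}" by auto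
  have "simplex_chart n t \<in> standard_simplex n" if t: "t \<in> corner_simplex n" for t
  proof -
    let ?x = "simplex_chart n t"
    have nn: "0 \<le> ?x i" for i
      using t by (auto simp: simplex_chart_def corner_simplex_def)
    have "(\<Sum>i=1..n. ?x i) = (\<Sum>i=1..n. t i)"
      by (rule sum.cong) (auto simp: simplex_chart_def)
    then have s: "(\<Sum>i\<le>n. ?x i) = 1"
      unfolding ins by (subst sum.insert) (auto simp: simplex_chart_def)
    have z: "?x i = 0" if "i > n" for i
      using that by (simp add: simplex_chart_def)
    have "?x i \<le> 1" for i
    proof (cases "i \<le> n")
      case True
      then have "?x i \<le> (\<Sum>j\<le>n. ?x j)" by (intro member_le_sum nn) auto
      with s show ?thesis by linarith
    qed (simp add: z)
    with nn s z show ?thesis by (auto simp: standard_simplex_def)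
  qed
  then show "simplex_chart n \<in> space (corner_lebesgue n) \<rightarrow> standard_simplex n"
    by (auto simp: space_corner_lebesgue)
  have "(\<lambda>t. simplex_chart n t i) \<in> borel_measurable (\<Pi>\<^sub>M i\<in>{1..n}. (lborel :: real measure))" for i
    by (cases "i = 0"; cases "i \<le> n") (auto simp: simplex_chart_def)
  then have "simplex_chart n \<in> borel_measurable (\<Pi>\<^sub>M i\<in>{1..n}. (lborel :: real measure))"
    by (rule measurable_coordinatewise_then_product)
  then show "simplex_chart n \<in> borel_measurable (corner_lebesgue n)"
    unfolding corner_lebesgue_def by (rule measurable_restrict_space1)
qed

lemma prob_space_simplex_volume: "prob_space (simplex_volume n)"
proof -
  have "prob_space (uniform_measure (corner_lebesgue n) (space (corner_lebesgue n)))"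
    by (rule prob_space_uniform_measure)
       (auto simp: space_corner_lebesgue emeasure_corner_lebesgue ennreal_divide_eq_top_iff ennreal_divide_eq_0_iff)
  then show ?thesis
    unfolding simplex_volume_def
    by (rule prob_space.prob_space_distr)
       (use simplex_chart_measurable in \<open>simp add: measurable_def\<close>)
qed

lemma simplex_iso_measurable:
  assumes "geometric_complex K" "\<sigma> \<in> K"
  shows "simplex_iso \<sigma> \<in> restrict_space borel (standard_simplex (card \<sigma> - 1)) \<rightarrow>\<^sub>M underlying_borel K"
  unfolding underlying_borel_def
proof (rule measurable_measure_of)
  show "{U. openin (underlying_space K) U} \<subseteq> Pow (underlying_set K)"
    by (auto simp: openin_underlying_space)
  show "simplex_iso \<sigma> \<in> space (restrict_space borel (standard_simplex (card \<sigma> - 1))) \<rightarrow> underlying_set K"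
  proof -
    have "simplex_iso \<sigma> ` standard_simplex (card \<sigma> - 1) = convex hull \<sigma>"
      using assms by (intro simplex_iso_image) (auto simp: geometric_complex_def)
    with assms(2) show ?thesis
      unfolding space_restrict_space underlying_set_def by auto
  qed
  fix U assume "U \<in> {U. openin (underlying_space K) U}"
  then have "openin (top_of_set (standard_simplex (card \<sigma> - 1)))
      {x \<in> standard_simplex (card \<sigma> - 1). simplex_iso \<sigma> x \<in> U}"
    using assms(2) by (simp only: mem_Collect_eq openin_underlying_space)
  then obtain T where T: "open T"
    "{x \<in> standard_simplex (card \<sigma> - 1). simplex_iso \<sigma> x \<in> U} = standard_simplex (card \<sigma> - 1) \<inter> T"
    unfolding openin_open by metis
  have "simplex_iso \<sigma> -` U \<inter> space (restrict_space borel (standard_simplex (card \<sigma> - 1)))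
      = {x \<in> standard_simplex (card \<sigma> - 1). simplex_iso \<sigma> x \<in> U}"
    by (auto simp: space_restrict_space)
  also have "\<dots> \<in> sets (restrict_space borel (standard_simplex (card \<sigma> - 1)))"
    unfolding T(2) sets_restrict_space using T(1) by (intro imageI borel_open)
  finally show "simplex_iso \<sigma> -` U \<inter> space (restrict_space borel (standard_simplex (card \<sigma> - 1)))
      \<in> sets (restrict_space borel (standard_simplex (card \<sigma> - 1)))" .
qed

text \<open>\<open>dvol n K\<close> and \<open>gamma n d p K\<close> are meant for complexes \<open>K\<close> of dimension \<open>n\<close>.\<close>

definition dvol :: "nat \<Rightarrow> 'v::real_vector set set \<Rightarrow> 'v measure" where
  "dvol n K = sum_measure (underlying_borel K) (p_simplices n K)
     (\<lambda>\<sigma>. distr (simplex_volume n) (underlying_borel K) (simplex_iso \<sigma>))"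

definition gamma :: "nat \<Rightarrow> nat \<Rightarrow> nat \<Rightarrow> 'v::real_vector set set \<Rightarrow> 'v measure" where
  "gamma n d p K = scale_measure (ennreal (1 / fact (n + 1) ^ d))
     (sum_measure (underlying_borel K) (p_simplices p ((Sd ^^ d) K))
       (\<lambda>\<sigma>. return (underlying_borel K) (barycenter \<sigma>)))"

text \<open>
  The common limit over all finite complexes \<open>L\<close> of dimension \<open>n\<close>. Up to isomorphism, these all
  live in \<open>nat \<Rightarrow>\<^sub>0 real\<close>, the real vector space with a countable basis.
\<close>

definition q_lim :: "nat \<Rightarrow> nat \<Rightarrow> real" where
  "q_lim p n = (THE l. \<forall>L :: (nat \<Rightarrow>\<^sub>0 real) set set.
     finite L \<and> geometric_complex L \<and> complex_of_dim n L \<longrightarrow>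
     (\<lambda>d. real (card (p_simplices p ((Sd ^^ d) L))) / (fact (n + 1) ^ d * real (card (p_simplices n L))))
       \<longlonglongrightarrow> l)"

end

theory Submission
  imports Defs "HOL-Combinatorics.Permutations"
begin

text \<open>
  Group the simplices of \<open>Sd\<^sup>d K\<close> by the simplex \<open>\<sigma>\<close> of \<open>K\<close> whose interior contains their interior.
  Since \<open>Sd\<^sup>d\<^sup>+\<^sup>1 K = Sd\<^sup>d (Sd K)\<close>, the contribution of \<open>\<sigma>\<close> after \<open>d + 1\<close> subdivisions is the sum
  over all flags with top \<open>\<sigma>\<close> of their contributions after \<open>d\<close> subdivisions. Only the full flags
  matter after division by \<open>(n + 1)!\<^sup>d\<close>: with the constant test function this gives the convergence
  of the counts, and in general it says that the contribution of \<open>\<sigma>\<close> is, up to a vanishing error,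
  the average of the contributions of the \<open>(n + 1)!\<close> top simplices of \<open>Sd \<sigma>\<close>. Lebesgue measure
  satisfies the same averaging identity exactly. Passing from \<open>\<sigma>\<close> to a simplex of its subdivision
  contracts the \<open>\<ell>\<^sup>1\<close>-distance of barycentric coordinates by \<open>n / (n + 1)\<close>, so that after enough
  steps the test function is almost constant on each piece, and both averages can be compared.
\<close>

text \<open>The ambient vector space carries no topology, so continuity, measurability and smallness
  of pieces are all expressed in the barycentric coordinates of a single simplex. Uniqueness of
  weights, which survives \<open>Sd\<close>, takes the place of affine independence. The delicate
  point of the limit is uniformity. An averaging step replaces one simplex by others living in
  another complex, and it is iterated a fixed number of times before the number of subdivisions
  tends to infinity. The threshold for that number must therefore serve all simplices and test
  functions with the same bounds at once. The error caused by oscillation passes through an average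
  unchanged, whereas each step adds the share of the shorter flags; that share is bounded by an
  increment of a convergent sequence of counts. A flag of \<open>j < m\<close> faces contributes at
  most of order \<open>j!^d\<close>, which loses against \<open>m!^d\<close>. Finally
  \<open>(n + 1)!\<close> has two roles, as the number of full flags and as the inverse determinant
  of the map onto one piece; their agreement makes Lebesgue measure average exactly.\<close>

section \<open>Simplicial complexes in barycentric coordinates\<close>

text \<open>Weights are total functions vanishing off \<sigma>, so that points of different
  simplices can be compared by plain equality of weights, and weights of a face are literally
  weights of the simplex.\<close>

definition simplex_weights :: "'v set \<Rightarrow> ('v \<Rightarrow> real) set" where
  "simplex_weights \<sigma> = {u. (\<forall>v. 0 \<le> u v) \<and> (\<forall>v. v \<notin> \<sigma> \<longrightarrow> u v = 0) \<and> sum u \<sigma> = 1}"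

text \<open>
  Equivalent to \<open>geometric_complex\<close>, but in terms of barycentric coordinates, where passing to the
  barycentric subdivision is a purely combinatorial operation on weights.
\<close>

definition simplicial :: "'v::real_vector set set \<Rightarrow> bool" where
  "simplicial K \<longleftrightarrow>
     (\<forall>\<sigma>\<in>K. finite \<sigma> \<and> \<sigma> \<noteq> {}) \<and>
     (\<forall>\<sigma>\<in>K. \<forall>\<tau>. \<tau> \<subseteq> \<sigma> \<and> \<tau> \<noteq> {} \<longrightarrow> \<tau> \<in> K) \<and>
     (\<forall>\<sigma>\<in>K. \<forall>\<tau>\<in>K. \<forall>u\<in>simplex_weights \<sigma>. \<forall>w\<in>simplex_weights \<tau>.
        (\<Sum>v\<in>\<sigma>. u v *\<^sub>R v) = (\<Sum>v\<in>\<tau>. w v *\<^sub>R v) \<longrightarrow> u = w)"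

lemma simplicialD:
  assumes "simplicial K" "\<sigma> \<in> K"
  shows "finite \<sigma>" "\<sigma> \<noteq> {}" "\<And>\<tau>. \<tau> \<subseteq> \<sigma> \<Longrightarrow> \<tau> \<noteq> {} \<Longrightarrow> \<tau> \<in> K" "card \<sigma> > 0"
proof -
  note s = assms(1)[unfolded simplicial_def]
  show *: "finite \<sigma>" "\<sigma> \<noteq> {}"
    using bspec[OF conjunct1[OF s] assms(2)] by simp_all
  show "\<tau> \<in> K" if "\<tau> \<subseteq> \<sigma>" "\<tau> \<noteq> {}" for \<tau>
    using bspec[OF conjunct1[OF conjunct2[OF s]] assms(2)] that by simp
  show "card \<sigma> > 0"
    using * by (simp add: card_gt_0_iff)
qed

lemma simplicial_weights_unique:
  assumes "simplicial K" "\<sigma> \<in> K" "\<tau> \<in> K" "u \<in> simplex_weights \<sigma>" "w \<in> simplex_weights \<tau>"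
    "(\<Sum>v\<in>\<sigma>. u v *\<^sub>R v) = (\<Sum>v\<in>\<tau>. w v *\<^sub>R v)"
  shows "u = w"
proof -
  note s = conjunct2[OF conjunct2[OF assms(1)[unfolded simplicial_def]]]
  show ?thesis
    by (rule bspec[OF bspec[OF bspec[OF bspec[OF s assms(2)] assms(3)] assms(4)] assms(5), rule_format])
       (rule assms(6))
qed

lemma convex_hull_simplex_weights:
  fixes \<sigma> :: "'v::real_vector set"
  assumes "finite \<sigma>"
  shows "convex hull \<sigma> = {\<Sum>v\<in>\<sigma>. u v *\<^sub>R v | u. u \<in> simplex_weights \<sigma>}"
proof -
  have "\<exists>u'. (\<Sum>v\<in>\<sigma>. u v *\<^sub>R v) = (\<Sum>v\<in>\<sigma>. u' v *\<^sub>R v) \<and> u' \<in> simplex_weights \<sigma>"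
    if "\<forall>v\<in>\<sigma>. 0 \<le> u v" "sum u \<sigma> = 1" for u
    using that by (intro exI[of _ "\<lambda>v. if v \<in> \<sigma> then u v else 0"]) (auto simp: simplex_weights_def)
  then show ?thesis
    unfolding convex_hull_finite[OF assms] by (auto simp: simplex_weights_def; blast)
qed

lemma simplex_weights_mono:
  assumes "\<tau> \<subseteq> \<sigma>" "finite \<sigma>" "u \<in> simplex_weights \<tau>"
  shows "u \<in> simplex_weights \<sigma>" "(\<Sum>v\<in>\<sigma>. u v *\<^sub>R v) = (\<Sum>v\<in>\<tau>. u v *\<^sub>R (v::'v::real_vector))"
proof -
  have "sum u \<sigma> = sum u \<tau>"
    by (rule sum.mono_neutral_right) (use assms in \<open>auto simp: simplex_weights_def\<close>)
  then show "u \<in> simplex_weights \<sigma>"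
    using assms by (auto simp: simplex_weights_def)
  show "(\<Sum>v\<in>\<sigma>. u v *\<^sub>R v) = (\<Sum>v\<in>\<tau>. u v *\<^sub>R v)"
    by (rule sum.mono_neutral_right) (use assms in \<open>auto simp: simplex_weights_def\<close>)
qed

lemma affine_independent_weights_unique:
  fixes \<sigma> :: "'v::real_vector set"
  assumes "finite \<sigma>" "\<not> affine_dependent \<sigma>" "u \<in> simplex_weights \<sigma>" "w \<in> simplex_weights \<sigma>"
    "(\<Sum>v\<in>\<sigma>. u v *\<^sub>R v) = (\<Sum>v\<in>\<sigma>. w v *\<^sub>R v)"
  shows "u = w"
proof
  fix v
  have "sum (\<lambda>v. u v - w v) \<sigma> = 0" "(\<Sum>v\<in>\<sigma>. (u v - w v) *\<^sub>R v) = 0"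
    using assms by (auto simp: simplex_weights_def sum_subtractf scaleR_left_diff_distrib)
  then have "\<forall>v\<in>\<sigma>. u v - w v = 0"
    using assms(1,2) unfolding affine_dependent_explicit_finite[OF assms(1)] by blast
  then show "u v = w v"
    using assms(3,4) by (cases "v \<in> \<sigma>") (auto simp: simplex_weights_def)
qed

text \<open>A common point lies in the hull of \<open>\<sigma> \<inter> \<tau>\<close> and so has
  weights \<open>z\<close> supported there; affine independence of each simplex then forces
  \<open>u = z\<close> and \<open>w = z\<close>.\<close>

lemma geometric_complex_imp_simplicial:
  assumes "geometric_complex K"
  shows "simplicial K"
  unfolding simplicial_def
proof (intro conjI ballI impI allI)
  fix \<sigma> assume "\<sigma> \<in> K"
  then show "finite \<sigma>" "\<sigma> \<noteq> {}" using assms unfolding geometric_complex_def by blast+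
next
  fix \<sigma> \<tau> assume "\<sigma> \<in> K" "\<tau> \<subseteq> \<sigma> \<and> \<tau> \<noteq> {}"
  then show "\<tau> \<in> K" using assms unfolding geometric_complex_def by blast
next
  fix \<sigma> \<tau> u w
  assume K: "\<sigma> \<in> K" "\<tau> \<in> K" and u: "u \<in> simplex_weights \<sigma>" and w: "w \<in> simplex_weights \<tau>"
    and eq: "(\<Sum>v\<in>\<sigma>. u v *\<^sub>R v) = (\<Sum>v\<in>\<tau>. w v *\<^sub>R v)"
  note g = assms[unfolded geometric_complex_def]
  have fin: "finite \<sigma>" "finite \<tau>" and ind: "\<not> affine_dependent \<sigma>" "\<not> affine_dependent \<tau>"
    using bspec[OF conjunct1[OF g] K(1)] bspec[OF conjunct1[OF g] K(2)] by simp_all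
  have int: "convex hull \<sigma> \<inter> convex hull \<tau> = convex hull (\<sigma> \<inter> \<tau>)"
    by (rule bspec[OF bspec[OF conjunct2[OF conjunct2[OF g]] K(1)] K(2)])
  have "finite (\<sigma> \<inter> \<tau>)" using fin by simp
  note fin = fin this
  have "(\<Sum>v\<in>\<sigma>. u v *\<^sub>R v) \<in> convex hull (\<sigma> \<inter> \<tau>)"
    unfolding int[symmetric] convex_hull_simplex_weights[OF fin(1)] convex_hull_simplex_weights[OF fin(2)]
    using u w eq by blast
  then obtain z where z: "z \<in> simplex_weights (\<sigma> \<inter> \<tau>)"
    "(\<Sum>v\<in>\<sigma>. u v *\<^sub>R v) = (\<Sum>v\<in>\<sigma> \<inter> \<tau>. z v *\<^sub>R v)"
    unfolding convex_hull_simplex_weights[OF fin(3)] by auto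
  have "u = z"
    using simplex_weights_mono[OF _ fin(1) z(1)] z(2)
    by (intro affine_independent_weights_unique[OF fin(1) ind(1) u]) auto
  moreover have "w = z"
    using simplex_weights_mono[OF _ fin(2) z(1)] z(2) eq
    by (intro affine_independent_weights_unique[OF fin(2) ind(2) w]) auto
  ultimately show "u = w" by simp
qed

section \<open>Barycenters and flags of faces\<close>

definition uniform_weights :: "'v set \<Rightarrow> 'v \<Rightarrow> real" where
  "uniform_weights \<sigma> v = (if v \<in> \<sigma> then 1 / real (card \<sigma>) else 0)"

lemma uniform_weights_in:
  assumes "finite \<sigma>" "\<sigma> \<noteq> {}"
  shows "uniform_weights \<sigma> \<in> simplex_weights \<sigma>"
  using assms by (simp add: simplex_weights_def uniform_weights_def card_gt_0_iff)

lemma barycenter_eq_uniform_weights: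
  "barycenter \<sigma> = (\<Sum>v\<in>\<sigma>. uniform_weights \<sigma> v *\<^sub>R v)"
  by (simp add: barycenter_def uniform_weights_def scaleR_right.sum)

lemma barycenter_in_hull:
  assumes "finite \<sigma>" "\<sigma> \<noteq> {}"
  shows "barycenter \<sigma> \<in> convex hull \<sigma>"
  using convex_hull_simplex_weights[OF assms(1)] uniform_weights_in[OF assms]
    barycenter_eq_uniform_weights[of \<sigma>] by auto

text \<open>The simplex is the support of the barycentric coordinates of its barycenter, and these
  coordinates are unique.\<close>

lemma inj_on_barycenter:
  assumes "simplicial K"
  shows "inj_on barycenter K"
proof (rule inj_onI)
  fix \<sigma> \<tau> assume K: "\<sigma> \<in> K" "\<tau> \<in> K" and "barycenter \<sigma> = barycenter \<tau>"
  then have "uniform_weights \<sigma> = uniform_weights \<tau>"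
    using simplicialD[OF assms]
    by (intro simplicial_weights_unique[OF assms K] uniform_weights_in)
       (auto simp: barycenter_eq_uniform_weights[symmetric])
  moreover have "\<sigma> = {v. uniform_weights \<sigma> v \<noteq> 0}" "\<tau> = {v. uniform_weights \<tau> v \<noteq> 0}"
    using simplicialD(4)[OF assms K(1)] simplicialD(4)[OF assms K(2)]
    by (auto simp: uniform_weights_def)
  ultimately show "\<sigma> = \<tau>" by simp
qed

text \<open>Chains of nonempty faces with top \<sigma>. Neither a complex nor a vector space
  structure is mentioned, so that flags can also be counted on the model set
  \<open>{..<m}\<close>.\<close>

definition flags :: "'v set \<Rightarrow> 'v set set set" where
  "flags \<sigma> = {C. subset.chain (Pow \<sigma> - {{}}) C \<and> \<sigma> \<in> C}"

lemma flagsD: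
  assumes "C \<in> flags \<sigma>"
  shows "\<sigma> \<in> C" "\<And>A. A \<in> C \<Longrightarrow> A \<subseteq> \<sigma>" "\<And>A. A \<in> C \<Longrightarrow> A \<noteq> {}"
    "\<And>A B. A \<in> C \<Longrightarrow> B \<in> C \<Longrightarrow> A \<subseteq> B \<or> B \<subseteq> A" "\<Union>C = \<sigma>"
  using assms by (auto simp: flags_def subset_chain_def)

lemma finite_flags:
  assumes "finite \<sigma>"
  shows "finite (flags \<sigma>)" "C \<in> flags \<sigma> \<Longrightarrow> finite C"
    "C \<in> flags \<sigma> \<Longrightarrow> A \<in> C \<Longrightarrow> finite A"
proof -
  have s: "flags \<sigma> \<subseteq> Pow (Pow \<sigma>)"
    by (auto simp: flags_def subset_chain_def)
  then show "finite (flags \<sigma>)"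
    by (rule finite_subset) (use assms in auto)
  show "finite C" if "C \<in> flags \<sigma>"
    using s that assms by (auto intro: finite_subset[of C "Pow \<sigma>"])
  show "finite A" if "C \<in> flags \<sigma>" "A \<in> C"
    using s that assms by (auto intro: finite_subset[of A \<sigma>])
qed

lemma flags_disjoint:
  assumes "C \<in> flags \<sigma>" "C \<in> flags \<tau>"
  shows "\<sigma> = \<tau>"
  using flagsD(5)[OF assms(1)] flagsD(5)[OF assms(2)] by simp

lemma flags_subset_complex:
  assumes "simplicial K" "\<sigma> \<in> K" "C \<in> flags \<sigma>"
  shows "C \<subseteq> K"
proof
  fix A assume A: "A \<in> C"
  show "A \<in> K"
    by (rule simplicialD(3)[OF assms(1,2) flagsD(2,3)[OF assms(3) A]])
qed

text \<open>A finite nonempty chain has its union as largest member, so each simplex of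
  \<open>Sd K\<close> can be filed under the top of its flag.\<close>

lemma Sd_eq_flags:
  assumes "simplicial K"
  shows "Sd K = (\<Union>\<sigma>\<in>K. (\<lambda>C. barycenter ` C) ` flags \<sigma>)"
proof (intro equalityI subsetI)
  fix \<rho> assume "\<rho> \<in> Sd K"
  then obtain C where C: "\<rho> = barycenter ` C" "subset.chain K C" "finite C" "C \<noteq> {}"
    by (auto simp: Sd_def)
  have "\<Union>C \<in> C"
    using C by (intro Union_in_chain) auto
  then have "C \<in> flags (\<Union>C)" "\<Union>C \<in> K"
    using C simplicialD(2)[OF assms] by (auto simp: flags_def subset_chain_def)
  with C(1) show "\<rho> \<in> (\<Union>\<sigma>\<in>K. (\<lambda>C. barycenter ` C) ` flags \<sigma>)" by blast
next
  fix \<rho> assume "\<rho> \<in> (\<Union>\<sigma>\<in>K. (\<lambda>C. barycenter ` C) ` flags \<sigma>)"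
  then obtain \<sigma> C where C: "\<sigma> \<in> K" "C \<in> flags \<sigma>" "\<rho> = barycenter ` C" by auto
  have "subset.chain K C"
    using flags_subset_complex[OF assms C(1,2)] flagsD(4)[OF C(2)] by (auto simp: subset_chain_def)
  moreover have "finite C" "C \<noteq> {}"
    using finite_flags(2)[OF simplicialD(1)[OF assms C(1)] C(2)] flagsD(1)[OF C(2)] by auto
  ultimately show "\<rho> \<in> Sd K"
    using C(3) by (auto simp: Sd_def)
qed

text \<open>The coordinates, with respect to the original vertices, of a point of the subdivision.\<close>

definition push_weights :: "'v::real_vector set set \<Rightarrow> ('v \<Rightarrow> real) \<Rightarrow> 'v \<Rightarrow> real" where
  "push_weights C u v = (\<Sum>A\<in>C. u (barycenter A) * uniform_weights A v)"

lemma push_weights_point: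
  assumes "finite \<sigma>" "C \<in> flags \<sigma>" "inj_on barycenter C"
  shows "(\<Sum>v\<in>\<sigma>. push_weights C u v *\<^sub>R v) = (\<Sum>r\<in>barycenter ` C. u r *\<^sub>R r)"
proof -
  have "(\<Sum>v\<in>\<sigma>. push_weights C u v *\<^sub>R v)
      = (\<Sum>A\<in>C. \<Sum>v\<in>\<sigma>. (u (barycenter A) * uniform_weights A v) *\<^sub>R v)"
    unfolding push_weights_def scaleR_sum_left by (rule sum.swap)
  also have "\<dots> = (\<Sum>A\<in>C. u (barycenter A) *\<^sub>R barycenter A)"
  proof (rule sum.cong[OF refl])
    fix A assume A: "A \<in> C"
    have "(\<Sum>v\<in>\<sigma>. (u (barycenter A) * uniform_weights A v) *\<^sub>R v)
        = (\<Sum>v\<in>A. (u (barycenter A) * uniform_weights A v) *\<^sub>R v)"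
      using flagsD(2)[OF assms(2) A] assms(1)
      by (intro sum.mono_neutral_right) (auto simp: uniform_weights_def)
    then show "(\<Sum>v\<in>\<sigma>. (u (barycenter A) * uniform_weights A v) *\<^sub>R v)
        = u (barycenter A) *\<^sub>R barycenter A"
      by (simp add: barycenter_eq_uniform_weights[of A] scaleR_right.sum)
  qed
  also have "\<dots> = (\<Sum>r\<in>barycenter ` C. u r *\<^sub>R r)"
    using assms(3) by (simp add: sum.reindex)
  finally show ?thesis .
qed

lemma push_weights_in:
  assumes "finite \<sigma>" "C \<in> flags \<sigma>" "inj_on barycenter C" "u \<in> simplex_weights (barycenter ` C)"
  shows "push_weights C u \<in> simplex_weights \<sigma>"
proof -
  have nn: "0 \<le> u r" for r
    using assms(4) by (simp add: simplex_weights_def)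
  have "sum (push_weights C u) \<sigma> = (\<Sum>A\<in>C. u (barycenter A) * (\<Sum>v\<in>\<sigma>. uniform_weights A v))"
    unfolding push_weights_def sum_distrib_left by (rule sum.swap)
  also have "\<dots> = (\<Sum>A\<in>C. u (barycenter A))"
  proof (rule sum.cong[OF refl])
    fix A assume A: "A \<in> C"
    have "uniform_weights A \<in> simplex_weights \<sigma>"
      by (rule simplex_weights_mono(1)[OF flagsD(2)[OF assms(2) A] assms(1)
            uniform_weights_in[OF finite_flags(3)[OF assms(1,2) A] flagsD(3)[OF assms(2) A]]])
    then have "(\<Sum>v\<in>\<sigma>. uniform_weights A v) = 1"
      unfolding simplex_weights_def by blast
    then show "u (barycenter A) * (\<Sum>v\<in>\<sigma>. uniform_weights A v) = u (barycenter A)" by simp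
  qed
  also have "\<dots> = sum u (barycenter ` C)"
    using assms(3) by (simp add: sum.reindex)
  also have "\<dots> = 1"
    using assms(4) by (simp add: simplex_weights_def)
  finally have "sum (push_weights C u) \<sigma> = 1" .
  moreover have "push_weights C u v = 0" if "v \<notin> \<sigma>" for v
    unfolding push_weights_def using that flagsD(2)[OF assms(2)]
    by (intro sum.neutral ballI) (auto simp: uniform_weights_def)
  ultimately show ?thesis
    using nn by (auto simp: simplex_weights_def push_weights_def uniform_weights_def intro!: sum_nonneg)
qed

section \<open>Uniqueness of coordinates in the subdivision\<close>

text \<open>
  At a largest set \<open>A\<close> with \<open>a A > b A\<close>, evaluate at a point of \<open>A\<close> outside every smaller member
  of the second chain.
\<close>

lemma chain_coefficients_le:
  fixes a b :: "'v set \<Rightarrow> real"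
  assumes fin: "finite C" "finite D" "\<And>A. A \<in> C \<union> D \<Longrightarrow> finite A \<and> A \<noteq> {}"
    and D: "\<And>A B. A \<in> D \<Longrightarrow> B \<in> D \<Longrightarrow> A \<subseteq> B \<or> B \<subseteq> A"
    and a: "\<And>A. 0 \<le> a A" "\<And>A. A \<notin> C \<Longrightarrow> a A = 0"
    and b: "\<And>A. 0 \<le> b A" "\<And>A. A \<notin> D \<Longrightarrow> b A = 0"
    and eq: "\<And>v. (\<Sum>A\<in>C \<union> D. if v \<in> A then a A else 0) = (\<Sum>A\<in>C \<union> D. if v \<in> A then b A else 0)"
    and A: "A \<in> C \<union> D" "\<And>B. B \<in> C \<union> D \<Longrightarrow> a B \<noteq> b B \<Longrightarrow> card B \<le> card A"
  shows "a A \<le> b A"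
proof (rule ccontr)
  assume "\<not> a A \<le> b A"
  then have gt: "a A > b A" by simp
  define E where "E = {B \<in> D. card B \<le> card A \<and> B \<noteq> A}"
  have "\<exists>v\<in>A. v \<notin> \<Union>E"
  proof (cases "E = {}")
    case True
    then show ?thesis using fin(3) A(1) by auto
  next
    case False
    have "\<Union>E \<in> E"
      using False fin(2) D by (intro Union_in_chain[of _ E]) (auto simp: E_def subset_chain_def)
    \<comment> \<open>The union is itself a member of \<open>E\<close>, so it has at most
      \<open>card A\<close> elements and differs from \<open>A\<close>; hence it cannot contain
      \<open>A\<close>.\<close>
    then have "\<not> A \<subseteq> \<Union>E"
      using fin(3) card_seteq[of "\<Union>E" A] by (auto simp: E_def)
    then show ?thesis by blast
  qed
  then obtain v where v: "v \<in> A" "v \<notin> \<Union>E" by blast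
  have "0 = (\<Sum>B\<in>C \<union> D. if v \<in> B then a B - b B else 0)"
  proof -
    have "(\<Sum>B\<in>C \<union> D. if v \<in> B then a B - b B else 0)
      = (\<Sum>A\<in>C \<union> D. if v \<in> A then a A else 0) - (\<Sum>A\<in>C \<union> D. if v \<in> A then b A else 0)"
      unfolding sum_subtractf[symmetric] by (rule sum.cong) auto
    then show ?thesis using eq[of v] by simp
  qed
  also have "\<dots> \<ge> (if v \<in> A then a A - b A else 0)"
  proof (rule member_le_sum[OF A(1)])
    fix B assume B: "B \<in> C \<union> D - {A}"
    have "a B - b B \<ge> 0" if "v \<in> B" "a B \<noteq> b B"
    proof -
      \<comment> \<open>A member of \<open>D\<close> with \<open>a B \<noteq> b B\<close> is no
        larger than \<open>A\<close> by maximality, hence belongs to \<open>E\<close>, whose union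
        misses \<open>v\<close>. Outside \<open>D\<close> the difference is just
        \<open>a B\<close>.\<close>
      have "B \<notin> D" using A(2)[of B] B that v by (auto simp: E_def)
      then show ?thesis using a b by simp
    qed
    then show "0 \<le> (if v \<in> B then a B - b B else 0)" by force
  qed (use fin in auto)
  finally show False using gt v by simp
qed

text \<open>Among the sets where \<open>a\<close> and \<open>b\<close> differ, one of largest
  cardinality satisfies the hypotheses of the preceding inequality in both directions, since the
  situation is symmetric in the two chains.\<close>

lemma chain_coefficients_unique:
  fixes a b :: "'v set \<Rightarrow> real"
  assumes fin: "finite C" "finite D" "\<And>A. A \<in> C \<union> D \<Longrightarrow> finite A \<and> A \<noteq> {}"
    and C: "\<And>A B. A \<in> C \<Longrightarrow> B \<in> C \<Longrightarrow> A \<subseteq> B \<or> B \<subseteq> A"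
    and D: "\<And>A B. A \<in> D \<Longrightarrow> B \<in> D \<Longrightarrow> A \<subseteq> B \<or> B \<subseteq> A"
    and a: "\<And>A. 0 \<le> a A" "\<And>A. A \<notin> C \<Longrightarrow> a A = 0"
    and b: "\<And>A. 0 \<le> b A" "\<And>A. A \<notin> D \<Longrightarrow> b A = 0"
    and eq: "\<And>v. (\<Sum>A\<in>C \<union> D. if v \<in> A then a A else 0) = (\<Sum>A\<in>C \<union> D. if v \<in> A then b A else 0)"
  shows "a = b"
proof (rule ccontr)
  define E where "E = {A \<in> C \<union> D. a A \<noteq> b A}"
  assume "a \<noteq> b"
  then have E: "E \<noteq> {}" "finite E"
    using a b fin by (auto simp: E_def fun_eq_iff) metis
  have "Max (card ` E) \<in> card ` E"
    using E by (intro Max_in) auto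
  then obtain A where A: "A \<in> E" "card A = Max (card ` E)" by auto
  have max: "card B \<le> card A" if "B \<in> C \<union> D" "a B \<noteq> b B" for B
    unfolding A(2) using that E by (intro Max_ge) (auto simp: E_def)
  have A': "A \<in> C \<union> D" "A \<in> D \<union> C" "a A \<noteq> b A" using A(1) by (auto simp: E_def)
  have "a A \<le> b A"
    by (rule chain_coefficients_le[OF fin D a b eq A'(1) max])
  moreover have "b A \<le> a A"
  proof (rule chain_coefficients_le[OF fin(2,1) _ C b a _ A'(2)])
    show "finite B \<and> B \<noteq> {}" if "B \<in> D \<union> C" for B
      using fin(3) that by blast
    show "(\<Sum>A\<in>D \<union> C. if v \<in> A then b A else 0) = (\<Sum>A\<in>D \<union> C. if v \<in> A then a A else 0)" for v
      using eq[of v] by (simp add: Un_commute)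
    show "card B \<le> card A" if "B \<in> D \<union> C" "b B \<noteq> a B" for B
      using max[of B] that by auto
  qed
  ultimately show False using A' by simp
qed

text \<open>With coefficients \<open>u (barycenter A) / card A\<close> a pushed weight is a
  combination of indicators of the flag, to which \<open>chain_coefficients_unique\<close> applies.
  Injectivity of \<open>barycenter\<close> on \<open>C \<union> D\<close> as a whole then converts
  coefficients back to weights, also at barycenters belonging to one flag only.\<close>

lemma push_weights_inject:
  assumes K: "simplicial K" "\<sigma> \<in> K" "\<tau> \<in> K" and C: "C \<in> flags \<sigma>" and D: "D \<in> flags \<tau>"
    and u: "u \<in> simplex_weights (barycenter ` C)" and w: "w \<in> simplex_weights (barycenter ` D)"
    and eq: "push_weights C u = push_weights D w"
  shows "u = w"
proof -
  have inj: "inj_on barycenter (C \<union> D)"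
    by (rule inj_on_subset[OF inj_on_barycenter[OF K(1)]])
       (use flags_subset_complex[OF K(1,2) C] flags_subset_complex[OF K(1,3) D] in blast)
  have fin: "finite C" "finite D" "\<And>A. A \<in> C \<union> D \<Longrightarrow> finite A \<and> A \<noteq> {}"
    using finite_flags(2)[OF simplicialD(1)[OF K(1,2)] C] finite_flags(2)[OF simplicialD(1)[OF K(1,3)] D]
      simplicialD[OF K(1)] flags_subset_complex[OF K(1,2) C] flags_subset_complex[OF K(1,3) D] by blast+
  define co where "co C u A = (if A \<in> C then u (barycenter A) / real (card A) else 0)"
    for C and u :: "'a \<Rightarrow> real" and A :: "'a set"
  have push: "push_weights C u v = (\<Sum>A\<in>C \<union> D. if v \<in> A then co C u A else 0)"
    "push_weights D w v = (\<Sum>A\<in>C \<union> D. if v \<in> A then co D w A else 0)" for v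
    unfolding push_weights_def
    by (rule sum.mono_neutral_cong_left; use fin in \<open>auto simp: co_def uniform_weights_def\<close>)+
  have co: "co C u = co D w"
  proof (rule chain_coefficients_unique[OF fin flagsD(4)[OF C] flagsD(4)[OF D]])
    show "0 \<le> co C u A" "0 \<le> co D w A" for A
      using u w by (auto simp: co_def simplex_weights_def)
    show "co C u A = 0" if "A \<notin> C" for A
      using that by (simp add: co_def)
    show "co D w A = 0" if "A \<notin> D" for A
      using that by (simp add: co_def)
    show "(\<Sum>A\<in>C \<union> D. if v \<in> A then co C u A else 0) = (\<Sum>A\<in>C \<union> D. if v \<in> A then co D w A else 0)" for v
      using fun_cong[OF eq, of v] by (simp only: push)
  qed
  show "u = w"
  proof
    fix r
    show "u r = w r"
    proof (cases "r \<in> barycenter ` (C \<union> D)")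
      case False
      then have "r \<notin> barycenter ` C" "r \<notin> barycenter ` D" by (simp_all add: image_Un)
      then show ?thesis using u w by (simp add: simplex_weights_def)
    next
      case True
      then obtain A where A: "A \<in> C \<union> D" "r = barycenter A" by auto
      have c: "card A \<noteq> 0" using fin(3)[OF A(1)] by auto
      have "u r = card A * co C u A"
      proof (cases "A \<in> C")
        case False
        then have "r \<notin> barycenter ` C"
          using A inj by (auto simp: inj_on_def)
        then show ?thesis using False u by (auto simp: co_def simplex_weights_def)
      qed (use c A in \<open>simp add: co_def\<close>)
      moreover have "w r = card A * co D w A"
      proof (cases "A \<in> D")
        case False
        then have "r \<notin> barycenter ` D"
          using A inj by (auto simp: inj_on_def)
        then show ?thesis using False w by (auto simp: co_def simplex_weights_def)
      qed (use c A in \<open>simp add: co_def\<close>)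
      ultimately show ?thesis using co by simp
    qed
  qed
qed

text \<open>For uniqueness, both weight functions are pushed to the vertices of \<open>K\<close>,
  where the hypothesis on \<open>K\<close> identifies them, and injectivity of the push brings the
  equality back.\<close>

lemma simplicial_Sd:
  assumes "simplicial K"
  shows "simplicial (Sd K)"
  unfolding simplicial_def
proof (intro conjI ballI impI allI)
  fix \<rho> assume "\<rho> \<in> Sd K"
  then obtain C where "\<rho> = barycenter ` C" "finite C" "C \<noteq> {}"
    unfolding Sd_def by blast
  then show "finite \<rho>" "\<rho> \<noteq> {}" by simp_all
next
  fix \<rho> \<tau> assume \<rho>: "\<rho> \<in> Sd K" and \<tau>: "\<tau> \<subseteq> \<rho> \<and> \<tau> \<noteq> {}"
  obtain C where C: "\<rho> = barycenter ` C" "subset.chain K C" "finite C"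
    using \<rho> unfolding Sd_def by blast
  obtain D where D: "D \<subseteq> C" "\<tau> = barycenter ` D"
    using \<tau> C(1) by (meson subset_imageE)
  have "subset.chain K D"
    using C(2) D(1) unfolding subset_chain_def by (meson subset_iff)
  moreover have "finite D" "D \<noteq> {}"
    using D C(3) \<tau> finite_subset by auto
  ultimately show "\<tau> \<in> Sd K"
    unfolding Sd_def D(2) by blast
next
  fix \<rho> \<tau> u w
  assume \<rho>: "\<rho> \<in> Sd K" and \<tau>: "\<tau> \<in> Sd K" and u: "u \<in> simplex_weights \<rho>" and w: "w \<in> simplex_weights \<tau>"
    and eq: "(\<Sum>v\<in>\<rho>. u v *\<^sub>R v) = (\<Sum>v\<in>\<tau>. w v *\<^sub>R v)"
  obtain \<alpha> C where C: "\<alpha> \<in> K" "C \<in> flags \<alpha>" "\<rho> = barycenter ` C"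
    using \<rho> unfolding Sd_eq_flags[OF assms] by blast
  obtain \<beta> D where D: "\<beta> \<in> K" "D \<in> flags \<beta>" "\<tau> = barycenter ` D"
    using \<tau> unfolding Sd_eq_flags[OF assms] by blast
  have inj: "inj_on barycenter C" "inj_on barycenter D"
    using inj_on_subset[OF inj_on_barycenter[OF assms] flags_subset_complex[OF assms C(1,2)]]
      inj_on_subset[OF inj_on_barycenter[OF assms] flags_subset_complex[OF assms D(1,2)]] .
  have fin: "finite \<alpha>" "finite \<beta>"
    using simplicialD(1)[OF assms C(1)] simplicialD(1)[OF assms D(1)] .
  note u' = u[unfolded C(3)] and w' = w[unfolded D(3)]
  have "(\<Sum>v\<in>\<alpha>. push_weights C u v *\<^sub>R v) = (\<Sum>v\<in>\<beta>. push_weights D w v *\<^sub>R v)"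
    unfolding push_weights_point[OF fin(1) C(2) inj(1)] push_weights_point[OF fin(2) D(2) inj(2)]
    using eq unfolding C(3) D(3) .
  then have "push_weights C u = push_weights D w"
    by (rule simplicial_weights_unique[OF assms C(1) D(1)
          push_weights_in[OF fin(1) C(2) inj(1) u'] push_weights_in[OF fin(2) D(2) inj(2) w']])
  then show "u = w"
    by (rule push_weights_inject[OF assms C(1) D(1) C(2) D(2) u' w'])
qed

section \<open>Iterated subdivision of a simplex\<close>

text \<open>The simplices of the \<open>d\<close>-th subdivision whose interior lies in the interior of \<open>\<sigma>\<close>.\<close>

primrec carried :: "nat \<Rightarrow> 'v::real_vector set \<Rightarrow> 'v set set" where
  "carried 0 \<sigma> = {\<sigma>}"
| "carried (Suc d) \<sigma> = (\<Union>C\<in>flags \<sigma>. carried d (barycenter ` C))"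

lemma barycenter_flag_in_Sd:
  assumes "simplicial K" "\<sigma> \<in> K" "C \<in> flags \<sigma>"
  shows "barycenter ` C \<in> Sd K"
  unfolding Sd_eq_flags[OF assms(1)] using assms(2,3) by blast

lemma inj_on_barycenter_flag:
  assumes "simplicial K" "\<sigma> \<in> K" "C \<in> flags \<sigma>"
  shows "inj_on barycenter C"
  by (rule inj_on_subset[OF inj_on_barycenter[OF assms(1)] flags_subset_complex[OF assms]])

lemma card_barycenter_flag:
  assumes "simplicial K" "\<sigma> \<in> K" "C \<in> flags \<sigma>"
  shows "card (barycenter ` C) = card C"
  by (rule card_image[OF inj_on_barycenter_flag[OF assms]])

lemma iterated_Sd_eq_carried:
  "simplicial K \<Longrightarrow> (Sd ^^ d) K = (\<Union>\<sigma>\<in>K. carried d \<sigma>)"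
proof (induction d arbitrary: K)
  case (Suc d)
  have "(Sd ^^ Suc d) K = (Sd ^^ d) (Sd K)"
    by (simp add: funpow_swap1)
  also have "\<dots> = (\<Union>\<rho>\<in>Sd K. carried d \<rho>)"
    by (rule Suc.IH[OF simplicial_Sd[OF Suc.prems]])
  also have "\<dots> = (\<Union>\<sigma>\<in>K. carried (Suc d) \<sigma>)"
    unfolding Sd_eq_flags[OF Suc.prems] by simp
  finally show ?case .
qed simp

lemma finite_carried: "finite \<sigma> \<Longrightarrow> finite (carried d \<sigma>)"
proof (induction d arbitrary: \<sigma>)
  case (Suc d)
  then show ?case
    using finite_flags(1,2)[OF Suc.prems] by (auto intro!: Suc.IH)
qed simp

text \<open>In the induction the complex changes from \<open>K\<close> to \<open>Sd K\<close>: there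
  the hypothesis identifies the simplices spanned by the two flags, injectivity of
  \<open>barycenter\<close> identifies the flags, and a flag determines its top.\<close>

lemma carried_disjoint:
  assumes "simplicial K" "\<sigma> \<in> K" "\<tau> \<in> K" "\<rho> \<in> carried d \<sigma>" "\<rho> \<in> carried d \<tau>"
  shows "\<sigma> = \<tau>"
  using assms
proof (induction d arbitrary: K \<sigma> \<tau>)
  case (Suc d)
  obtain C where C: "C \<in> flags \<sigma>" "\<rho> \<in> carried d (barycenter ` C)" using Suc.prems(4) by auto
  obtain D where D: "D \<in> flags \<tau>" "\<rho> \<in> carried d (barycenter ` D)" using Suc.prems(5) by auto
  have "barycenter ` C = barycenter ` D"
    by (rule Suc.IH[OF simplicial_Sd[OF Suc.prems(1)] barycenter_flag_in_Sd[OF Suc.prems(1,2) C(1)]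
          barycenter_flag_in_Sd[OF Suc.prems(1,3) D(1)] C(2) D(2)])
  then have "C = D"
    using inj_on_image_eq_iff[OF inj_on_barycenter[OF Suc.prems(1)]
        flags_subset_complex[OF Suc.prems(1,2) C(1)] flags_subset_complex[OF Suc.prems(1,3) D(1)]] by simp
  with C(1) D(1) show ?case by (metis flags_disjoint)
qed simp

lemma sum_carried_Suc:
  assumes "simplicial K" "\<sigma> \<in> K"
  shows "(\<Sum>\<tau>\<in>carried (Suc d) \<sigma>. g \<tau>) = (\<Sum>C\<in>flags \<sigma>. \<Sum>\<tau>\<in>carried d (barycenter ` C). g \<tau>)"
proof -
  have fin: "finite \<sigma>" by (rule simplicialD(1)[OF assms])
  have "carried d (barycenter ` C) \<inter> carried d (barycenter ` D) = {}"
    if CD: "C \<in> flags \<sigma>" "D \<in> flags \<sigma>" "C \<noteq> D" for C D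
  proof (rule ccontr)
    assume "carried d (barycenter ` C) \<inter> carried d (barycenter ` D) \<noteq> {}"
    then obtain \<rho> where "\<rho> \<in> carried d (barycenter ` C)" "\<rho> \<in> carried d (barycenter ` D)" by blast
    then have "barycenter ` C = barycenter ` D"
      by (rule carried_disjoint[OF simplicial_Sd[OF assms(1)] barycenter_flag_in_Sd[OF assms CD(1)]
            barycenter_flag_in_Sd[OF assms CD(2)]])
    then show False
      using inj_on_image_eq_iff[OF inj_on_barycenter[OF assms(1)] flags_subset_complex[OF assms CD(1)]
          flags_subset_complex[OF assms CD(2)]] CD(3) by simp
  qed
  then show ?thesis
    using finite_flags(1)[OF fin] finite_flags(2)[OF fin]
    by (simp, intro sum.UNION_disjoint) (auto intro!: finite_carried)
qed

lemma hull_barycenter_flag: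
  assumes "finite \<sigma>" "C \<in> flags \<sigma>"
  shows "convex hull (barycenter ` C) \<subseteq> convex hull \<sigma>"
proof (rule hull_minimal)
  show "barycenter ` C \<subseteq> convex hull \<sigma>"
    using barycenter_in_hull[OF finite_flags(3)[OF assms] flagsD(3)[OF assms(2)]]
      hull_mono[OF flagsD(2)[OF assms(2)]] by blast
qed (rule convex_convex_hull)

lemma carried_nonempty_finite:
  "finite \<sigma> \<Longrightarrow> \<sigma> \<noteq> {} \<Longrightarrow> \<tau> \<in> carried d \<sigma> \<Longrightarrow> finite \<tau> \<and> \<tau> \<noteq> {}"
proof (induction d arbitrary: \<sigma>)
  case (Suc d)
  then obtain C where C: "C \<in> flags \<sigma>" "\<tau> \<in> carried d (barycenter ` C)" by auto
  show ?case
    using Suc.IH[OF _ _ C(2)] finite_flags(2)[OF Suc.prems(1) C(1)] flagsD(1)[OF C(1)] by blast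
qed simp

lemma hull_carried:
  "finite \<sigma> \<Longrightarrow> \<tau> \<in> carried d \<sigma> \<Longrightarrow> convex hull \<tau> \<subseteq> convex hull \<sigma>"
proof (induction d arbitrary: \<sigma>)
  case (Suc d)
  then obtain C where C: "C \<in> flags \<sigma>" "\<tau> \<in> carried d (barycenter ` C)" by auto
  have "convex hull \<tau> \<subseteq> convex hull (barycenter ` C)"
    by (rule Suc.IH[OF _ C(2)]) (simp add: finite_flags(2)[OF Suc.prems(1) C(1)])
  then show ?case
    using hull_barycenter_flag[OF Suc.prems(1) C(1)] by blast
qed simp

lemma barycenter_carried_in_hull:
  assumes "finite \<sigma>" "\<sigma> \<noteq> {}" "\<tau> \<in> carried d \<sigma>"
  shows "barycenter \<tau> \<in> convex hull \<sigma>"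
  using carried_nonempty_finite[OF assms] barycenter_in_hull
  by (intro subsetD[OF hull_carried[OF assms(1,3)]]) blast

section \<open>Flags under bijections, and the number of full flags\<close>

lemma image_flag:
  assumes "C \<in> flags \<sigma>"
  shows "(`) h ` C \<in> flags (h ` \<sigma>)"
proof -
  have "C \<subseteq> Pow \<sigma> - {{}}" "\<forall>X\<in>C. \<forall>Y\<in>C. X \<subseteq> Y \<or> Y \<subseteq> X" "\<sigma> \<in> C"
    using assms by (auto simp: flags_def subset_chain_def)
  then show ?thesis
    unfolding flags_def subset_chain_def by (auto intro!: image_mono)
qed

lemma flags_image:
  assumes "inj_on h \<sigma>"
  shows "(`) ((`) h) ` flags \<sigma> = flags (h ` \<sigma>)"
proof -
  show ?thesis
  proof (intro equalityI subsetI)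
    fix D assume D: "D \<in> flags (h ` \<sigma>)"
    define g where "g = inv_into \<sigma> h"
    have g: "h ` g ` A = A" if "A \<in> D" for A
      unfolding g_def by (rule image_inv_into_cancel[OF refl flagsD(2)[OF D that]])
    have gs: "g ` h ` \<sigma> = \<sigma>"
      unfolding g_def by (rule inv_into_image_cancel[OF assms]) simp
    have "(`) h ` (`) g ` D = D"
      using g by (force simp: image_iff)
    moreover have "(`) g ` D \<in> flags \<sigma>"
      using image_flag[OF D, of g] gs by simp
    ultimately show "D \<in> (`) ((`) h) ` flags \<sigma>" by (metis image_eqI)
  qed (use image_flag in auto)
qed

text \<open>A bijection of the vertices transports flags and preserves their lengths. This moves
  every count to the model set \<open>{..<m}\<close>, so that it depends on the number of vertices
  alone.\<close>

lemma sum_flags_card: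
  fixes g :: "nat \<Rightarrow> real"
  assumes "finite \<sigma>"
  shows "(\<Sum>C\<in>flags \<sigma>. g (card C)) = (\<Sum>C\<in>flags {..<card \<sigma>}. g (card C))"
proof -
  obtain h where h: "bij_betw h {..<card \<sigma>} \<sigma>"
    using ex_bij_betw_nat_finite[OF assms] by (auto simp: atLeast0LessThan)
  then have inj: "inj_on h {..<card \<sigma>}" and im: "h ` {..<card \<sigma>} = \<sigma>"
    by (auto simp: bij_betw_def)
  have sub: "flags {..<card \<sigma>} \<subseteq> Pow (Pow {..<card \<sigma>})"
    by (auto simp: flags_def subset_chain_def)
  have inj2: "inj_on ((`) h) (Pow {..<card \<sigma>})"
    by (rule inj_on_image_Pow[OF inj])
  have inj3: "inj_on ((`) ((`) h)) (flags {..<card \<sigma>})"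
    by (rule inj_on_subset[OF inj_on_image_Pow[OF inj2] sub])
  have fl: "flags \<sigma> = (`) ((`) h) ` flags {..<card \<sigma>}"
    unfolding flags_image[OF inj] im ..
  have "(\<Sum>C\<in>flags \<sigma>. g (card C)) = (\<Sum>C\<in>flags {..<card \<sigma>}. g (card ((`) h ` C)))"
    unfolding fl sum.reindex[OF inj3] by simp
  also have "\<dots> = (\<Sum>C\<in>flags {..<card \<sigma>}. g (card C))"
  proof (rule sum.cong[OF refl])
    fix C assume "C \<in> flags {..<card \<sigma>}"
    then have "C \<subseteq> Pow {..<card \<sigma>}" using sub by blast
    then have "card ((`) h ` C) = card C"
      by (intro card_image inj_on_subset[OF inj2])
    then show "g (card ((`) h ` C)) = g (card C)" by simp
  qed
  finally show ?thesis .
qed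

lemma inj_on_card_flag:
  assumes "finite \<sigma>" "C \<in> flags \<sigma>"
  shows "inj_on card C"
proof (rule inj_onI)
  fix A B assume "A \<in> C" "B \<in> C" "card A = card B"
  then show "A = B"
    using flagsD(4)[OF assms(2)] finite_flags(3)[OF assms]
    by (metis card_subset_eq)
qed

lemma card_image_flag:
  assumes "finite \<sigma>" "C \<in> flags \<sigma>"
  shows "card ` C \<subseteq> {1..card \<sigma>}"
proof -
  have "1 \<le> card A \<and> card A \<le> card \<sigma>" if "A \<in> C" for A
    using flagsD(2,3)[OF assms(2) that] finite_flags(3)[OF assms that] card_mono[OF assms(1)]
    by (simp add: Suc_le_eq card_gt_0_iff)
  then show ?thesis by auto
qed

text \<open>The map \<open>card\<close> embeds a flag into \<open>{1..card \<sigma>}\<close>, since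
  comparable finite sets of equal size coincide.\<close>

lemma card_flag_le:
  assumes "finite \<sigma>" "C \<in> flags \<sigma>"
  shows "card C \<le> card \<sigma>" "card C > 0"
proof -
  have "card C = card (card ` C)"
    by (rule card_image[OF inj_on_card_flag[OF assms], symmetric])
  also have "\<dots> \<le> card \<sigma>"
    using card_mono[OF _ card_image_flag[OF assms]] by simp
  finally show "card C \<le> card \<sigma>" .
  show "card C > 0"
    using finite_flags(2)[OF assms] flagsD(1)[OF assms(2)] by (auto simp: card_gt_0_iff)
qed

text \<open>Such a flag contains one face of each cardinality; its barycenters span a simplex of the
  subdivision of the same dimension as \<sigma>.\<close>

definition full_flags :: "'v set \<Rightarrow> 'v set set set" where
  "full_flags \<sigma> = {C \<in> flags \<sigma>. card C = card \<sigma>}"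

text \<open>The complete flag belonging to an ordering of the vertices. Indices start at 0, so for
  injective \<open>w\<close> the index \<open>k\<close> yields a face with \<open>k + 1\<close>
  vertices.\<close>

definition initial_flag :: "nat \<Rightarrow> (nat \<Rightarrow> 'v) \<Rightarrow> 'v set set" where
  "initial_flag n w = (\<lambda>k. w ` {..k}) ` {..n}"

lemma card_initial:
  assumes "inj_on w {..n}" "k \<le> n"
  shows "card (w ` {..k}) = Suc k"
  using assms by (subst card_image) (auto intro: inj_on_subset)

lemma initial_flag_full:
  assumes w: "bij_betw w {..n} \<sigma>"
  shows "initial_flag n w \<in> full_flags \<sigma>"
proof -
  have inj: "inj_on w {..n}" and im: "w ` {..n} = \<sigma>" using w by (auto simp: bij_betw_def)
  have "inj_on (\<lambda>k. w ` {..k}) {..n}"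
  proof (rule inj_onI)
    fix k l assume kl: "k \<in> {..n}" "l \<in> {..n}" "w ` {..k} = w ` {..l}"
    then have "Suc k = Suc l" using card_initial[OF inj] by (metis atMost_iff)
    then show "k = l" by simp
  qed
  then have "card (initial_flag n w) = card \<sigma>"
    using bij_betw_same_card[OF w] by (simp add: initial_flag_def card_image)
  moreover have "initial_flag n w \<in> flags \<sigma>"
  proof -
    have "w ` {..k} \<subseteq> w ` {..l} \<or> w ` {..l} \<subseteq> w ` {..k}" for k l
      using linear[of k l] by (auto intro!: image_mono)
    moreover have "w ` {..k} \<subseteq> \<sigma>" if "k \<le> n" for k
      using im that by auto
    ultimately show ?thesis
      using im by (auto simp: flags_def subset_chain_def initial_flag_def)
  qed
  ultimately show ?thesis by (simp add: full_flags_def)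
qed

text \<open>Members of the two flags are matched by cardinality, so the \<open>k\<close>-th initial
  segments agree; \<open>w k\<close> is what the \<open>k\<close>-th segment adds to the previous
  one.\<close>

lemma initial_flag_inject:
  assumes "inj_on w {..n}" "inj_on w' {..n}" "initial_flag n w = initial_flag n w'" "k \<le> n"
  shows "w k = w' k"
proof -
  have eq: "w ` {..k} = w' ` {..k}" if "k \<le> n" for k
  proof -
    have "w ` {..k} \<in> initial_flag n w'"
      unfolding assms(3)[symmetric] using that by (simp add: initial_flag_def)
    then obtain l where l: "l \<le> n" "w ` {..k} = w' ` {..l}" by (auto simp: initial_flag_def)
    then have "Suc k = Suc l"
      using card_initial[OF assms(1) that] card_initial[OF assms(2) l(1)] by simp
    with l show ?thesis by simp
  qed
  have diff: "{w k} = w ` {..k} - w ` {..<k}" if "inj_on w {..n}" for w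
  proof -
    have "w k \<notin> w ` {..<k}"
      using that assms(4) by (auto dest: inj_onD)
    then show ?thesis
      unfolding ivl_disj_un(2)[of k, symmetric] image_Un by auto
  qed
  have "w ` {..<k} = w' ` {..<k}"
  proof (cases k)
    case (Suc j)
    then show ?thesis using eq[of j] assms(4) by (simp add: lessThan_Suc_atMost)
  qed simp
  then have "{w k} = {w' k}"
    unfolding diff[OF assms(1)] diff[OF assms(2)] using eq[OF assms(4)] by simp
  then show ?thesis by simp
qed

text \<open>A full flag attains every cardinality from 1 to \<open>n + 1\<close>, so it can be
  listed as \<open>A 0, ..., A n\<close>, each member adding a single vertex \<open>v k\<close>.
  These vertices give the ordering.\<close>

lemma full_flag_eq_initial_flag:
  assumes "finite \<sigma>" "card \<sigma> = Suc n" "C \<in> full_flags \<sigma>"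
  obtains v where "bij_betw v {..n} \<sigma>" "C = initial_flag n v"
proof -
  have C: "C \<in> flags \<sigma>" "card C = Suc n" using assms by (auto simp: full_flags_def)
  have finC: "finite C" by (rule finite_flags(2)[OF assms(1) C(1)])
  have "card ` C = {1..Suc n}"
  proof (rule card_subset_eq)
    show "card ` C \<subseteq> {1..Suc n}" using card_image_flag[OF assms(1) C(1)] assms(2) by simp
    show "card (card ` C) = card {1..Suc n}"
      using card_image[OF inj_on_card_flag[OF assms(1) C(1)]] C(2) by simp
  qed simp
  then have "\<exists>A\<in>C. card A = Suc k" if "k \<le> n" for k
    using that by (metis (no_types, lifting) Suc_le_mono atLeastAtMost_iff imageE le_add1 plus_1_eq_Suc)
  then have "\<forall>k. \<exists>A. k \<le> n \<longrightarrow> A \<in> C \<and> card A = Suc k" by blast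
  then obtain A where A: "\<And>k. k \<le> n \<Longrightarrow> A k \<in> C" "\<And>k. k \<le> n \<Longrightarrow> card (A k) = Suc k" by metis
  have finA: "finite (A k)" if "k \<le> n" for k
    by (rule finite_flags(3)[OF assms(1) C(1) A(1)[OF that]])
  have step: "A k \<subseteq> A (Suc k)" if "Suc k \<le> n" for k
  proof (rule ccontr)
    assume "\<not> A k \<subseteq> A (Suc k)"
    then have "A (Suc k) \<subseteq> A k"
      using flagsD(4)[OF C(1)] A(1) that by (meson Suc_leD)
    then have "card (A (Suc k)) \<le> card (A k)"
      using finA that by (intro card_mono) auto
    then show False using A(2) that by simp
  qed
  have "\<exists>v. v \<in> A k \<and> (k > 0 \<longrightarrow> v \<notin> A (k - 1))" if "k \<le> n" for k
  proof (cases k)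
    case 0
    then show ?thesis using A(2)[OF that] by (cases "A k = {}") auto
  next
    case (Suc j)
    have "\<not> A k \<subseteq> A j"
    proof
      assume "A k \<subseteq> A j"
      then have "card (A k) \<le> card (A j)"
        using finA[of j] that Suc by (intro card_mono) auto
      then show False using A(2)[of j] A(2)[of k] that Suc by simp
    qed
    then show ?thesis using Suc by auto
  qed
  then obtain v where v: "\<And>k. k \<le> n \<Longrightarrow> v k \<in> A k" "\<And>k. Suc k \<le> n \<Longrightarrow> v (Suc k) \<notin> A k"
    by (metis diff_Suc_1 zero_less_Suc)
  have Av: "A k = v ` {..k}" if "k \<le> n" for k
    using that
  proof (induction k)
    case 0
    have "{v 0} \<subseteq> A 0" "card {v 0} = card (A 0)" using v(1) A(2) by simp_all
    then have "{v 0} = A 0" using finA by (intro card_subset_eq) auto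
    then show ?case by simp
  next
    case (Suc k)
    have "insert (v (Suc k)) (A k) \<subseteq> A (Suc k)" using v(1) step Suc.prems by blast
    moreover have "card (insert (v (Suc k)) (A k)) = card (A (Suc k))"
      using v(2) finA A(2) Suc.prems by simp
    ultimately have "insert (v (Suc k)) (A k) = A (Suc k)"
      using finA Suc.prems by (intro card_subset_eq) auto
    then show ?case using Suc by (auto simp: atMost_Suc)
  qed
  have An: "A n = \<sigma>"
    using flagsD(2)[OF C(1) A(1)] A(2) assms(1,2) by (intro card_subset_eq) auto
  have "v ` {..n} = \<sigma>" using Av[of n] An by simp
  moreover from this have "inj_on v {..n}"
    using assms(2) by (intro eq_card_imp_inj_on) auto
  ultimately have bij: "bij_betw v {..n} \<sigma>" by (simp add: bij_betw_def)
  have "initial_flag n v \<subseteq> C"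
    unfolding initial_flag_def using Av A(1) by auto
  moreover have "card (initial_flag n v) = card C"
    using initial_flag_full[OF bij] C(2) assms(2) by (simp add: full_flags_def)
  ultimately have "C = initial_flag n v"
    using finC by (intro card_subset_eq[symmetric]) auto
  with bij show ?thesis by (rule that)
qed

text \<open>The origin of the factor \<open>(n + 1)!\<close>. The explicit bijection is needed
  besides the cardinality: a sum of integrals over permutations later becomes a sum over full
  flags.\<close>

lemma bij_betw_permutations_full_flags:
  assumes w: "bij_betw w {..n} \<sigma>"
  shows "bij_betw (\<lambda>\<pi>. initial_flag n (w \<circ> \<pi>)) {\<pi>. \<pi> permutes {..n}} (full_flags \<sigma>)"
proof -
  have bij: "bij_betw (w \<circ> \<pi>) {..n} \<sigma>" if "\<pi> permutes {..n}" for \<pi>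
    by (rule bij_betw_trans[OF permutes_imp_bij[OF that] w])
  have fin: "finite \<sigma>" "card \<sigma> = Suc n"
    using bij_betw_finite[OF w] bij_betw_same_card[OF w] by simp_all
  have winj: "inj_on w {..n}" using w by (simp add: bij_betw_def)
  show ?thesis
  proof (rule bij_betw_imageI)
    show "inj_on (\<lambda>\<pi>. initial_flag n (w \<circ> \<pi>)) {\<pi>. \<pi> permutes {..n}}"
    proof (rule inj_onI)
      fix \<pi> \<pi>' assume "\<pi> \<in> {\<pi>. \<pi> permutes {..n}}" "\<pi>' \<in> {\<pi>. \<pi> permutes {..n}}"
      then have p: "\<pi> permutes {..n}" "\<pi>' permutes {..n}" by auto
      assume eq: "initial_flag n (w \<circ> \<pi>) = initial_flag n (w \<circ> \<pi>')"
      show "\<pi> = \<pi>'"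
      proof
        fix k show "\<pi> k = \<pi>' k"
        proof (cases "k \<le> n")
          case True
          have "(w \<circ> \<pi>) k = (w \<circ> \<pi>') k"
            by (rule initial_flag_inject[OF _ _ eq True]) (use bij p in \<open>auto simp: bij_betw_def\<close>)
          then show ?thesis
            using winj True permutes_in_image[OF p(1), of k] permutes_in_image[OF p(2), of k]
            by (auto dest: inj_onD)
        next
          case False
          then show ?thesis using p permutes_not_in by (metis atMost_iff)
        qed
      qed
    qed
    show "(\<lambda>\<pi>. initial_flag n (w \<circ> \<pi>)) ` {\<pi>. \<pi> permutes {..n}} = full_flags \<sigma>"
    proof (intro equalityI subsetI)
      fix C assume "C \<in> full_flags \<sigma>"
      with fin obtain v where v: "bij_betw v {..n} \<sigma>" "C = initial_flag n v"
        by (rule full_flag_eq_initial_flag)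
      define \<pi> where "\<pi> k = (if k \<in> {..n} then inv_into {..n} w (v k) else k)" for k
      have "bij_betw (inv_into {..n} w \<circ> v) {..n} {..n}"
        by (rule bij_betw_trans[OF v(1) bij_betw_inv_into[OF w]])
      then have "bij_betw \<pi> {..n} {..n}"
        by (rule bij_betw_cong[THEN iffD1, rotated]) (simp add: \<pi>_def)
      then have p: "\<pi> permutes {..n}"
        by (rule bij_imp_permutes) (auto simp: \<pi>_def)
      have "w (\<pi> k) = v k" if "k \<le> n" for k
        using bij_betw_inv_into_right[OF w, of "v k"] bij_betw_apply[OF v(1), of k] that by (simp add: \<pi>_def)
      then have "(w \<circ> \<pi>) ` {..k} = v ` {..k}" if "k \<le> n" for k
        using that by (intro image_cong) auto
      then have "(\<lambda>k. (w \<circ> \<pi>) ` {..k}) ` {..n} = (\<lambda>k. v ` {..k}) ` {..n}"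
        by (rule image_cong[OF refl]) (simp only: atMost_iff)
      then have "initial_flag n (w \<circ> \<pi>) = C"
        unfolding v(2) initial_flag_def .
      with p show "C \<in> (\<lambda>\<pi>. initial_flag n (w \<circ> \<pi>)) ` {\<pi>. \<pi> permutes {..n}}" by blast
    qed (use initial_flag_full[OF bij] in auto)
  qed
qed

lemma card_full_flags:
  assumes "finite \<sigma>" "\<sigma> \<noteq> {}"
  shows "card (full_flags \<sigma>) = fact (card \<sigma>)"
proof -
  have c: "card \<sigma> = Suc (card \<sigma> - 1)" using assms by (simp add: card_gt_0_iff)
  have "card (full_flags \<sigma>) = card {\<pi>. \<pi> permutes {..card \<sigma> - 1}}"
    by (rule bij_betw_same_card[OF bij_betw_permutations_full_flags[OF bij_betw_vertex_enum[OF assms]], symmetric])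
  also have "\<dots> = fact (card {..card \<sigma> - 1})"
    by (rule card_permutations) simp_all
  also have "card {..card \<sigma> - 1} = card \<sigma>"
    using c by simp
  finally show ?thesis .
qed

section \<open>Counting simplices in the interior\<close>

text \<open>
  \<open>local_count p d m\<close> is the number of \<open>p\<close>-simplices in the interior of the \<open>d\<close>-th subdivision of a
  simplex with \<open>m\<close> vertices.
\<close>

primrec local_count :: "nat \<Rightarrow> nat \<Rightarrow> nat \<Rightarrow> real" where
  "local_count p 0 m = (if m = p + 1 then 1 else 0)"
| "local_count p (Suc d) m = (\<Sum>C\<in>flags {..<m}. local_count p d (card C))"

text \<open>Up to normalization, the integral of \<phi> over the part of the \<open>d\<close>-th
  measure that sits in the interior of \<sigma>.\<close>

definition local_sum :: "nat \<Rightarrow> ('v::real_vector \<Rightarrow> real) \<Rightarrow> nat \<Rightarrow> 'v set \<Rightarrow> real" where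
  "local_sum p \<phi> d \<sigma> = (\<Sum>\<tau>\<in>carried d \<sigma>. if card \<tau> = p + 1 then \<phi> (barycenter \<tau>) else 0)"

lemma local_sum_Suc:
  assumes "simplicial K" "\<sigma> \<in> K"
  shows "local_sum p \<phi> (Suc d) \<sigma> = (\<Sum>C\<in>flags \<sigma>. local_sum p \<phi> d (barycenter ` C))"
  unfolding local_sum_def by (rule sum_carried_Suc[OF assms])

lemma local_sum_1:
  assumes "simplicial K" "\<sigma> \<in> K"
  shows "local_sum p (\<lambda>_. 1) d \<sigma> = local_count p d (card \<sigma>)"
  using assms
proof (induction d arbitrary: K \<sigma>)
  case (Suc d)
  have "local_sum p (\<lambda>_. 1) (Suc d) \<sigma> = (\<Sum>C\<in>flags \<sigma>. local_count p d (card C))"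
    unfolding local_sum_Suc[OF Suc.prems]
  proof (rule sum.cong[OF refl])
    fix C assume C: "C \<in> flags \<sigma>"
    show "local_sum p (\<lambda>_. 1) d (barycenter ` C) = local_count p d (card C)"
      using Suc.IH[OF simplicial_Sd[OF Suc.prems(1)] barycenter_flag_in_Sd[OF Suc.prems C]]
        card_barycenter_flag[OF Suc.prems C] by simp
  qed
  also have "\<dots> = local_count p (Suc d) (card \<sigma>)"
    using sum_flags_card[OF simplicialD(1)[OF Suc.prems]] by simp
  finally show ?case .
qed (simp add: local_sum_def)

text \<open>Serves with \<open>c\<close> the value of \<phi> at the barycenter when \<phi> is nearly
  constant, and with \<open>c = 0\<close> as a plain bound for lower-dimensional
  contributions.\<close>

lemma local_sum_diff_le:
  assumes "simplicial K" "\<sigma> \<in> K" "\<And>x. x \<in> convex hull \<sigma> \<Longrightarrow> \<bar>\<phi> x - c\<bar> \<le> B"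
  shows "\<bar>local_sum p \<phi> d \<sigma> - c * local_count p d (card \<sigma>)\<bar> \<le> B * local_count p d (card \<sigma>)"
proof -
  have "local_sum p \<phi> d \<sigma> - c * local_count p d (card \<sigma>)
      = (\<Sum>\<tau>\<in>carried d \<sigma>. if card \<tau> = p + 1 then \<phi> (barycenter \<tau>) - c else 0)"
    unfolding local_sum_1[OF assms(1,2), symmetric] local_sum_def sum_distrib_left sum_subtractf[symmetric]
    by (rule sum.cong) auto
  also have "\<bar>\<dots>\<bar> \<le> (\<Sum>\<tau>\<in>carried d \<sigma>. B * (if card \<tau> = p + 1 then 1 else 0))"
    using assms(3)[OF barycenter_carried_in_hull[OF simplicialD(1,2)[OF assms(1,2)]]]
    by (intro order_trans[OF sum_abs] sum_mono) auto
  also have "\<dots> = B * local_count p d (card \<sigma>)"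
    unfolding local_sum_1[OF assms(1,2), symmetric] local_sum_def sum_distrib_left ..
  finally show ?thesis .
qed

lemma local_count_nonneg: "0 \<le> local_count p d m"
  by (induction d arbitrary: m) (auto intro!: sum_nonneg)

lemma sum_flags_split:
  fixes g :: "'v set set \<Rightarrow> real"
  assumes "finite \<sigma>"
  shows "(\<Sum>C\<in>flags \<sigma>. g C) = (\<Sum>C\<in>full_flags \<sigma>. g C) + (\<Sum>C | C \<in> flags \<sigma> \<and> card C < card \<sigma>. g C)"
proof -
  have "flags \<sigma> = full_flags \<sigma> \<union> {C. C \<in> flags \<sigma> \<and> card C < card \<sigma>}"
    unfolding full_flags_def using card_flag_le(1)[OF assms] by (auto simp: le_less)
  moreover have "sum g (full_flags \<sigma> \<union> {C. C \<in> flags \<sigma> \<and> card C < card \<sigma>})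
      = sum g (full_flags \<sigma>) + sum g {C. C \<in> flags \<sigma> \<and> card C < card \<sigma>}"
  proof (rule sum.union_disjoint)
    show "finite (full_flags \<sigma>)" "finite {C. C \<in> flags \<sigma> \<and> card C < card \<sigma>}"
      using finite_flags(1)[OF assms] unfolding full_flags_def by simp_all
    show "full_flags \<sigma> \<inter> {C. C \<in> flags \<sigma> \<and> card C < card \<sigma>} = {}"
      unfolding full_flags_def by fastforce
  qed
  ultimately show ?thesis by simp
qed

definition local_density :: "nat \<Rightarrow> nat \<Rightarrow> nat \<Rightarrow> real" where
  "local_density p m d = local_count p d m / fact m ^ d"

lemma local_density_nonneg: "0 \<le> local_density p m d"
  by (simp add: local_density_def local_count_nonneg)

text \<open>Each of the \<open>m!\<close> full flags reproduces \<open>local_count p d m\<close>,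
  and the additional division by \<open>fact m\<close> cancels this factor exactly. The increment
  therefore consists of the shorter flags only.\<close>

lemma local_density_Suc:
  assumes "m > 0"
  shows "local_density p m (Suc d) - local_density p m d
    = (\<Sum>C | C \<in> flags {..<m} \<and> card C < m. local_count p d (card C)) / fact m ^ Suc d"
proof -
  have "local_count p (Suc d) m = (\<Sum>C\<in>full_flags {..<m}. local_count p d (card C))
      + (\<Sum>C | C \<in> flags {..<m} \<and> card C < m. local_count p d (card C))"
    using sum_flags_split[of "{..<m}" "\<lambda>C. local_count p d (card C)"] by simp
  also have "(\<Sum>C\<in>full_flags {..<m}. local_count p d (card C)) = fact m * local_count p d m"
    using card_full_flags[of "{..<m}"] assms by (simp add: full_flags_def lessThan_empty_iff)
  finally show ?thesis
    by (simp add: local_density_def field_simps)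
qed

text \<open>By induction the count belonging to a shorter flag is bounded by a multiple of
  \<open>fact (card C) ^ d\<close>, so the increments are dominated by geometric series and the
  telescoping sum converges.\<close>

lemma local_density_convergent: "m > 0 \<Longrightarrow> convergent (local_density p m)"
proof (induction m rule: less_induct)
  case (less m)
  let ?S = "{C. C \<in> flags {..<m} \<and> card C < m}"
  have pos: "0 < card C" if "C \<in> ?S" for C
    using that card_flag_le(2)[of "{..<m}" C] by simp
  have "summable (\<lambda>d. local_count p d (card C) / fact m ^ d)" if C: "C \<in> ?S" for C
  proof -
    define r :: real where "r = fact (card C) / fact m"
    \<comment> \<open>Strictness needs \<open>card C > 0\<close>, because
      \<open>fact 0 = fact 1\<close>.\<close>
    have r: "0 \<le> r" "r < 1"
      using C pos[OF C] fact_less_mono[of "card C" m, where 'a=real] by (auto simp: r_def)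
    have "Bseq (local_density p (card C))"
      using less.IH[of "card C"] C pos[OF C] by (simp add: convergent_imp_Bseq)
    then obtain B where B: "\<And>d. norm (local_density p (card C) d) \<le> B"
      unfolding Bseq_def by blast
    show ?thesis
    proof (rule summable_comparison_test'[of "\<lambda>d. B * r ^ d" 0])
      show "summable (\<lambda>d. B * r ^ d)"
        using r by (intro summable_mult summable_geometric) simp
      fix d
      have "local_count p d (card C) / fact m ^ d = local_density p (card C) d * r ^ d"
        by (simp add: local_density_def r_def power_divide)
      then show "norm (local_count p d (card C) / fact m ^ d) \<le> B * r ^ d"
        using B[of d] r by (simp add: abs_mult mult_right_mono)
    qed
  qed
  then have "summable (\<lambda>d. (\<Sum>C\<in>?S. local_count p d (card C) / fact m ^ d) / fact m)"
    by (intro summable_divide summable_sum)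
  also have "(\<lambda>d. (\<Sum>C\<in>?S. local_count p d (card C) / fact m ^ d) / fact m)
      = (\<lambda>d. local_density p m (Suc d) - local_density p m d)"
    unfolding local_density_Suc[OF less.prems]
    by (simp add: sum_divide_distrib mult.commute)
  finally have "convergent (\<lambda>n. \<Sum>d<n. local_density p m (Suc d) - local_density p m d)"
    by (simp add: summable_iff_convergent)
  then have "convergent (\<lambda>n. local_density p m n - local_density p m 0)"
    by (simp only: sum_lessThan_telescope)
  then show ?case
    using convergent_add_const_iff[of "- local_density p m 0" "local_density p m"] by simp
qed

text \<open>The mechanism by which simplices below the top dimension disappear: their counts are at
  most of order \<open>fact m ^ d\<close> and are measured against
  \<open>fact n ^ d\<close>.\<close>

lemma local_count_lower_tendsto:
  assumes "0 < m" "m < n"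
  shows "(\<lambda>d. local_count p d m / fact n ^ d) \<longlonglongrightarrow> 0"
proof -
  define r :: real where "r = fact m / fact n"
  have r: "0 \<le> r" "r < 1"
    using assms fact_less_mono[of m n, where 'a=real] by (auto simp: r_def)
  have "(\<lambda>d. local_density p m d * r ^ d) \<longlonglongrightarrow> lim (local_density p m) * 0"
    using local_density_convergent[OF assms(1)] r
    by (intro tendsto_mult LIMSEQ_power_zero) (simp_all add: convergent_LIMSEQ_iff)
  then show ?thesis
    by (simp add: local_density_def r_def power_divide)
qed

section \<open>Lebesgue measure on the standard simplex\<close>

lemma standard_simplexI:
  assumes "\<And>i. 0 \<le> x i" "\<And>i. i > n \<Longrightarrow> x i = 0" "(\<Sum>i\<le>n. x i) = 1"
  shows "x \<in> standard_simplex n"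
proof -
  have "x i \<le> 1" for i
  proof (cases "i \<le> n")
    case True
    then have "x i \<le> (\<Sum>j\<le>n. x j)" by (intro member_le_sum assms) auto
    with assms(3) show ?thesis by linarith
  qed (simp add: assms)
  with assms show ?thesis by (auto simp: standard_simplex_def)
qed

lemma standard_simplex_sets [measurable]: "standard_simplex n \<in> sets borel"
proof -
  have "closed (standard_simplex n)"
    using closedin_standard_simplex[of n] by (simp add: euclidean_product_topology)
  then show ?thesis by simp
qed

lemma borel_measurable_comp_index:
  "(\<lambda>x i. x (g i)) \<in> borel_measurable (borel :: (nat \<Rightarrow> real) measure)"
  by (intro borel_measurable_continuous_onI continuous_on_coordinatewise_then_product
      continuous_on_product_coordinates)

lemma borel_measurable_compose_index:
  assumes "f \<in> borel_measurable borel"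
  shows "(\<lambda>x. f (\<lambda>i. x (g i))) \<in> borel_measurable (borel :: (nat \<Rightarrow> real) measure)"
  by (rule measurable_compose[OF borel_measurable_comp_index assms])

lemma simplex_chart_borel [measurable]:
  "simplex_chart n \<in> borel_measurable (\<Pi>\<^sub>M i\<in>{1..n}. (lborel :: real measure))"
proof (rule measurable_coordinatewise_then_product)
  show "(\<lambda>t. simplex_chart n t i) \<in> borel_measurable (\<Pi>\<^sub>M i\<in>{1..n}. (lborel :: real measure))" for i
    by (cases "i = 0"; cases "i \<le> n") (auto simp: simplex_chart_def)
qed

lemma sets_simplex_volume: "sets (simplex_volume n) = sets (restrict_space borel (standard_simplex n))"
  and space_simplex_volume: "space (simplex_volume n) = standard_simplex n"
  by (simp_all add: simplex_volume_def space_restrict_space)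

lemma borel_measurable_simplex_volume:
  "f \<in> borel_measurable borel \<Longrightarrow> f \<in> borel_measurable (simplex_volume n)"
  unfolding measurable_cong_sets[OF sets_simplex_volume refl] by (rule measurable_restrict_space1)

text \<open>The factor \<open>fact n\<close> is the reciprocal of the Lebesgue volume of
  \<open>corner_simplex n\<close>.\<close>

lemma nn_integral_simplex_volume:
  assumes f [measurable]: "f \<in> borel_measurable borel"
  shows "(\<integral>\<^sup>+x. f x \<partial>simplex_volume n)
    = fact n * (\<integral>\<^sup>+t. f (simplex_chart n t) * indicator (corner_simplex n) t \<partial>(\<Pi>\<^sub>M i\<in>{1..n}. lborel))"
proof -
  note corner_simplex_sets [measurable]
  have fr: "f \<in> borel_measurable (restrict_space borel (standard_simplex n))"
    by (rule measurable_restrict_space1) measurable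
  have [measurable]: "(\<lambda>t. f (simplex_chart n t)) \<in> borel_measurable (corner_lebesgue n)"
    using measurable_compose[OF simplex_chart_measurable fr] .
  have sp: "corner_simplex n \<in> sets (corner_lebesgue n)"
    using sets.top[of "corner_lebesgue n"] by (simp add: space_corner_lebesgue)
  have "(\<integral>\<^sup>+x. f x \<partial>simplex_volume n)
      = (\<integral>\<^sup>+t. f (simplex_chart n t) \<partial>uniform_measure (corner_lebesgue n) (corner_simplex n))"
    unfolding simplex_volume_def space_corner_lebesgue
  proof (rule nn_integral_distr)
    show "simplex_chart n \<in> uniform_measure (corner_lebesgue n) (corner_simplex n)
        \<rightarrow>\<^sub>M restrict_space borel (standard_simplex n)"
      unfolding measurable_cong_sets[OF sets_uniform_measure refl] by (rule simplex_chart_measurable)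
    show "f \<in> borel_measurable
        (distr (uniform_measure (corner_lebesgue n) (corner_simplex n)) (restrict_space borel (standard_simplex n)) (simplex_chart n))"
      unfolding measurable_cong_sets[OF sets_distr refl] by (rule fr)
  qed
  also have "\<dots> = (\<integral>\<^sup>+t. f (simplex_chart n t) * indicator (corner_simplex n) t \<partial>corner_lebesgue n)
      / (1 / fact n)"
    by (subst nn_integral_uniform_measure[OF _ sp]) (simp_all add: emeasure_corner_lebesgue)
  also have "(\<integral>\<^sup>+t. f (simplex_chart n t) * indicator (corner_simplex n) t \<partial>corner_lebesgue n)
      = (\<integral>\<^sup>+t. f (simplex_chart n t) * indicator (corner_simplex n) t \<partial>(\<Pi>\<^sub>M i\<in>{1..n}. lborel))"
    unfolding corner_lebesgue_def
    by (subst nn_integral_restrict_space[OF sets.Int[OF corner_simplex_sets sets.top]])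
       (auto intro!: nn_integral_cong simp: indicator_def)
  also have "x / (1 / fact n) = fact n * x" for x :: ennreal
  proof -
    have "1 / fact n = inverse (ennreal (fact n))"
      unfolding ennreal_fact by (simp add: divide_ennreal_def)
    then have "inverse (1 / fact n :: ennreal) = ennreal (fact n)"
      by (simp only: inverse_ennreal fact_gt_zero inverse_positive_iff_positive inverse_inverse_eq)
    then show ?thesis
      by (simp add: divide_ennreal_def ennreal_fact mult.commute)
  qed
  finally show ?thesis .
qed

text \<open>The chart hides coordinate 0 as one minus the sum of the others, so this symmetry is not
  a mere renaming. With all coordinates except \<open>a\<close> frozen, exchanging 0 and
  \<open>a\<close> is the reflection \<open>y \<mapsto> 1 - sum x J - y\<close> of a line, which
  preserves Lebesgue measure and the slice of the corner simplex.\<close>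

lemma simplex_volume_swap:
  assumes f [measurable]: "f \<in> borel_measurable borel" and a: "a \<in> {1..n}"
  shows "(\<integral>\<^sup>+x. f (\<lambda>i. x (Transposition.transpose 0 a i)) \<partial>simplex_volume n) = (\<integral>\<^sup>+x. f x \<partial>simplex_volume n)"
proof -
  note corner_simplex_sets [measurable]
  interpret product_sigma_finite "\<lambda>_. lborel :: real measure" ..
  define J where "J = {1..n} - {a}"
  have J: "finite J" "a \<notin> J" "{1..n} = insert a J" using a by (auto simp: J_def)
  have [measurable]: "corner_simplex n \<in> sets (\<Pi>\<^sub>M i\<in>insert a J. (lborel :: real measure))"
    and [measurable]: "simplex_chart n \<in> borel_measurable (\<Pi>\<^sub>M i\<in>insert a J. (lborel :: real measure))"
    using corner_simplex_sets[of n, unfolded J(3)] simplex_chart_borel[of n, unfolded J(3)] .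
  note borel_measurable_compose_index[OF f, of "Transposition.transpose 0 a", measurable]
  have upd [measurable]: "(\<lambda>y. x(a := y)) \<in> lborel \<rightarrow>\<^sub>M (\<Pi>\<^sub>M i\<in>insert a J. (lborel :: real measure))"
    if "x \<in> space (\<Pi>\<^sub>M i\<in>J. (lborel :: real measure))" for x
    using that J by (intro measurable_fun_upd[where J=J]) auto
  let ?F = "\<lambda>t. f (simplex_chart n t) * indicator (corner_simplex n) t"
  let ?G = "\<lambda>t. f (\<lambda>i. simplex_chart n t (Transposition.transpose 0 a i)) * indicator (corner_simplex n) t"
  have "(\<integral>\<^sup>+t. ?F t \<partial>(\<Pi>\<^sub>M i\<in>{1..n}. lborel))
      = (\<integral>\<^sup>+x. (\<integral>\<^sup>+y. ?F (x(a := y)) \<partial>lborel) \<partial>(\<Pi>\<^sub>M i\<in>J. lborel))"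
    unfolding J(3) by (rule product_nn_integral_insert[OF J(1,2)]) measurable
  also have "\<dots> = (\<integral>\<^sup>+x. (\<integral>\<^sup>+y. ?G (x(a := y)) \<partial>lborel) \<partial>(\<Pi>\<^sub>M i\<in>J. lborel))"
  proof (rule nn_integral_cong)
    fix x :: "nat \<Rightarrow> real" assume x: "x \<in> space (\<Pi>\<^sub>M i\<in>J. (lborel :: real measure))"
    have [measurable]: "(\<lambda>y. ?F (x(a := y))) \<in> borel_measurable borel"
      using measurable_compose[OF upd[OF x], of ?F] by simp
    have "(\<integral>\<^sup>+y. ?F (x(a := y)) \<partial>lborel) = (\<integral>\<^sup>+y. ?F (x(a := (1 - sum x J) + (-1) * y)) \<partial>lborel)"
      by (subst nn_integral_real_affine[of "\<lambda>y. ?F (x(a := y))" "-1" "1 - sum x J"]) simp_all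
    also have "\<dots> = (\<integral>\<^sup>+y. ?G (x(a := y)) \<partial>lborel)"
    proof (rule nn_integral_cong)
      fix y :: real
      have s: "(\<Sum>j=1..n. (x(a := z)) j) = z + sum x J" for z
        unfolding J(3) using J by (subst sum.insert) (auto intro!: sum.cong)
      have c: "simplex_chart n (x(a := (1 - sum x J) + (-1) * y))
          = (\<lambda>i. simplex_chart n (x(a := y)) (Transposition.transpose 0 a i))"
        unfolding simplex_chart_def s using a by (auto simp: fun_eq_iff Transposition.transpose_def)
      have "x(a := z) \<in> corner_simplex n \<longleftrightarrow> (\<forall>i\<in>J. 0 \<le> x i) \<and> 0 \<le> z \<and> z + sum x J \<le> 1" for z
        using x J unfolding corner_simplex_def mem_Collect_eq s
        by (auto simp: space_PiM PiE_def extensional_def)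
      then have "x(a := (1 - sum x J) + (-1) * y) \<in> corner_simplex n \<longleftrightarrow> x(a := y) \<in> corner_simplex n"
        by auto
      then have "indicator (corner_simplex n) (x(a := (1 - sum x J) + (-1) * y))
          = (indicator (corner_simplex n) (x(a := y)) :: ennreal)"
        unfolding indicator_def by (rule arg_cong)
      then show "?F (x(a := (1 - sum x J) + (-1) * y)) = ?G (x(a := y))"
        unfolding c by (rule arg_cong)
    qed
    finally show "(\<integral>\<^sup>+y. ?F (x(a := y)) \<partial>lborel) = (\<integral>\<^sup>+y. ?G (x(a := y)) \<partial>lborel)" .
  qed
  also have "\<dots> = (\<integral>\<^sup>+t. ?G t \<partial>(\<Pi>\<^sub>M i\<in>{1..n}. lborel))"
    unfolding J(3) by (rule product_nn_integral_insert[OF J(1,2), symmetric]) measurable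
  finally show ?thesis
    unfolding nn_integral_simplex_volume[OF f]
      nn_integral_simplex_volume[OF borel_measurable_compose_index[OF f]] by simp
qed

text \<open>Transpositions generate the symmetric group, and a transposition of \<open>a\<close> and
  \<open>b\<close> that avoids 0 is the product \<open>(0 a)(0 b)(0 a)\<close> of transpositions
  already treated.\<close>

lemma simplex_volume_permutes:
  assumes "\<pi> permutes {..n}" "f \<in> borel_measurable borel"
  shows "(\<integral>\<^sup>+x. f (\<lambda>i. x (\<pi> i)) \<partial>simplex_volume n) = (\<integral>\<^sup>+x. f x \<partial>simplex_volume n)"
  using assms(1) finite_atMost assms(2)
proof (induction arbitrary: f rule: permutes_induct)
  case (swap a b \<pi>)
  let ?t = "Transposition.transpose"
  note borel_measurable_compose_index [intro]
  have *: "(\<integral>\<^sup>+x. g (\<lambda>i. x (?t 0 c i)) \<partial>simplex_volume n) = (\<integral>\<^sup>+x. g x \<partial>simplex_volume n)"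
    if "c \<in> {..n}" "g \<in> borel_measurable borel" for c and g :: "(nat \<Rightarrow> real) \<Rightarrow> ennreal"
    using that simplex_volume_swap[of g c n] by (cases "c = 0") auto
  have t: "(\<integral>\<^sup>+x. g (\<lambda>i. x (?t a b i)) \<partial>simplex_volume n) = (\<integral>\<^sup>+x. g x \<partial>simplex_volume n)"
    if [measurable]: "g \<in> borel_measurable borel" for g :: "(nat \<Rightarrow> real) \<Rightarrow> ennreal"
  proof (cases "a = 0 \<or> b = 0")
    case True
    then show ?thesis using *[of a g] *[of b g] swap by (auto simp: transpose_commute)
  next
    case False
    have "?t a b i = ?t 0 a (?t 0 b (?t 0 a i))" for i
      using False swap by (auto simp: Transposition.transpose_def)
    then have "(\<integral>\<^sup>+x. g (\<lambda>i. x (?t a b i)) \<partial>simplex_volume n)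
        = (\<integral>\<^sup>+x. g (\<lambda>i. x (?t 0 a (?t 0 b (?t 0 a i)))) \<partial>simplex_volume n)" by simp
    also have "\<dots> = (\<integral>\<^sup>+x. g (\<lambda>i. x (?t 0 b (?t 0 a i))) \<partial>simplex_volume n)"
      using swap by (intro *[of a "\<lambda>x. g (\<lambda>i. x (?t 0 b (?t 0 a i)))"]) auto
    also have "\<dots> = (\<integral>\<^sup>+x. g (\<lambda>i. x (?t 0 a i)) \<partial>simplex_volume n)"
      using swap by (intro *[of b "\<lambda>x. g (\<lambda>i. x (?t 0 a i))"]) auto
    also have "\<dots> = (\<integral>\<^sup>+x. g x \<partial>simplex_volume n)"
      using swap by (intro *) auto
    finally show ?thesis .
  qed
  have f: "f \<in> borel_measurable borel" by fact
  have "(\<integral>\<^sup>+x. f (\<lambda>i. x ((?t a b \<circ> \<pi>) i)) \<partial>simplex_volume n)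
      = (\<integral>\<^sup>+x. f (\<lambda>i. x (\<pi> i)) \<partial>simplex_volume n)"
    using t[OF borel_measurable_compose_index[OF f, of \<pi>]] by simp
  then show ?case using swap.IH[OF f] by simp
qed simp_all

text \<open>The substitution is triangular with diagonal entries \<open>1 / (k + 1)\<close>. By
  Fubini it is carried out one coordinate at a time, from the last index down: once the coordinates
  above \<open>m\<close> are fixed, the \<open>m\<close>-th one is an affine function of
  \<open>s m\<close>, and its slope contributes one factor of the determinant.\<close>

lemma nn_integral_triangular:
  assumes "m \<le> Suc n" "F \<in> borel_measurable (\<Pi>\<^sub>M i\<in>{m..n}. (lborel :: real measure))"
  shows "(\<integral>\<^sup>+t. F t \<partial>(\<Pi>\<^sub>M i\<in>{m..n}. lborel))
    = ennreal (\<Prod>k=m..n. 1 / real (Suc k)) *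
      (\<integral>\<^sup>+s. F (\<lambda>i\<in>{m..n}. \<Sum>k=i..n. s k / real (Suc k)) \<partial>(\<Pi>\<^sub>M i\<in>{m..n}. lborel))"
  using assms
proof (induction m arbitrary: F rule: inc_induct)
  case base
  have "(\<integral>\<^sup>+t. F t \<partial>(\<Pi>\<^sub>M i\<in>{Suc n..n}. lborel)) =
      (\<integral>\<^sup>+s. F (\<lambda>i\<in>{Suc n..n}. \<Sum>k=i..n. s k / real (Suc k)) \<partial>(\<Pi>\<^sub>M i\<in>{Suc n..n}. lborel))"
    by (rule nn_integral_cong) (auto intro!: arg_cong[where f=F] simp: space_PiM restrict_def)
  then show ?case
    by (simp only: atLeastatMost_empty[OF lessI] prod.empty ennreal_1 mult_1)
next
  case (step m)
  interpret product_sigma_finite "\<lambda>_. lborel :: real measure" ..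
  have c: "ennreal (\<Prod>k=m..n. 1 / real (Suc k))
      = ennreal (1 / real (Suc m)) * ennreal (\<Prod>k=Suc m..n. 1 / real (Suc k))"
    using step.hyps
    by (subst prod.atLeast_Suc_atMost) (simp_all add: ennreal_mult'[symmetric] prod_nonneg)
  let ?P = "\<Pi>\<^sub>M i\<in>{Suc m..n}. (lborel :: real measure)"
  have J: "finite {Suc m..n}" "m \<notin> {Suc m..n}" "{m..n} = insert m {Suc m..n}"
    using atLeastAtMost_insertL[of m n] step.hyps by simp_all
  have F [measurable]: "F \<in> borel_measurable (\<Pi>\<^sub>M i\<in>insert m {Suc m..n}. (lborel :: real measure))"
    using step.prems(1)[unfolded J(3)] .
  define L where "L j s = (\<lambda>i\<in>{j..n}. \<Sum>k=i..n. s k / real (Suc k))" for j and s :: "nat \<Rightarrow> real"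
  have Lm: "L j \<in> (\<Pi>\<^sub>M i\<in>{j..n}. lborel) \<rightarrow>\<^sub>M (\<Pi>\<^sub>M i\<in>{j..n}. (lborel :: real measure))" for j
    unfolding L_def by (intro measurable_restrict) auto
  have [measurable]: "L m \<in> (\<Pi>\<^sub>M i\<in>insert m {Suc m..n}. lborel) \<rightarrow>\<^sub>M (\<Pi>\<^sub>M i\<in>insert m {Suc m..n}. (lborel :: real measure))"
    using Lm[of m, unfolded J(3)] .
  note Lm[of "Suc m", measurable]
  have upd [measurable]: "(\<lambda>y. x(m := y)) \<in> lborel \<rightarrow>\<^sub>M (\<Pi>\<^sub>M i\<in>insert m {Suc m..n}. (lborel :: real measure))"
    if "x \<in> space ?P" for x
    using that J by (intro measurable_fun_upd[where J="{Suc m..n}"]) auto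
  have "(\<integral>\<^sup>+t. F t \<partial>(\<Pi>\<^sub>M i\<in>{m..n}. lborel)) = (\<integral>\<^sup>+x. (\<integral>\<^sup>+y. F (x(m := y)) \<partial>lborel) \<partial>?P)"
    unfolding J(3) by (rule product_nn_integral_insert[OF J(1,2)]) measurable
  also have "\<dots> = ennreal (\<Prod>k=Suc m..n. 1 / real (Suc k)) *
      (\<integral>\<^sup>+s. (\<integral>\<^sup>+y. F ((L (Suc m) s)(m := y)) \<partial>lborel) \<partial>?P)"
    unfolding L_def by (rule step.IH) measurable
  also have "(\<integral>\<^sup>+s. (\<integral>\<^sup>+y. F ((L (Suc m) s)(m := y)) \<partial>lborel) \<partial>?P)
      = (\<integral>\<^sup>+s. ennreal (1 / real (Suc m)) * (\<integral>\<^sup>+y. F (L m (s(m := y))) \<partial>lborel) \<partial>?P)"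
  proof (rule nn_integral_cong)
    fix s :: "nat \<Rightarrow> real" assume s: "s \<in> space ?P"
    have Ls: "L (Suc m) s \<in> space ?P" using measurable_space[OF Lm s] .
    have [measurable]: "(\<lambda>y. F ((L (Suc m) s)(m := y))) \<in> borel_measurable borel"
      using measurable_compose[OF upd[OF Ls] F] by simp
    \<comment> \<open>Entries above \<open>m\<close> of the image do not involve the coordinate
      \<open>m\<close> of \<open>s\<close>, so altering that coordinate changes the entry
      \<open>m\<close> alone.\<close>
    have eq: "(L (Suc m) s)(m := (\<Sum>k=Suc m..n. s k / real (Suc k)) + (1 / real (Suc m)) * y)
        = L m (s(m := y))" for y
    proof
      fix i
      have "(\<Sum>k=m..n. (s(m := y)) k / real (Suc k)) = y / real (Suc m) + (\<Sum>k=Suc m..n. s k / real (Suc k))"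
        using step.hyps by (subst sum.atLeast_Suc_atMost) (auto intro!: sum.cong)
      moreover have "(\<Sum>k=i..n. (s(m := y)) k / real (Suc k)) = (\<Sum>k=i..n. s k / real (Suc k))" if "i > m"
        using that by (intro sum.cong) auto
      ultimately show "((L (Suc m) s)(m := (\<Sum>k=Suc m..n. s k / real (Suc k)) + (1 / real (Suc m)) * y)) i
          = L m (s(m := y)) i"
        using step.hyps by (cases i m rule: linorder_cases) (auto simp: L_def)
    qed
    show "(\<integral>\<^sup>+y. F ((L (Suc m) s)(m := y)) \<partial>lborel)
        = ennreal (1 / real (Suc m)) * (\<integral>\<^sup>+y. F (L m (s(m := y))) \<partial>lborel)"
      unfolding eq[symmetric]
      by (subst nn_integral_real_affine[of _ "1 / real (Suc m)" "\<Sum>k=Suc m..n. s k / real (Suc k)"]) simp_all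
  qed
  also have "\<dots> = ennreal (1 / real (Suc m)) * (\<integral>\<^sup>+s. (\<integral>\<^sup>+y. F (L m (s(m := y))) \<partial>lborel) \<partial>?P)"
    by (rule nn_integral_cmult) measurable
  also have "(\<integral>\<^sup>+s. (\<integral>\<^sup>+y. F (L m (s(m := y))) \<partial>lborel) \<partial>?P) = (\<integral>\<^sup>+s. F (L m s) \<partial>(\<Pi>\<^sub>M i\<in>{m..n}. lborel))"
    unfolding J(3) by (rule product_nn_integral_insert[OF J(1,2), symmetric]) measurable
  finally show ?case
    unfolding c L_def by (simp only: mult_ac)
qed

text \<open>
  The affine map from the standard simplex onto \<open>{x\<^sub>0 \<ge> x\<^sub>1 \<ge> \<dots> \<ge> x\<^sub>n}\<close> that sends the \<open>k\<close>-th
  vertex to the barycenter of the vertices \<open>0, \<dots>, k\<close>.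
\<close>

definition sorted_chart :: "nat \<Rightarrow> (nat \<Rightarrow> real) \<Rightarrow> nat \<Rightarrow> real" where
  "sorted_chart n y i = (if i \<le> n then \<Sum>k=i..n. y k / real (Suc k) else 0)"

text \<open>A closed chamber for the permutations of the coordinates \<open>0, ..., n\<close>. Its
  translates cover the space but overlap where coordinates agree.\<close>

definition sorted_region :: "nat \<Rightarrow> (nat \<Rightarrow> real) set" where
  "sorted_region n = {x. \<forall>i<n. x (Suc i) \<le> x i}"

lemma sorted_region_sets [measurable]: "sorted_region n \<in> sets borel"
proof -
  have "sorted_region n = (\<Inter>i\<in>{..<n}. {x. x (Suc i) \<le> x i})"
    by (auto simp: sorted_region_def)
  moreover have "closed \<dots>"
    by (intro closed_INT ballI closed_Collect_le continuous_on_product_coordinates)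
  ultimately show ?thesis by simp
qed

lemma sorted_chart_measurable [measurable]: "sorted_chart n \<in> borel_measurable borel"
proof (rule measurable_coordinatewise_then_product)
  have [measurable]: "(\<lambda>x. x i) \<in> borel_measurable (borel :: (nat \<Rightarrow> real) measure)" for i
    by (intro borel_measurable_continuous_onI continuous_on_product_coordinates)
  show "(\<lambda>y. sorted_chart n y i) \<in> borel_measurable borel" for i
    by (cases "i \<le> n") (simp_all add: sorted_chart_def)
qed

text \<open>The term \<open>y k / (k + 1)\<close> occurs once for each of the \<open>k + 1\<close>
  indices \<open>i \<le> k\<close>.\<close>

lemma sum_sorted_chart: "(\<Sum>i\<le>n. sorted_chart n y i) = (\<Sum>k\<le>n. y k)"
proof -
  have "(\<Sum>i\<le>n. sorted_chart n y i) = (\<Sum>i\<le>n. \<Sum>k\<in>{k. k \<in> {..n} \<and> i \<le> k}. y k / real (Suc k))"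
    by (intro sum.cong) (auto simp: sorted_chart_def intro!: sum.cong)
  also have "\<dots> = (\<Sum>k\<le>n. \<Sum>i\<in>{i. i \<in> {..n} \<and> i \<le> k}. y k / real (Suc k))"
    by (rule sum.swap_restrict) auto
  also have "\<dots> = (\<Sum>k\<le>n. y k)"
  proof (rule sum.cong[OF refl])
    fix k assume "k \<in> {..n}"
    then have "{i. i \<in> {..n} \<and> i \<le> k} = {..k}" by auto
    then show "(\<Sum>i\<in>{i. i \<in> {..n} \<and> i \<le> k}. y k / real (Suc k)) = y k" by simp
  qed
  finally show ?thesis .
qed

lemma sorted_chart_in_simplex:
  assumes "y \<in> standard_simplex n"
  shows "sorted_chart n y \<in> standard_simplex n"
proof (rule standard_simplexI)
  have y: "0 \<le> y i" "(\<Sum>i\<le>n. y i) = 1" for i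
    using assms by (simp_all add: standard_simplex_def)
  show "0 \<le> sorted_chart n y i" for i
    using y(1) by (simp add: sorted_chart_def sum_nonneg)
  show "(\<Sum>i\<le>n. sorted_chart n y i) = 1"
    unfolding sum_sorted_chart by (rule y)
qed (simp add: sorted_chart_def)

text \<open>In the corner coordinates \<open>1, ..., n\<close> the map \<open>sorted_chart\<close>
  is the triangular substitution with determinant \<open>1 / fact (n + 1)\<close>; coordinate 0 is
  recovered from the sum. It remains to match the domains of integration.\<close>

lemma nn_integral_sorted_region:
  assumes f [measurable]: "f \<in> borel_measurable borel"
  shows "(\<integral>\<^sup>+x. f x * indicator (sorted_region n) x \<partial>simplex_volume n)
    = ennreal (1 / fact (Suc n)) * (\<integral>\<^sup>+y. f (sorted_chart n y) \<partial>simplex_volume n)"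
proof -
  note corner_simplex_sets [measurable]
  define F where "F t = f (simplex_chart n t) * indicator (sorted_region n) (simplex_chart n t)
    * indicator (corner_simplex n) t" for t
  have Fm [measurable]: "F \<in> borel_measurable (\<Pi>\<^sub>M i\<in>{1..n}. lborel)"
    unfolding F_def by measurable
  have prod: "(\<Prod>k=1..n. 1 / real (Suc k)) = 1 / fact (Suc n)"
    by (induction n) (auto simp: field_simps)
  let ?L = "\<lambda>s. \<lambda>i\<in>{1..n}. \<Sum>k=i..n. s k / real (Suc k)"
  have "(\<integral>\<^sup>+x. f x * indicator (sorted_region n) x \<partial>simplex_volume n)
      = fact n * (\<integral>\<^sup>+t. F t \<partial>(\<Pi>\<^sub>M i\<in>{1..n}. lborel))"
    unfolding F_def by (rule nn_integral_simplex_volume) measurable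
  also have "(\<integral>\<^sup>+t. F t \<partial>(\<Pi>\<^sub>M i\<in>{1..n}. lborel))
      = ennreal (1 / fact (Suc n)) * (\<integral>\<^sup>+s. F (?L s) \<partial>(\<Pi>\<^sub>M i\<in>{1..n}. lborel))"
    using nn_integral_triangular[of 1 n F] Fm unfolding prod by simp
  also have "(\<integral>\<^sup>+s. F (?L s) \<partial>(\<Pi>\<^sub>M i\<in>{1..n}. lborel))
    = (\<integral>\<^sup>+s. f (sorted_chart n (simplex_chart n s)) * indicator (corner_simplex n) s \<partial>(\<Pi>\<^sub>M i\<in>{1..n}. lborel))"
  proof (rule nn_integral_cong)
    fix s :: "nat \<Rightarrow> real" assume "s \<in> space (\<Pi>\<^sub>M i\<in>{1..n}. (lborel :: real measure))"
    then have s: "s \<in> extensional {1..n}" by (simp add: space_PiM PiE_def)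
    define x where "x = sorted_chart n (simplex_chart n s)"
    have "(\<Sum>k\<le>n. simplex_chart n s k) = simplex_chart n s 0 + (\<Sum>k=1..n. s k)"
      by (subst sum.atMost_shift) (auto simp: simplex_chart_def sum.atLeast1_atMost_eq lessThan_Suc_atMost[symmetric]
          intro!: sum.cong)
    then have sx: "(\<Sum>i\<le>n. x i) = 1"
      unfolding x_def sum_sorted_chart by (simp add: simplex_chart_def)
    have xi: "x i = ?L s i" if "i \<in> {1..n}" for i
      using that by (auto simp: x_def sorted_chart_def simplex_chart_def intro!: sum.cong)
    have "(\<Sum>i\<le>n. x i) = x 0 + (\<Sum>i=1..n. x i)"
      by (subst sum.atMost_shift) (auto simp: sum.atLeast1_atMost_eq lessThan_Suc_atMost[symmetric])
    also have "(\<Sum>i=1..n. x i) = (\<Sum>i=1..n. ?L s i)"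
      by (rule sum.cong) (use xi in auto)
    finally have x0: "x 0 = 1 - (\<Sum>i=1..n. ?L s i)" using sx by simp
    have chart: "simplex_chart n (?L s) = x"
    proof
      fix i show "simplex_chart n (?L s) i = x i"
      proof (cases "i \<in> {1..n}")
        case True
        then show ?thesis using xi by (simp add: simplex_chart_def)
      next
        case False
        then show ?thesis using x0 by (cases "i = 0") (auto simp: simplex_chart_def x_def sorted_chart_def)
      qed
    qed
    \<comment> \<open>Successive differences recover the original point, so its coordinates are
      nonnegative exactly when \<open>x\<close> is weakly decreasing. For \<open>i = n\<close> this
      involves \<open>x (Suc n) = 0\<close>, and the condition there reads
      \<open>0 \<le> x n\<close>.\<close>
    have diff: "x i - x (Suc i) = simplex_chart n s i / real (Suc i)" if "i \<le> n" for i
      using that by (cases "i = n") (auto simp: x_def sorted_chart_def sum.atLeast_Suc_atMost)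
    have xs: "x (Suc n) = 0" by (simp add: x_def sorted_chart_def)
    have "x \<in> sorted_region n \<and> ?L s \<in> corner_simplex n \<longleftrightarrow> s \<in> corner_simplex n"
    proof
      assume *: "x \<in> sorted_region n \<and> ?L s \<in> corner_simplex n"
      have "0 \<le> x i" if "i \<le> n" for i
      proof (cases "i = 0")
        case True
        have "(\<Sum>i=1..n. ?L s i) \<le> 1" using * unfolding corner_simplex_def by blast
        then show ?thesis using x0 True by simp
      next
        case False
        then have "i \<in> {1..n}" using that by simp
        moreover from this * have "0 \<le> ?L s i" unfolding corner_simplex_def by blast
        ultimately show ?thesis using xi by simp
      qed
      then have mono: "x (Suc i) \<le> x i" if "i \<le> n" for i
        using * that xs by (cases "i = n") (auto simp: sorted_region_def)
      have nn: "0 \<le> simplex_chart n s i" if "i \<le> n" for i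
      proof -
        have "simplex_chart n s i = (x i - x (Suc i)) * real (Suc i)"
          unfolding diff[OF that] by simp
        then show ?thesis using mono[OF that] by simp
      qed
      have "0 \<le> s i" if "i \<in> {1..n}" for i
        using nn[of i] that by (simp add: simplex_chart_def)
      moreover have "(\<Sum>i=1..n. s i) \<le> 1"
        using nn[of 0] by (simp add: simplex_chart_def)
      ultimately show "s \<in> corner_simplex n"
        using s by (simp add: corner_simplex_def PiE_def)
    next
      assume *: "s \<in> corner_simplex n"
      have nn: "0 \<le> simplex_chart n s i" for i
        using * by (auto simp: corner_simplex_def simplex_chart_def)
      have "x (Suc i) \<le> x i" if "i < n" for i
      proof -
        have "0 \<le> x i - x (Suc i)"
          using that nn[of i] by (subst diff) simp_all
        then show ?thesis by simp
      qed
      then have "x \<in> sorted_region n" by (simp add: sorted_region_def)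
      have x_nn: "0 \<le> x i" for i
        using nn by (auto simp: x_def sorted_chart_def intro!: sum_nonneg)
      have "\<forall>i\<in>{1..n}. 0 \<le> ?L s i" by (metis x_nn xi)
      moreover have "(\<Sum>i=1..n. ?L s i) \<le> 1" using x_nn[of 0] unfolding x0 by simp
      moreover have "?L s \<in> {1..n} \<rightarrow>\<^sub>E UNIV" unfolding restrict_PiE_iff by blast
      ultimately have "?L s \<in> corner_simplex n"
        unfolding corner_simplex_def by (intro CollectI conjI)
      note this \<open>x \<in> sorted_region n\<close>
      then show "x \<in> sorted_region n \<and> ?L s \<in> corner_simplex n" by blast
    qed
    then show "F (?L s) = f (sorted_chart n (simplex_chart n s)) * indicator (corner_simplex n) s"
      unfolding F_def chart x_def[symmetric] by (auto simp: indicator_def)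
  qed
  finally show ?thesis
    unfolding nn_integral_simplex_volume[OF measurable_compose[OF sorted_chart_measurable f]]
    by (simp add: ac_simps)
qed

section \<open>Averaging over all chambers\<close>

lemma ex_sorting_permutation:
  fixes x :: "nat \<Rightarrow> real"
  shows "\<exists>\<pi>. \<pi> permutes {..n} \<and> (\<lambda>i. x (\<pi> i)) \<in> sorted_region n"
proof -
  define xs where "xs = map x [0..<Suc n]"
  have "mset (rev (sort xs)) = mset xs" by simp
  then obtain \<pi> where p: "\<pi> permutes {..<length xs}" "permute_list \<pi> xs = rev (sort xs)"
    by (rule mset_eq_permutation)
  have len: "length xs = Suc n" by (simp add: xs_def)
  have x: "x (\<pi> i) = rev (sort xs) ! i" if "i \<le> n" for i
  proof -
    have "\<pi> i < Suc n" using permutes_in_image[OF p(1), of i] that len by simp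
    then show ?thesis
      unfolding p(2)[symmetric] using permute_list_nth[OF p(1), of i] that len
      by (simp add: xs_def del: upt_Suc)
  qed
  have "x (\<pi> (Suc i)) \<le> x (\<pi> i)" if "i < n" for i
    using that len by (simp add: x rev_nth sorted_nth_mono)
  then show ?thesis
    using p(1) len by (auto simp: sorted_region_def lessThan_Suc_atMost)
qed

text \<open>\<open>N x\<close> counts the permutations that sort \<open>x\<close>. Invariance of the
  measure moves each of these permutations from the indicator to the integrand, so the identity
  holds with the weight \<open>N\<close> on the left. The rest of the proof removes the weight,
  using \<open>N \<ge> 1\<close> and the case of a constant integrand.\<close>

lemma simplex_volume_subdivision_nn:
  assumes f [measurable]: "f \<in> borel_measurable borel"
  shows "(\<integral>\<^sup>+x. f x \<partial>simplex_volume n) = ennreal (1 / fact (Suc n)) *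
    (\<Sum>\<pi> | \<pi> permutes {..n}. \<integral>\<^sup>+y. f (\<lambda>i. sorted_chart n y (\<pi> i)) \<partial>simplex_volume n)"
proof -
  interpret prob_space "simplex_volume n" by (rule prob_space_simplex_volume)
  let ?S = "{\<pi>. \<pi> permutes {..n}}"
  have fin: "finite ?S" by (rule finite_permutations) simp
  define N where "N x = (\<Sum>\<pi>\<in>?S. indicator (sorted_region n) (\<lambda>i. x (\<pi> i)) :: ennreal)" for x :: "nat \<Rightarrow> real"
  have ind: "(\<lambda>x. indicator (sorted_region n) (\<lambda>i. x (\<pi> i)) :: ennreal) \<in> borel_measurable borel"
    for \<pi> :: "nat \<Rightarrow> nat"
    by (rule borel_measurable_compose_index[of "indicator (sorted_region n)" \<pi>]) measurable
  note ind [measurable]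
  have [measurable]: "N \<in> borel_measurable borel"
    unfolding N_def by measurable
  have main: "(\<integral>\<^sup>+x. g x * N x \<partial>simplex_volume n) = ennreal (1 / fact (Suc n)) *
      (\<Sum>\<pi>\<in>?S. \<integral>\<^sup>+y. g (\<lambda>i. sorted_chart n y (\<pi> i)) \<partial>simplex_volume n)"
    if g [measurable]: "g \<in> borel_measurable borel" for g
  proof -
    have "(\<integral>\<^sup>+x. g x * N x \<partial>simplex_volume n)
        = (\<Sum>\<pi>\<in>?S. \<integral>\<^sup>+x. g x * indicator (sorted_region n) (\<lambda>i. x (\<pi> i)) \<partial>simplex_volume n)"
      unfolding N_def sum_distrib_left
      by (intro nn_integral_sum borel_measurable_simplex_volume) measurable
    also have "\<dots> = (\<Sum>\<pi>\<in>?S. ennreal (1 / fact (Suc n)) *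
        (\<integral>\<^sup>+y. g (\<lambda>i. sorted_chart n y (inv_into UNIV \<pi> i)) \<partial>simplex_volume n))"
    proof (rule sum.cong[OF refl])
      fix \<pi> assume "\<pi> \<in> ?S"
      then have p: "\<pi> permutes {..n}" by simp
      note borel_measurable_compose_index[OF g, of "inv_into UNIV \<pi>", measurable]
      have "(\<integral>\<^sup>+x. g x * indicator (sorted_region n) (\<lambda>i. x (\<pi> i)) \<partial>simplex_volume n)
          = (\<integral>\<^sup>+x. g (\<lambda>i. x (\<pi> (inv_into UNIV \<pi> i))) * indicator (sorted_region n) (\<lambda>i. x (\<pi> i)) \<partial>simplex_volume n)"
        using permutes_inverses(1)[OF p] by simp
      also have "\<dots> = (\<integral>\<^sup>+x. g (\<lambda>i. x (inv_into UNIV \<pi> i)) * indicator (sorted_region n) x \<partial>simplex_volume n)"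
        by (rule simplex_volume_permutes[OF p, of "\<lambda>x. g (\<lambda>i. x (inv_into UNIV \<pi> i)) * indicator (sorted_region n) x"])
           measurable
      also have "\<dots> = ennreal (1 / fact (Suc n)) *
          (\<integral>\<^sup>+y. g (\<lambda>i. sorted_chart n y (inv_into UNIV \<pi> i)) \<partial>simplex_volume n)"
        by (rule nn_integral_sorted_region) measurable
      finally show "(\<integral>\<^sup>+x. g x * indicator (sorted_region n) (\<lambda>i. x (\<pi> i)) \<partial>simplex_volume n)
          = ennreal (1 / fact (Suc n)) *
            (\<integral>\<^sup>+y. g (\<lambda>i. sorted_chart n y (inv_into UNIV \<pi> i)) \<partial>simplex_volume n)" .
    qed
    also have "\<dots> = ennreal (1 / fact (Suc n)) *
        (\<Sum>\<pi>\<in>?S. \<integral>\<^sup>+y. g (\<lambda>i. sorted_chart n y (inv_into UNIV \<pi> i)) \<partial>simplex_volume n)"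
      by (simp add: sum_distrib_left)
    also have "(\<Sum>\<pi>\<in>?S. \<integral>\<^sup>+y. g (\<lambda>i. sorted_chart n y (inv_into UNIV \<pi> i)) \<partial>simplex_volume n)
        = (\<Sum>\<pi>\<in>?S. \<integral>\<^sup>+y. g (\<lambda>i. sorted_chart n y (\<pi> i)) \<partial>simplex_volume n)"
      by (rule sum_permutations_inverse[symmetric])
    finally show ?thesis .
  qed
  have ge: "1 \<le> N x" for x
  proof -
    obtain \<pi> where p: "\<pi> \<in> ?S" "(\<lambda>i. x (\<pi> i)) \<in> sorted_region n"
      using ex_sorting_permutation[of n x] by auto
    have "(indicator (sorted_region n) (\<lambda>i. x (\<pi> i)) :: ennreal) \<le> N x"
      unfolding N_def by (rule member_le_sum[OF p(1)]) (use fin in auto)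
    with p(2) show ?thesis by simp
  qed
  have "(\<integral>\<^sup>+x. N x \<partial>simplex_volume n) = ennreal (1 / fact (Suc n)) * of_nat (card ?S)"
    using main[of "\<lambda>_. 1"] by (simp add: emeasure_space_1)
  also have "card ?S = fact (Suc n)"
    using card_permutations[of "{..n}" "Suc n"] by simp
  also have "ennreal (1 / fact (Suc n)) * of_nat (fact (Suc n)) = 1"
    unfolding ennreal_of_nat_eq_real_of_nat
    by (subst ennreal_mult'[symmetric]) (simp_all del: fact_Suc)
  finally have one: "(\<integral>\<^sup>+x. N x \<partial>simplex_volume n) = 1" .
  \<comment> \<open>Points with two equal coordinates are counted several times by \<open>N\<close>; this shows that they
    form a null set.\<close>
  have "AE x in simplex_volume n. N x = 1"
  proof -
    have "(\<integral>\<^sup>+x. N x - 1 \<partial>simplex_volume n) = (\<integral>\<^sup>+x. N x \<partial>simplex_volume n) - (\<integral>\<^sup>+x. 1 \<partial>simplex_volume n)"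
    proof (rule nn_integral_diff)
      show "N \<in> borel_measurable (simplex_volume n)"
        by (rule borel_measurable_simplex_volume) measurable
      show "AE x in simplex_volume n. 1 \<le> N x"
        by (rule AE_I2) (rule ge)
    qed (simp_all add: emeasure_space_1)
    also have "\<dots> = 0" by (simp add: one emeasure_space_1)
    finally have z: "(\<integral>\<^sup>+x. N x - 1 \<partial>simplex_volume n) = 0" .
    have "(\<lambda>x. N x - 1) \<in> borel_measurable (simplex_volume n)"
      by (rule borel_measurable_simplex_volume) measurable
    from iffD1[OF nn_integral_0_iff_AE[OF this] z] have "AE x in simplex_volume n. N x - 1 = 0" .
    then show ?thesis
    proof (rule AE_mp[OF _ AE_I2], intro impI)
      fix x assume "N x - 1 = 0"
      then have "N x \<le> 1" unfolding diff_eq_0_iff_ennreal by blast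
      with ge[of x] show "N x = 1" by (rule antisym[rotated])
    qed
  qed
  then have "(\<integral>\<^sup>+x. f x \<partial>simplex_volume n) = (\<integral>\<^sup>+x. f x * N x \<partial>simplex_volume n)"
  proof (intro nn_integral_cong_AE, eventually_elim)
    case (elim x)
    then show ?case by simp
  qed
  then show ?thesis
    unfolding main[OF f] .
qed

lemma permuted_sorted_chart_in_simplex:
  assumes "\<pi> permutes {..n}" "y \<in> standard_simplex n"
  shows "(\<lambda>i. sorted_chart n y (\<pi> i)) \<in> standard_simplex n"
proof (rule standard_simplexI)
  have x: "sorted_chart n y \<in> standard_simplex n" by (rule sorted_chart_in_simplex) fact
  show "0 \<le> sorted_chart n y (\<pi> i)" for i
    using x by (simp add: standard_simplex_def)
  show "sorted_chart n y (\<pi> i) = 0" if "i > n" for i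
    using x permutes_not_in[OF assms(1), of i] that by (simp add: standard_simplex_def)
  show "(\<Sum>i\<le>n. sorted_chart n y (\<pi> i)) = 1"
    using sum.permute[OF assms(1), of "sorted_chart n y"] x by (simp add: standard_simplex_def o_def)
qed

lemma permuted_sorted_chart_measurable:
  assumes "\<pi> permutes {..n}"
  shows "(\<lambda>y i. sorted_chart n y (\<pi> i))
    \<in> restrict_space borel (standard_simplex n) \<rightarrow>\<^sub>M restrict_space borel (standard_simplex n)"
proof (rule measurable_restrict_space2)
  show "(\<lambda>y i. sorted_chart n y (\<pi> i)) \<in> borel_measurable (restrict_space borel (standard_simplex n))"
    by (rule measurable_restrict_space1)
       (rule measurable_compose[OF sorted_chart_measurable borel_measurable_comp_index])
qed (use permuted_sorted_chart_in_simplex[OF assms] in \<open>simp add: space_restrict_space\<close>)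

lemma simplex_volume_integrable:
  fixes f :: "(nat \<Rightarrow> real) \<Rightarrow> real"
  assumes "f \<in> borel_measurable (restrict_space borel (standard_simplex n))"
    and "\<And>x. x \<in> standard_simplex n \<Longrightarrow> \<bar>f x\<bar> \<le> B"
  shows "integrable (simplex_volume n) f"
proof -
  interpret prob_space "simplex_volume n" by (rule prob_space_simplex_volume)
  show ?thesis
  proof (rule integrable_const_bound[of _ B])
    show "AE x in simplex_volume n. norm (f x) \<le> B"
      by (rule AE_I2) (use assms(2) in \<open>simp add: space_simplex_volume\<close>)
    show "f \<in> borel_measurable (simplex_volume n)"
      unfolding measurable_cong_sets[OF sets_simplex_volume refl] by (rule assms(1))
  qed
qed

text \<open>Adding the bound \<open>B\<close> makes the integrand nonnegative on the simplex; it
  adds \<open>B\<close> to both sides, because the right-hand side is an average of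
  \<open>(n + 1)!\<close> integrals against a probability measure.\<close>

lemma simplex_volume_subdivision:
  fixes f :: "(nat \<Rightarrow> real) \<Rightarrow> real"
  assumes f: "f \<in> borel_measurable (restrict_space borel (standard_simplex n))"
    and bound: "\<And>x. x \<in> standard_simplex n \<Longrightarrow> \<bar>f x\<bar> \<le> B"
  shows "(\<integral>x. f x \<partial>simplex_volume n) = 1 / fact (Suc n) *
    (\<Sum>\<pi> | \<pi> permutes {..n}. \<integral>y. f (\<lambda>i. sorted_chart n y (\<pi> i)) \<partial>simplex_volume n)"
proof -
  interpret prob_space "simplex_volume n" by (rule prob_space_simplex_volume)
  let ?S = "{\<pi>. \<pi> permutes {..n}}"
  have card: "card ?S = fact (Suc n)"
    using card_permutations[of "{..n}" "Suc n"] by simp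
  \<comment> \<open>Measurability of \<open>f\<close> is known on the simplex only, hence the
    extension by 0.\<close>
  define g where "g x = (if x \<in> standard_simplex n then ennreal (f x + B) else 0)" for x
  have g: "g \<in> borel_measurable borel"
    unfolding g_def using f
    by (subst measurable_If_restrict_space_iff) (auto simp: standard_simplex_sets)
  have intg: "integrable (simplex_volume n) (\<lambda>y. f (\<lambda>i. sorted_chart n y (\<pi> i)))"
    if "\<pi> permutes {..n}" for \<pi>
    using bound permuted_sorted_chart_in_simplex[OF that]
    by (intro simplex_volume_integrable[of _ _ B]
        measurable_compose[OF permuted_sorted_chart_measurable[OF that] f]) simp_all
  have int_f: "integrable (simplex_volume n) f"
    by (rule simplex_volume_integrable[OF f bound])
  have conv: "(\<integral>\<^sup>+x. g (h x) \<partial>simplex_volume n) = ennreal ((\<integral>x. f (h x) \<partial>simplex_volume n) + B)"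
    and nonneg: "0 \<le> (\<integral>x. f (h x) \<partial>simplex_volume n) + B"
    if h: "\<And>x. x \<in> standard_simplex n \<Longrightarrow> h x \<in> standard_simplex n"
      and i: "integrable (simplex_volume n) (\<lambda>x. f (h x))" for h
  proof -
    have nn: "0 \<le> f (h x) + B" if "x \<in> standard_simplex n" for x
      using bound[OF h[OF that]] by linarith
    have "(\<integral>\<^sup>+x. g (h x) \<partial>simplex_volume n) = (\<integral>\<^sup>+x. ennreal (f (h x) + B) \<partial>simplex_volume n)"
      by (rule nn_integral_cong) (simp add: g_def h space_simplex_volume)
    also have "\<dots> = ennreal (\<integral>x. f (h x) + B \<partial>simplex_volume n)"
      using i nn by (intro nn_integral_eq_integral AE_I2) (simp_all add: space_simplex_volume)
    also have eq: "(\<integral>x. f (h x) + B \<partial>simplex_volume n) = (\<integral>x. f (h x) \<partial>simplex_volume n) + B"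
      using i by (simp add: prob_space)
    finally show "(\<integral>\<^sup>+x. g (h x) \<partial>simplex_volume n) = ennreal ((\<integral>x. f (h x) \<partial>simplex_volume n) + B)" .
    show "0 \<le> (\<integral>x. f (h x) \<partial>simplex_volume n) + B"
      unfolding eq[symmetric] using nn by (intro integral_nonneg_AE AE_I2) (simp add: space_simplex_volume)
  qed
  let ?I = "\<lambda>\<pi>. \<integral>y. f (\<lambda>i. sorted_chart n y (\<pi> i)) \<partial>simplex_volume n"
  have nn: "0 \<le> ?I \<pi> + B" if "\<pi> \<in> ?S" for \<pi>
    using nonneg[OF permuted_sorted_chart_in_simplex intg] that by simp
  have "ennreal ((\<integral>x. f x \<partial>simplex_volume n) + B) = (\<integral>\<^sup>+x. g x \<partial>simplex_volume n)"
    using conv[of "\<lambda>x. x"] int_f by simp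
  also have "\<dots> = ennreal (1 / fact (Suc n)) * (\<Sum>\<pi>\<in>?S. ennreal (?I \<pi> + B))"
    unfolding simplex_volume_subdivision_nn[OF g]
    by (intro arg_cong2[where f="(*)"] refl sum.cong conv permuted_sorted_chart_in_simplex intg) simp_all
  also have "\<dots> = ennreal (1 / fact (Suc n) * (\<Sum>\<pi>\<in>?S. ?I \<pi> + B))"
  proof -
    have "(\<Sum>\<pi>\<in>?S. ennreal (?I \<pi> + B)) = ennreal (\<Sum>\<pi>\<in>?S. ?I \<pi> + B)"
      by (rule sum_ennreal) (rule nn)
    then show ?thesis
      by (simp only:) (rule ennreal_mult'[symmetric], simp)
  qed
  finally have "(\<integral>x. f x \<partial>simplex_volume n) + B = 1 / fact (Suc n) * (\<Sum>\<pi>\<in>?S. ?I \<pi> + B)"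
  proof (rule ennreal_inj[THEN iffD1, rotated 2])
    show "0 \<le> (\<integral>x. f x \<partial>simplex_volume n) + B"
      using nonneg[of "\<lambda>x. x"] int_f by simp
    show "0 \<le> 1 / fact (Suc n) * (\<Sum>\<pi>\<in>?S. ?I \<pi> + B)"
      by (intro mult_nonneg_nonneg sum_nonneg nn) simp_all
  qed
  also have "(\<Sum>\<pi>\<in>?S. ?I \<pi> + B) = (\<Sum>\<pi>\<in>?S. ?I \<pi>) + fact (Suc n) * B"
    using card by (simp add: sum.distrib del: fact_Suc)
  finally show ?thesis
    by (simp add: distrib_left del: fact_Suc)
qed

section \<open>Mean values over a simplex\<close>

definition simplex_mean :: "('v::real_vector \<Rightarrow> real) \<Rightarrow> 'v set \<Rightarrow> real" where
  "simplex_mean \<phi> \<sigma> = (\<integral>x. \<phi> (simplex_iso \<sigma> x) \<partial>simplex_volume (card \<sigma> - 1))"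

text \<open>Measurability is required through the chart of the simplex, as no topology of the vector
  space is available.\<close>

definition simplex_measurable :: "('v::real_vector \<Rightarrow> real) \<Rightarrow> 'v set \<Rightarrow> bool" where
  "simplex_measurable \<phi> \<sigma> \<longleftrightarrow>
    (\<lambda>x. \<phi> (simplex_iso \<sigma> x)) \<in> borel_measurable (restrict_space borel (standard_simplex (card \<sigma> - 1)))"

section \<open>Independence of the enumeration of the vertices\<close>

lemma permuted_in_simplex:
  assumes "\<pi> permutes {..n}" "x \<in> standard_simplex n"
  shows "(\<lambda>i. x (\<pi> i)) \<in> standard_simplex n"
proof (rule standard_simplexI)
  show "0 \<le> x (\<pi> i)" for i
    using assms(2) by (simp add: standard_simplex_def)
  show "x (\<pi> i) = 0" if "i > n" for i
    using assms(2) permutes_not_in[OF assms(1), of i] that by (simp add: standard_simplex_def)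
  show "(\<Sum>i\<le>n. x (\<pi> i)) = 1"
    using sum.permute[OF assms(1), of x] assms(2) by (simp add: standard_simplex_def o_def)
qed

lemma permuted_measurable:
  assumes "\<pi> permutes {..n}"
  shows "(\<lambda>x i. x (\<pi> i))
    \<in> restrict_space borel (standard_simplex n) \<rightarrow>\<^sub>M restrict_space borel (standard_simplex n)"
proof (rule measurable_restrict_space2)
  show "(\<lambda>x i. x (\<pi> i)) \<in> borel_measurable (restrict_space borel (standard_simplex n))"
    by (rule measurable_restrict_space1) (rule borel_measurable_comp_index)
qed (use permuted_in_simplex[OF assms] in \<open>simp add: space_restrict_space\<close>)

lemma distr_simplex_volume_permutes:
  assumes "\<pi> permutes {..n}"
  shows "distr (simplex_volume n) (restrict_space borel (standard_simplex n)) (\<lambda>x i. x (\<pi> i)) = simplex_volume n"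
proof (rule measure_eqI)
  let ?R = "restrict_space borel (standard_simplex n)"
  show "sets (distr (simplex_volume n) ?R (\<lambda>x i. x (\<pi> i))) = sets (simplex_volume n)"
    by (simp add: sets_simplex_volume)
  fix A assume "A \<in> sets (distr (simplex_volume n) ?R (\<lambda>x i. x (\<pi> i)))"
  then have A: "A \<in> sets ?R" by simp
  then have Ab: "A \<in> sets borel"
    by (auto simp: sets_restrict_space intro: sets.Int standard_simplex_sets)
  have m: "(\<lambda>x i. x (\<pi> i)) \<in> simplex_volume n \<rightarrow>\<^sub>M ?R"
    unfolding measurable_cong_sets[OF sets_simplex_volume refl] by (rule permuted_measurable[OF assms])
  have "emeasure (distr (simplex_volume n) ?R (\<lambda>x i. x (\<pi> i))) A
      = (\<integral>\<^sup>+x. indicator A x \<partial>distr (simplex_volume n) ?R (\<lambda>x i. x (\<pi> i)))"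
    using A by simp
  also have "\<dots> = (\<integral>\<^sup>+x. indicator A (\<lambda>i. x (\<pi> i)) \<partial>simplex_volume n)"
    by (rule nn_integral_distr[OF m]) (use A in simp)
  also have "\<dots> = (\<integral>\<^sup>+x. indicator A x \<partial>simplex_volume n)"
    by (rule simplex_volume_permutes[OF assms, of "indicator A"]) (use Ab in simp)
  also have "\<dots> = emeasure (simplex_volume n) A"
    using A by (simp add: sets_simplex_volume)
  finally show "emeasure (distr (simplex_volume n) ?R (\<lambda>x i. x (\<pi> i))) A = emeasure (simplex_volume n) A" .
qed

lemma enumeration_change:
  fixes w w' :: "nat \<Rightarrow> 'v::real_vector"
  assumes w: "bij_betw w {..n} \<sigma>" and w': "bij_betw w' {..n} \<sigma>"
  shows "\<exists>\<pi>. \<pi> permutes {..n} \<and> (\<forall>x. (\<Sum>i\<le>n. x i *\<^sub>R w' i) = (\<Sum>i\<le>n. x (\<pi> i) *\<^sub>R w i))"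
proof -
  define \<tau> where "\<tau> k = (if k \<in> {..n} then inv_into {..n} w (w' k) else k)" for k
  have "bij_betw (inv_into {..n} w \<circ> w') {..n} {..n}"
    by (rule bij_betw_trans[OF w' bij_betw_inv_into[OF w]])
  then have "bij_betw \<tau> {..n} {..n}"
    by (rule bij_betw_cong[THEN iffD1, rotated]) (simp add: \<tau>_def)
  then have p: "\<tau> permutes {..n}"
    by (rule bij_imp_permutes) (auto simp: \<tau>_def)
  have w\<tau>: "w (\<tau> k) = w' k" if "k \<le> n" for k
    using bij_betw_inv_into_right[OF w, of "w' k"] bij_betw_apply[OF w', of k] that by (simp add: \<tau>_def)
  have "(\<Sum>i\<le>n. x i *\<^sub>R w' i) = (\<Sum>i\<le>n. x (inv_into UNIV \<tau> i) *\<^sub>R w i)" for x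
  proof -
    have "(\<Sum>i\<le>n. x (inv_into UNIV \<tau> i) *\<^sub>R w i) = (\<Sum>i\<le>n. x (inv_into UNIV \<tau> (\<tau> i)) *\<^sub>R w (\<tau> i))"
      using sum.permute[OF p, of "\<lambda>i. x (inv_into UNIV \<tau> i) *\<^sub>R w i"] by (simp add: o_def)
    also have "\<dots> = (\<Sum>i\<le>n. x i *\<^sub>R w' i)"
      using permutes_inverses(2)[OF p] w\<tau> by (intro sum.cong) auto
    finally show ?thesis by simp
  qed
  with permutes_inv[OF p] show ?thesis by blast
qed

lemma enumeration_change_integral:
  fixes \<phi> :: "'v::real_vector \<Rightarrow> real"
  assumes w: "bij_betw w {..n} \<sigma>" "bij_betw w' {..n} \<sigma>"
    and m: "(\<lambda>x. \<phi> (\<Sum>i\<le>n. x i *\<^sub>R w i)) \<in> borel_measurable (restrict_space borel (standard_simplex n))"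
  shows "(\<lambda>x. \<phi> (\<Sum>i\<le>n. x i *\<^sub>R w' i)) \<in> borel_measurable (restrict_space borel (standard_simplex n))"
    and "(\<integral>x. \<phi> (\<Sum>i\<le>n. x i *\<^sub>R w' i) \<partial>simplex_volume n) = (\<integral>x. \<phi> (\<Sum>i\<le>n. x i *\<^sub>R w i) \<partial>simplex_volume n)"
proof -
  obtain \<pi> where p: "\<pi> permutes {..n}"
    and eq: "\<And>x. (\<Sum>i\<le>n. x i *\<^sub>R w' i) = (\<Sum>i\<le>n. x (\<pi> i) *\<^sub>R w i)"
    using enumeration_change[OF w] by blast
  show "(\<lambda>x. \<phi> (\<Sum>i\<le>n. x i *\<^sub>R w' i)) \<in> borel_measurable (restrict_space borel (standard_simplex n))"
    unfolding eq by (rule measurable_compose[OF permuted_measurable[OF p] m])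
  have pm: "(\<lambda>x i. x (\<pi> i)) \<in> simplex_volume n \<rightarrow>\<^sub>M restrict_space borel (standard_simplex n)"
    unfolding measurable_cong_sets[OF sets_simplex_volume refl] by (rule permuted_measurable[OF p])
  show "(\<integral>x. \<phi> (\<Sum>i\<le>n. x i *\<^sub>R w' i) \<partial>simplex_volume n) = (\<integral>x. \<phi> (\<Sum>i\<le>n. x i *\<^sub>R w i) \<partial>simplex_volume n)"
    unfolding eq integral_distr[OF pm m, symmetric] distr_simplex_volume_permutes[OF p] ..
qed

text \<open>\<open>vertex_enum\<close> is an arbitrary choice, whereas the barycenters of a full
  flag come ordered by the size of the face; permutation invariance of the volume makes the order
  irrelevant.\<close>

lemma simplex_mean_enumeration:
  fixes \<phi> :: "'v::real_vector \<Rightarrow> real"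
  assumes w: "bij_betw w {..n} \<sigma>"
    and m: "(\<lambda>x. \<phi> (\<Sum>i\<le>n. x i *\<^sub>R w i)) \<in> borel_measurable (restrict_space borel (standard_simplex n))"
  shows "simplex_measurable \<phi> \<sigma>"
    and "simplex_mean \<phi> \<sigma> = (\<integral>x. \<phi> (\<Sum>i\<le>n. x i *\<^sub>R w i) \<partial>simplex_volume n)"
proof -
  have n: "card \<sigma> - 1 = n" using bij_betw_same_card[OF w] by simp
  have f: "finite \<sigma>" "\<sigma> \<noteq> {}"
    using bij_betw_finite[OF w] w by (auto simp: bij_betw_def)
  have v: "bij_betw (vertex_enum \<sigma>) {..n} \<sigma>"
    using bij_betw_vertex_enum[OF f] unfolding n .
  show "simplex_measurable \<phi> \<sigma>"
    unfolding simplex_measurable_def simplex_iso_def n by (rule enumeration_change_integral(1)[OF w v m])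
  show "simplex_mean \<phi> \<sigma> = (\<integral>x. \<phi> (\<Sum>i\<le>n. x i *\<^sub>R w i) \<partial>simplex_volume n)"
    unfolding simplex_mean_def simplex_iso_def n by (rule enumeration_change_integral(2)[OF w v m])
qed

lemma barycenter_initial:
  assumes "inj_on v {..n}" "k \<le> n"
  shows "barycenter (v ` {..k}) = (1 / real (Suc k)) *\<^sub>R (\<Sum>j\<le>k. v j)"
proof -
  have "inj_on v {..k}" by (rule inj_on_subset[OF assms(1)]) (use assms(2) in auto)
  then show ?thesis
    unfolding barycenter_def card_initial[OF assms] by (simp add: sum.reindex)
qed

lemma sorted_chart_barycenters:
  fixes v :: "nat \<Rightarrow> 'v::real_vector"
  assumes "inj_on v {..n}"
  shows "(\<Sum>j\<le>n. sorted_chart n y j *\<^sub>R v j) = (\<Sum>k\<le>n. y k *\<^sub>R barycenter (v ` {..k}))"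
proof -
  have "(\<Sum>j\<le>n. sorted_chart n y j *\<^sub>R v j)
      = (\<Sum>j\<le>n. \<Sum>k\<in>{k. k \<in> {..n} \<and> j \<le> k}. (y k / real (Suc k)) *\<^sub>R v j)"
  proof (rule sum.cong[OF refl])
    fix j assume "j \<in> {..n}"
    moreover have "{k. k \<in> {..n} \<and> j \<le> k} = {j..n}" by auto
    ultimately show "sorted_chart n y j *\<^sub>R v j
        = (\<Sum>k\<in>{k. k \<in> {..n} \<and> j \<le> k}. (y k / real (Suc k)) *\<^sub>R v j)"
      by (simp add: sorted_chart_def scaleR_sum_left)
  qed
  also have "\<dots> = (\<Sum>k\<le>n. \<Sum>j\<in>{j. j \<in> {..n} \<and> j \<le> k}. (y k / real (Suc k)) *\<^sub>R v j)"
    by (rule sum.swap_restrict) auto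
  also have "\<dots> = (\<Sum>k\<le>n. y k *\<^sub>R barycenter (v ` {..k}))"
  proof (rule sum.cong[OF refl])
    fix k assume k: "k \<in> {..n}"
    then have "{j. j \<in> {..n} \<and> j \<le> k} = {..k}" by auto
    then show "(\<Sum>j\<in>{j. j \<in> {..n} \<and> j \<le> k}. (y k / real (Suc k)) *\<^sub>R v j) = y k *\<^sub>R barycenter (v ` {..k})"
      using k by (simp add: barycenter_initial[OF assms] scaleR_sum_right)
  qed
  finally show ?thesis .
qed

text \<open>The map \<open>sorted_chart\<close>, followed by a permutation of coordinates, is the
  affine parametrization of one simplex of the subdivision by the barycenters of a full flag. This
  turns the integral identity over permutations into the exact averaging of means.\<close>

lemma simplex_mean_subdivision:
  fixes \<phi> :: "'v::real_vector \<Rightarrow> real"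
  assumes K: "simplicial K" "\<sigma> \<in> K" and m: "simplex_measurable \<phi> \<sigma>"
    and bound: "\<And>x. x \<in> convex hull \<sigma> \<Longrightarrow> \<bar>\<phi> x\<bar> \<le> B"
  shows "\<And>C. C \<in> full_flags \<sigma> \<Longrightarrow> simplex_measurable \<phi> (barycenter ` C)"
    and "simplex_mean \<phi> \<sigma> = 1 / fact (card \<sigma>) * (\<Sum>C\<in>full_flags \<sigma>. simplex_mean \<phi> (barycenter ` C))"
proof -
  define n where "n = card \<sigma> - 1"
  define w where "w = vertex_enum \<sigma>"
  define f where "f x = \<phi> (simplex_iso \<sigma> x)" for x
  have fin: "finite \<sigma>" "\<sigma> \<noteq> {}" "card \<sigma> = Suc n"
    using simplicialD[OF K] by (simp_all add: n_def)
  have w: "bij_betw w {..n} \<sigma>"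
    unfolding w_def n_def by (rule bij_betw_vertex_enum[OF fin(1,2)])
  have f_eq: "f x = \<phi> (\<Sum>i\<le>n. x i *\<^sub>R w i)" for x
    by (simp add: f_def simplex_iso_def w_def n_def)
  have fm: "f \<in> borel_measurable (restrict_space borel (standard_simplex n))"
    using m unfolding simplex_measurable_def f_def n_def .
  have fb: "\<bar>f x\<bar> \<le> B" if "x \<in> standard_simplex n" for x
    unfolding f_def using simplex_iso_image[OF fin(1,2)] that n_def by (intro bound) blast
  have piece: "simplex_measurable \<phi> (barycenter ` initial_flag n (w \<circ> \<pi>)) \<and>
      simplex_mean \<phi> (barycenter ` initial_flag n (w \<circ> \<pi>))
        = (\<integral>y. f (\<lambda>i. sorted_chart n y (inv_into UNIV \<pi> i)) \<partial>simplex_volume n)"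
    if p: "\<pi> permutes {..n}" for \<pi>
  proof -
    have v: "bij_betw (w \<circ> \<pi>) {..n} \<sigma>"
      by (rule bij_betw_trans[OF permutes_imp_bij[OF p] w])
    then have vinj: "inj_on (w \<circ> \<pi>) {..n}" by (simp add: bij_betw_def)
    have flag: "initial_flag n (w \<circ> \<pi>) \<in> flags \<sigma>"
      using initial_flag_full[OF v] by (simp add: full_flags_def)
    define b where "b k = barycenter ((w \<circ> \<pi>) ` {..k})" for k
    have b: "bij_betw b {..n} (barycenter ` initial_flag n (w \<circ> \<pi>))"
    proof (rule bij_betw_imageI)
      show "b ` {..n} = barycenter ` initial_flag n (w \<circ> \<pi>)"
        by (simp add: b_def initial_flag_def image_image)
      then have "card (b ` {..n}) = card {..n}"
        using card_barycenter_flag[OF K flag] initial_flag_full[OF v] fin(3) by (simp add: full_flags_def)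
      then show "inj_on b {..n}"
        by (intro eq_card_imp_inj_on) auto
    qed
    \<comment> \<open>Permuting the vertices by \<pi> amounts to permuting the coordinates by its
      inverse.\<close>
    have eq: "f (\<lambda>i. sorted_chart n y (inv_into UNIV \<pi> i)) = \<phi> (\<Sum>k\<le>n. y k *\<^sub>R b k)" for y
    proof -
      have "(\<Sum>i\<le>n. sorted_chart n y (inv_into UNIV \<pi> i) *\<^sub>R w i)
          = (\<Sum>i\<le>n. sorted_chart n y (inv_into UNIV \<pi> (\<pi> i)) *\<^sub>R w (\<pi> i))"
        using sum.permute[OF p, of "\<lambda>i. sorted_chart n y (inv_into UNIV \<pi> i) *\<^sub>R w i"] by (simp add: o_def)
      also have "\<dots> = (\<Sum>i\<le>n. sorted_chart n y i *\<^sub>R (w \<circ> \<pi>) i)"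
        using permutes_inverses(2)[OF p] by simp
      also have "\<dots> = (\<Sum>k\<le>n. y k *\<^sub>R b k)"
        unfolding b_def by (rule sorted_chart_barycenters[OF vinj])
      finally show ?thesis unfolding f_eq by simp
    qed
    have "(\<lambda>y. f (\<lambda>i. sorted_chart n y (inv_into UNIV \<pi> i))) \<in> borel_measurable (restrict_space borel (standard_simplex n))"
      by (rule measurable_compose[OF permuted_sorted_chart_measurable[OF permutes_inv[OF p]] fm])
    then have "(\<lambda>y. \<phi> (\<Sum>k\<le>n. y k *\<^sub>R b k)) \<in> borel_measurable (restrict_space borel (standard_simplex n))"
      unfolding eq .
    from simplex_mean_enumeration[OF b this] show ?thesis
      unfolding eq by blast
  qed
  note bij = bij_betw_permutations_full_flags[OF w]
  show "simplex_measurable \<phi> (barycenter ` C)" if "C \<in> full_flags \<sigma>" for C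
  proof -
    have "C \<in> (\<lambda>\<pi>. initial_flag n (w \<circ> \<pi>)) ` {\<pi>. \<pi> permutes {..n}}"
      unfolding bij_betw_imp_surj_on[OF bij] by (rule that)
    then obtain \<pi> where \<pi>: "\<pi> permutes {..n}" "C = initial_flag n (w \<circ> \<pi>)" by auto
    show ?thesis
      unfolding \<pi>(2) by (rule conjunct1[OF piece[OF \<pi>(1)]])
  qed
  have "simplex_mean \<phi> \<sigma> = (\<integral>x. f x \<partial>simplex_volume n)"
    by (simp add: simplex_mean_def f_def n_def)
  also have "\<dots> = 1 / fact (Suc n) *
      (\<Sum>\<pi> | \<pi> permutes {..n}. \<integral>y. f (\<lambda>i. sorted_chart n y (\<pi> i)) \<partial>simplex_volume n)"
    by (rule simplex_volume_subdivision[OF fm fb])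
  also have "(\<Sum>\<pi> | \<pi> permutes {..n}. \<integral>y. f (\<lambda>i. sorted_chart n y (\<pi> i)) \<partial>simplex_volume n)
      = (\<Sum>\<pi> | \<pi> permutes {..n}. \<integral>y. f (\<lambda>i. sorted_chart n y (inv_into UNIV \<pi> i)) \<partial>simplex_volume n)"
    by (rule sum_permutations_inverse)
  also have "\<dots> = (\<Sum>\<pi> | \<pi> permutes {..n}. simplex_mean \<phi> (barycenter ` initial_flag n (w \<circ> \<pi>)))"
    using piece by (intro sum.cong) auto
  also have "\<dots> = (\<Sum>C\<in>full_flags \<sigma>. simplex_mean \<phi> (barycenter ` C))"
    by (rule sum.reindex_bij_betw[OF bij])
  finally show "simplex_mean \<phi> \<sigma> = 1 / fact (card \<sigma>) * (\<Sum>C\<in>full_flags \<sigma>. simplex_mean \<phi> (barycenter ` C))"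
    by (simp only: fin(3))
qed

lemma simplex_mean_diff_le:
  fixes \<phi> :: "'v::real_vector \<Rightarrow> real"
  assumes \<sigma>: "finite \<sigma>" "\<sigma> \<noteq> {}" and m: "simplex_measurable \<phi> \<sigma>"
    and bound: "\<And>x. x \<in> convex hull \<sigma> \<Longrightarrow> \<bar>\<phi> x - c\<bar> \<le> e"
  shows "\<bar>simplex_mean \<phi> \<sigma> - c\<bar> \<le> e"
proof -
  define n where "n = card \<sigma> - 1"
  interpret prob_space "simplex_volume n" by (rule prob_space_simplex_volume)
  have b: "\<bar>\<phi> (simplex_iso \<sigma> x) - c\<bar> \<le> e" if "x \<in> standard_simplex n" for x
    using simplex_iso_image[OF \<sigma>] that unfolding n_def by (intro bound) blast
  have b': "\<bar>\<phi> (simplex_iso \<sigma> x)\<bar> \<le> e + \<bar>c\<bar>" if "x \<in> standard_simplex n" for x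
    using b[OF that] by linarith
  have i: "integrable (simplex_volume n) (\<lambda>x. \<phi> (simplex_iso \<sigma> x))"
    by (rule simplex_volume_integrable[OF m[unfolded simplex_measurable_def n_def[symmetric]] b'])
  have "simplex_mean \<phi> \<sigma> - c = (\<integral>x. \<phi> (simplex_iso \<sigma> x) - c \<partial>simplex_volume n)"
    unfolding simplex_mean_def n_def[symmetric] using i by (simp add: prob_space)
  also have "\<bar>\<dots>\<bar> \<le> (\<integral>x. \<bar>\<phi> (simplex_iso \<sigma> x) - c\<bar> \<partial>simplex_volume n)"
    by (rule integral_abs_bound)
  also have "\<dots> \<le> (\<integral>x. e \<partial>simplex_volume n)"
    by (rule integral_mono) (use i b in \<open>auto simp: space_simplex_volume\<close>)
  also have "\<dots> = e" by (simp add: prob_space)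
  finally show ?thesis .
qed

section \<open>Oscillation\<close>

text \<open>One point of a modulus of continuity, measured in the l1 distance of barycentric
  coordinates. This distance makes sense without any metric on the vector space.\<close>

definition oscillation_le :: "real \<Rightarrow> real \<Rightarrow> ('v::real_vector \<Rightarrow> real) \<Rightarrow> 'v set \<Rightarrow> bool" where
  "oscillation_le \<delta> \<epsilon> \<phi> \<sigma> \<longleftrightarrow> (\<forall>u\<in>simplex_weights \<sigma>. \<forall>w\<in>simplex_weights \<sigma>.
     (\<Sum>v\<in>\<sigma>. \<bar>u v - w v\<bar>) \<le> \<delta> \<longrightarrow> \<bar>\<phi> (\<Sum>v\<in>\<sigma>. u v *\<^sub>R v) - \<phi> (\<Sum>v\<in>\<sigma>. w v *\<^sub>R v)\<bar> \<le> \<epsilon>)"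

text \<open>
  Doeblin's argument: all the uniform distributions on members of \<open>C\<close> dominate a multiple of the
  Dirac measure at one vertex of the least member.
\<close>

lemma push_weights_contraction:
  assumes \<sigma>: "finite \<sigma>" and C: "C \<in> flags \<sigma>" and inj: "inj_on barycenter C"
    and u: "u \<in> simplex_weights (barycenter ` C)" and w: "w \<in> simplex_weights (barycenter ` C)"
  shows "(\<Sum>v\<in>\<sigma>. \<bar>push_weights C u v - push_weights C w v\<bar>)
    \<le> (1 - 1 / real (card \<sigma>)) * (\<Sum>r\<in>barycenter ` C. \<bar>u r - w r\<bar>)"
proof -
  let ?c = "1 / real (card \<sigma>)"
  have finC: "finite C" "C \<noteq> {}" using finite_flags(2)[OF \<sigma> C] flagsD(1)[OF C] by auto
  have "\<Inter>C \<in> C"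
    using finC flagsD(4)[OF C] by (intro Inter_in_chain[of _ UNIV]) (auto simp: subset_chain_def)
  then obtain v0 where v0: "\<And>A. A \<in> C \<Longrightarrow> v0 \<in> A"
    using flagsD(3)[OF C] by (metis Inter_iff ex_in_conv)
  have v0\<sigma>: "v0 \<in> \<sigma>" using v0[OF flagsD(1)[OF C]] .
  define z where "z A = u (barycenter A) - w (barycenter A)" for A
  \<comment> \<open>From every row the mass \<open>1 / card \<sigma>\<close> at the common vertex is
    removed. As \<open>z\<close> has total 0, subtracting the same row everywhere does not change
    the pushed difference, and the remaining rows are nonnegative with total mass
    \<open>1 - 1 / card \<sigma>\<close>.\<close>
  define k where "k A v = uniform_weights A v - (if v = v0 then ?c else 0)" for A v
  have sz: "(\<Sum>A\<in>C. z A) = 0"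
    using u w sum.reindex[OF inj, of u] sum.reindex[OF inj, of w]
    by (simp add: z_def sum_subtractf simplex_weights_def o_def)
  have k_nn: "0 \<le> k A v" if A: "A \<in> C" for A v
  proof (cases "v = v0")
    case True
    have "0 < card A" "card A \<le> card \<sigma>"
      using finite_flags(3)[OF \<sigma> C A] flagsD(3)[OF C A] flagsD(2)[OF C A] card_mono[OF \<sigma>]
      by (simp_all add: card_gt_0_iff)
    then have "?c \<le> 1 / real (card A)" by (simp add: frac_le)
    then show ?thesis using True v0[OF A] by (simp add: k_def uniform_weights_def)
  qed (simp add: k_def uniform_weights_def)
  have k_sum: "(\<Sum>v\<in>\<sigma>. k A v) = 1 - ?c" if A: "A \<in> C" for A
  proof -
    have "uniform_weights A \<in> simplex_weights \<sigma>"
      by (rule simplex_weights_mono(1)[OF flagsD(2)[OF C A] \<sigma>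
            uniform_weights_in[OF finite_flags(3)[OF \<sigma> C A] flagsD(3)[OF C A]]])
    then have "(\<Sum>v\<in>\<sigma>. uniform_weights A v) = 1"
      unfolding simplex_weights_def by blast
    then show ?thesis
      using \<sigma> v0\<sigma> by (simp add: k_def sum_subtractf)
  qed
  have "push_weights C u v - push_weights C w v = (\<Sum>A\<in>C. z A * k A v)" for v
  proof -
    have "(\<Sum>A\<in>C. z A * k A v) = (\<Sum>A\<in>C. z A * uniform_weights A v) - (\<Sum>A\<in>C. z A) * (if v = v0 then ?c else 0)"
      unfolding k_def right_diff_distrib sum_subtractf sum_distrib_right ..
    also have "\<dots> = push_weights C u v - push_weights C w v"
      unfolding sz by (simp add: push_weights_def z_def left_diff_distrib sum_subtractf)
    finally show ?thesis by simp
  qed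
  then have "(\<Sum>v\<in>\<sigma>. \<bar>push_weights C u v - push_weights C w v\<bar>) = (\<Sum>v\<in>\<sigma>. \<bar>\<Sum>A\<in>C. z A * k A v\<bar>)"
    by simp
  also have "\<dots> \<le> (\<Sum>v\<in>\<sigma>. \<Sum>A\<in>C. \<bar>z A\<bar> * k A v)"
    using k_nn by (intro sum_mono order_trans[OF sum_abs]) (simp add: abs_mult)
  also have "\<dots> = (\<Sum>A\<in>C. \<bar>z A\<bar> * (\<Sum>v\<in>\<sigma>. k A v))"
    unfolding sum_distrib_left by (rule sum.swap)
  also have "\<dots> = (1 - ?c) * (\<Sum>A\<in>C. \<bar>z A\<bar>)"
    using k_sum by (simp add: sum_distrib_right[symmetric] mult.commute)
  also have "(\<Sum>A\<in>C. \<bar>z A\<bar>) = (\<Sum>r\<in>barycenter ` C. \<bar>u r - w r\<bar>)"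
    by (simp add: z_def sum.reindex[OF inj])
  finally show ?thesis .
qed

text \<open>By the contraction, the pieces tolerate a larger distance for the same \<epsilon>. The
  relation of the two distances is stated as a product because the contraction factor is 0 for a
  single vertex.\<close>

lemma oscillation_le_flag:
  assumes K: "simplicial K" "\<sigma> \<in> K" and C: "C \<in> flags \<sigma>" and osc: "oscillation_le \<delta> \<epsilon> \<phi> \<sigma>"
    and \<delta>: "(1 - 1 / real (card \<sigma>)) * \<delta>' \<le> \<delta>"
  shows "oscillation_le \<delta>' \<epsilon> \<phi> (barycenter ` C)"
  unfolding oscillation_le_def
proof (intro ballI impI)
  fix u w
  assume u: "u \<in> simplex_weights (barycenter ` C)" and w: "w \<in> simplex_weights (barycenter ` C)"
    and d: "(\<Sum>r\<in>barycenter ` C. \<bar>u r - w r\<bar>) \<le> \<delta>'"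
  have fin: "finite \<sigma>" by (rule simplicialD(1)[OF K])
  have inj: "inj_on barycenter C" by (rule inj_on_barycenter_flag[OF K C])
  have "0 \<le> 1 - 1 / real (card \<sigma>)"
    using simplicialD(4)[OF K] by simp
  then have "(1 - 1 / real (card \<sigma>)) * (\<Sum>r\<in>barycenter ` C. \<bar>u r - w r\<bar>) \<le> (1 - 1 / real (card \<sigma>)) * \<delta>'"
    using d by (rule mult_left_mono[rotated])
  then have "(\<Sum>v\<in>\<sigma>. \<bar>push_weights C u v - push_weights C w v\<bar>) \<le> \<delta>"
    using push_weights_contraction[OF fin C inj u w] \<delta> by linarith
  then have "\<bar>\<phi> (\<Sum>v\<in>\<sigma>. push_weights C u v *\<^sub>R v) - \<phi> (\<Sum>v\<in>\<sigma>. push_weights C w v *\<^sub>R v)\<bar> \<le> \<epsilon>"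
    using osc push_weights_in[OF fin C inj u] push_weights_in[OF fin C inj w]
    unfolding oscillation_le_def by blast
  then show "\<bar>\<phi> (\<Sum>r\<in>barycenter ` C. u r *\<^sub>R r) - \<phi> (\<Sum>r\<in>barycenter ` C. w r *\<^sub>R r)\<bar> \<le> \<epsilon>"
    unfolding push_weights_point[OF fin C inj] .
qed

section \<open>Equidistribution inside one simplex\<close>

lemma oscillation_le_mono:
  assumes "oscillation_le \<delta> \<epsilon> \<phi> \<sigma>" "\<delta>' \<le> \<delta>"
  shows "oscillation_le \<delta>' \<epsilon> \<phi> \<sigma>"
  using assms unfolding oscillation_le_def by (meson order_trans)

text \<open>The parameters \<open>m\<close>, \<open>B\<close>, \<delta> and \<epsilon> are those on
  which the threshold in \<open>local_sum_close\<close> may depend, while \<phi> and \<sigma> vary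
  freely. The complex is hidden under a quantifier because the pieces of a simplex of
  \<open>K\<close> live in \<open>Sd K\<close>.\<close>

definition test_simplex :: "nat \<Rightarrow> real \<Rightarrow> real \<Rightarrow> real \<Rightarrow> ('v::real_vector \<Rightarrow> real) \<Rightarrow> 'v set \<Rightarrow> bool" where
  "test_simplex m B \<delta> \<epsilon> \<phi> \<sigma> \<longleftrightarrow> (\<exists>K. simplicial K \<and> \<sigma> \<in> K) \<and> card \<sigma> = m \<and> simplex_measurable \<phi> \<sigma> \<and>
     (\<forall>x\<in>convex hull \<sigma>. \<bar>\<phi> x\<bar> \<le> B) \<and> oscillation_le \<delta> \<epsilon> \<phi> \<sigma>"

lemma test_simplexE:
  assumes "test_simplex m B \<delta> \<epsilon> \<phi> \<sigma>"
  obtains K where "simplicial K" "\<sigma> \<in> K" "card \<sigma> = m" "simplex_measurable \<phi> \<sigma>"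
    "\<And>x. x \<in> convex hull \<sigma> \<Longrightarrow> \<bar>\<phi> x\<bar> \<le> B" "oscillation_le \<delta> \<epsilon> \<phi> \<sigma>"
  using assms unfolding test_simplex_def by blast

lemma test_simplexI:
  assumes "simplicial K" "\<sigma> \<in> K" "card \<sigma> = m" "simplex_measurable \<phi> \<sigma>"
    "\<And>x. x \<in> convex hull \<sigma> \<Longrightarrow> \<bar>\<phi> x\<bar> \<le> B" "oscillation_le \<delta> \<epsilon> \<phi> \<sigma>"
  shows "test_simplex m B \<delta> \<epsilon> \<phi> \<sigma>"
  using assms unfolding test_simplex_def by blast

text \<open>Induction on the number \<open>k\<close> of averaging steps. For \<open>k = 0\<close>
  the oscillation hypothesis covers the whole simplex, and \<phi> is compared with its value at the
  barycenter both in the sum and in the mean, whence the factor 2 of \<epsilon>. A step spends half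
  of \<eta> on the full flags and half on the shorter ones; the term in \<epsilon> is the same for
  all pieces and is reproduced by the average.\<close>

lemma local_sum_close:
  fixes B \<epsilon> \<eta> :: real
  assumes m: "m > 0" and B: "0 \<le> B" and \<epsilon>: "0 \<le> \<epsilon>" and "0 < \<eta>"
  shows "\<exists>D. \<forall>d\<ge>D. \<forall>\<sigma> (\<phi> :: 'v::real_vector \<Rightarrow> real).
    test_simplex m B (2 * (1 - 1 / real m) ^ k) \<epsilon> \<phi> \<sigma> \<longrightarrow>
    \<bar>local_sum p \<phi> d \<sigma> / fact m ^ d - lim (local_density p m) * simplex_mean \<phi> \<sigma>\<bar>
      \<le> 2 * lim (local_density p m) * \<epsilon> + \<eta>"
  using \<open>0 < \<eta>\<close>
proof (induction k arbitrary: \<eta>)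
  case 0
  define q where "q = lim (local_density p m)"
  have lim: "local_density p m \<longlonglongrightarrow> q"
    using local_density_convergent[OF m] by (simp add: q_def convergent_LIMSEQ_iff)
  have q: "0 \<le> q"
    by (rule LIMSEQ_le_const[OF lim]) (simp add: local_density_nonneg)
  \<comment> \<open>Chosen so that the deviation of the density times \<open>\<epsilon> + B\<close>
    stays below \<eta>; the summand 1 guards against a zero denominator.\<close>
  have "0 < \<eta> / (\<epsilon> + B + 1)" using 0 B \<epsilon> by simp
  then obtain D where D: "\<And>d. d \<ge> D \<Longrightarrow> \<bar>local_density p m d - q\<bar> < \<eta> / (\<epsilon> + B + 1)"
    using LIMSEQ_D[OF lim] by (metis real_norm_def)
  have small: "(\<epsilon> + B) * \<bar>local_density p m d - q\<bar> \<le> \<eta>" if "d \<ge> D" for d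
  proof -
    have "(\<epsilon> + B) * \<bar>local_density p m d - q\<bar> \<le> (\<epsilon> + B + 1) * \<bar>local_density p m d - q\<bar>"
      by (rule mult_right_mono) simp_all
    also have "\<dots> \<le> (\<epsilon> + B + 1) * (\<eta> / (\<epsilon> + B + 1))"
      using D[OF that] B \<epsilon> by (intro mult_left_mono) auto
    also have "\<dots> = \<eta>" using B \<epsilon> by simp
    finally show ?thesis .
  qed
  show ?case
    unfolding q_def[symmetric]
  proof (intro exI[of _ D] allI impI)
    fix d \<sigma> and \<phi> :: "'v \<Rightarrow> real"
    assume d: "D \<le> d" and "test_simplex m B (2 * (1 - 1 / real m) ^ 0) \<epsilon> \<phi> \<sigma>"
    from this(2) obtain K where K: "simplicial K" "\<sigma> \<in> K" and c: "card \<sigma> = m"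
      and ms: "simplex_measurable \<phi> \<sigma>" and bound: "\<And>x. x \<in> convex hull \<sigma> \<Longrightarrow> \<bar>\<phi> x\<bar> \<le> B"
      and osc: "oscillation_le 2 \<epsilon> \<phi> \<sigma>"
      unfolding power_0 mult_1_right by (rule test_simplexE) blast
    have fin: "finite \<sigma>" "\<sigma> \<noteq> {}" by (rule simplicialD[OF K])+
    have osc': "\<bar>\<phi> x - \<phi> y\<bar> \<le> \<epsilon>" if xy: "x \<in> convex hull \<sigma>" "y \<in> convex hull \<sigma>" for x y
    proof -
      obtain u where u: "u \<in> simplex_weights \<sigma>" "x = (\<Sum>v\<in>\<sigma>. u v *\<^sub>R v)"
        using xy(1) unfolding convex_hull_simplex_weights[OF fin(1)] by blast
      obtain w where w: "w \<in> simplex_weights \<sigma>" "y = (\<Sum>v\<in>\<sigma>. w v *\<^sub>R v)"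
        using xy(2) unfolding convex_hull_simplex_weights[OF fin(1)] by blast
      \<comment> \<open>The initial distance 2 bounds the l1 distance of any two weight functions,
        so the oscillation hypothesis applies to all pairs of points.\<close>
      have "(\<Sum>v\<in>\<sigma>. \<bar>u v - w v\<bar>) \<le> (\<Sum>v\<in>\<sigma>. u v + w v)"
        using u(1) w(1) by (intro sum_mono) (simp add: simplex_weights_def abs_le_iff add_increasing)
      also have "\<dots> = 2" using u(1) w(1) by (simp add: simplex_weights_def sum.distrib)
      finally show ?thesis
        using osc u w unfolding oscillation_le_def by blast
    qed
    define x0 where "x0 = barycenter \<sigma>"
    have x0: "x0 \<in> convex hull \<sigma>" unfolding x0_def by (rule barycenter_in_hull[OF fin])
    let ?a = "local_density p m d" and ?S = "local_sum p \<phi> d \<sigma> / fact m ^ d" and ?M = "simplex_mean \<phi> \<sigma>"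
    have "\<bar>local_sum p \<phi> d \<sigma> - \<phi> x0 * local_count p d m\<bar> \<le> \<epsilon> * local_count p d m"
      using local_sum_diff_le[OF K osc'[OF _ x0]] unfolding c .
    then have "\<bar>local_sum p \<phi> d \<sigma> - \<phi> x0 * local_count p d m\<bar> / fact m ^ d \<le> \<epsilon> * local_count p d m / fact m ^ d"
      by (rule divide_right_mono) simp
    moreover have "\<bar>local_sum p \<phi> d \<sigma> - \<phi> x0 * local_count p d m\<bar> / fact m ^ d = \<bar>?S - \<phi> x0 * ?a\<bar>"
      by (simp add: local_density_def diff_divide_distrib[symmetric] abs_divide)
    ultimately have 1: "\<bar>?S - \<phi> x0 * ?a\<bar> \<le> \<epsilon> * ?a"
      by (simp add: local_density_def)
    have 2: "q * \<bar>?M - \<phi> x0\<bar> \<le> q * \<epsilon>"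
      by (rule mult_left_mono[OF simplex_mean_diff_le[OF fin ms osc'[OF _ x0]] q])
    have 3: "\<bar>\<phi> x0\<bar> * \<bar>?a - q\<bar> \<le> B * \<bar>?a - q\<bar>"
      using bound x0 by (intro mult_right_mono) auto
    have 4: "\<epsilon> * ?a \<le> \<epsilon> * q + \<epsilon> * \<bar>?a - q\<bar>"
      using mult_left_mono[OF abs_ge_self[of "?a - q"] \<epsilon>] by (simp add: algebra_simps)
    have "?S - q * ?M = (?S - \<phi> x0 * ?a) + \<phi> x0 * (?a - q) - q * (?M - \<phi> x0)"
      by (simp add: algebra_simps)
    also have "\<bar>\<dots>\<bar> \<le> \<bar>?S - \<phi> x0 * ?a\<bar> + \<bar>\<phi> x0 * (?a - q)\<bar> + \<bar>q * (?M - \<phi> x0)\<bar>"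
      by linarith
    also have "\<dots> \<le> \<epsilon> * ?a + B * \<bar>?a - q\<bar> + q * \<epsilon>"
      using 1 2 3 q by (simp add: abs_mult)
    also have "\<dots> \<le> 2 * q * \<epsilon> + (\<epsilon> + B) * \<bar>?a - q\<bar>"
      using 4 by (simp add: algebra_simps)
    also have "\<dots> \<le> 2 * q * \<epsilon> + \<eta>"
      using small[OF d] by simp
    finally show "\<bar>?S - q * ?M\<bar> \<le> 2 * q * \<epsilon> + \<eta>" .
  qed
next
  case (Suc k)
  define q where "q = lim (local_density p m)"
  have lim: "local_density p m \<longlonglongrightarrow> q"
    using local_density_convergent[OF m] by (simp add: q_def convergent_LIMSEQ_iff)
  \<comment> \<open>The increment, times \<open>B\<close>, will bound the share of the shorter
    flags; it tends to 0 because the density converges.\<close>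
  have "(\<lambda>d. B * (local_density p m (Suc d) - local_density p m d)) \<longlonglongrightarrow> B * (q - q)"
    by (intro tendsto_intros LIMSEQ_Suc lim)
  then have "(\<lambda>d. B * (local_density p m (Suc d) - local_density p m d)) \<longlonglongrightarrow> 0" by simp
  then obtain D1 where D1: "\<And>d. d \<ge> D1 \<Longrightarrow> \<bar>B * (local_density p m (Suc d) - local_density p m d)\<bar> < \<eta> / 2"
    using LIMSEQ_D[of _ 0 "\<eta> / 2"] Suc.prems by fastforce
  obtain D2 where D2: "\<And>d \<sigma> (\<phi> :: 'v \<Rightarrow> real). d \<ge> D2 \<Longrightarrow>
      test_simplex m B (2 * (1 - 1 / real m) ^ k) \<epsilon> \<phi> \<sigma> \<Longrightarrow>
      \<bar>local_sum p \<phi> d \<sigma> / fact m ^ d - q * simplex_mean \<phi> \<sigma>\<bar> \<le> 2 * q * \<epsilon> + \<eta> / 2"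
    using Suc.IH[of "\<eta> / 2"] Suc.prems unfolding q_def by (meson half_gt_zero)
  show ?case
    unfolding q_def[symmetric]
  proof (intro exI[of _ "Suc (max D1 D2)"] allI impI)
    fix d' \<sigma> and \<phi> :: "'v \<Rightarrow> real"
    assume d': "Suc (max D1 D2) \<le> d'" and "test_simplex m B (2 * (1 - 1 / real m) ^ Suc k) \<epsilon> \<phi> \<sigma>"
    from this(2) obtain K where K: "simplicial K" "\<sigma> \<in> K" and c: "card \<sigma> = m"
      and ms: "simplex_measurable \<phi> \<sigma>" and bound: "\<And>x. x \<in> convex hull \<sigma> \<Longrightarrow> \<bar>\<phi> x\<bar> \<le> B"
      and osc: "oscillation_le (2 * (1 - 1 / real m) ^ Suc k) \<epsilon> \<phi> \<sigma>"
      by (rule test_simplexE) blast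
    \<comment> \<open>One subdivision is used up in passing to the flags, hence the successor in the
      threshold.\<close>
    obtain d where d: "d' = Suc d" "D1 \<le> d" "D2 \<le> d" using d' by (cases d') auto
    have fin: "finite \<sigma>" "\<sigma> \<noteq> {}" by (rule simplicialD[OF K])+
    let ?F = "full_flags \<sigma>" and ?L = "{C. C \<in> flags \<sigma> \<and> card C < card \<sigma>}"
    define S where "S C = local_sum p \<phi> d (barycenter ` C)" for C
    define M where "M C = simplex_mean \<phi> (barycenter ` C)" for C
    have bound': "\<bar>\<phi> x\<bar> \<le> B" if "C \<in> flags \<sigma>" "x \<in> convex hull (barycenter ` C)" for C x
      by (rule bound, rule subsetD[OF hull_barycenter_flag[OF fin(1) that(1)] that(2)])
    have full: "\<bar>S C / fact m ^ d - q * M C\<bar> \<le> 2 * q * \<epsilon> + \<eta> / 2" if C: "C \<in> ?F" for C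
    proof -
      have fl: "C \<in> flags \<sigma>" "card C = m" using C c by (simp_all add: full_flags_def)
      have "oscillation_le (2 * (1 - 1 / real m) ^ k) \<epsilon> \<phi> (barycenter ` C)"
        by (rule oscillation_le_flag[OF K fl(1) osc]) (simp add: c mult.left_commute)
      moreover have "card (barycenter ` C) = m"
        using card_barycenter_flag[OF K fl(1)] fl(2) by simp
      ultimately have "test_simplex m B (2 * (1 - 1 / real m) ^ k) \<epsilon> \<phi> (barycenter ` C)"
        using test_simplexI[OF simplicial_Sd[OF K(1)] barycenter_flag_in_Sd[OF K fl(1)] _
            simplex_mean_subdivision(1)[OF K ms bound C] bound'[OF fl(1)]] by blast
      then show ?thesis
        unfolding S_def M_def by (rule D2[OF d(3)])
    qed
    have low: "\<bar>\<Sum>C\<in>?L. S C\<bar> / fact m ^ Suc d \<le> \<eta> / 2"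
    proof -
      have "\<bar>\<Sum>C\<in>?L. S C\<bar> \<le> (\<Sum>C\<in>?L. B * local_count p d (card C))"
      proof (rule order_trans[OF sum_abs sum_mono])
        fix C assume "C \<in> ?L"
        then have C: "C \<in> flags \<sigma>" by simp
        show "\<bar>S C\<bar> \<le> B * local_count p d (card C)"
          using local_sum_diff_le[OF simplicial_Sd[OF K(1)] barycenter_flag_in_Sd[OF K C], of \<phi> 0 B p d]
            bound'[OF C] card_barycenter_flag[OF K C] by (simp add: S_def)
      qed
      also have "\<dots> = (\<Sum>C\<in>flags \<sigma>. B * (if card C < m then local_count p d (card C) else 0))"
        using finite_flags(1)[OF fin(1)] unfolding c
        by (intro sum.mono_neutral_cong_left) auto
      also have "\<dots> = (\<Sum>C\<in>flags {..<m}. B * (if card C < m then local_count p d (card C) else 0))"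
        using sum_flags_card[OF fin(1), of "\<lambda>k. B * (if k < m then local_count p d k else 0)"] unfolding c .
      also have "\<dots> = (\<Sum>C | C \<in> flags {..<m} \<and> card C < m. B * local_count p d (card C))"
        using finite_flags(1)[of "{..<m}"]
        by (intro sum.mono_neutral_cong_right) auto
      finally have "\<bar>\<Sum>C\<in>?L. S C\<bar> / fact m ^ Suc d
          \<le> (\<Sum>C | C \<in> flags {..<m} \<and> card C < m. B * local_count p d (card C)) / fact m ^ Suc d"
        by (rule divide_right_mono) simp
      also have "\<dots> = B * (local_density p m (Suc d) - local_density p m d)"
        unfolding local_density_Suc[OF m] sum_distrib_left[symmetric] by simp
      also have "\<dots> \<le> \<eta> / 2" using D1[OF d(2)] by linarith
      finally show ?thesis .
    qed
    have cardF: "real (card ?F) = fact m"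
      using card_full_flags[OF fin] c by simp
    have "local_sum p \<phi> d' \<sigma> = (\<Sum>C\<in>?F. S C) + (\<Sum>C\<in>?L. S C)"
      unfolding d(1) local_sum_Suc[OF K] S_def by (rule sum_flags_split[OF fin(1)])
    moreover have "simplex_mean \<phi> \<sigma> = (\<Sum>C\<in>?F. M C) / fact m"
      using simplex_mean_subdivision(2)[OF K ms bound] by (simp add: M_def c)
    moreover have "(\<Sum>C\<in>?F. S C / fact m ^ d - q * M C) = (\<Sum>C\<in>?F. S C) / fact m ^ d - q * (\<Sum>C\<in>?F. M C)"
      by (simp add: sum_subtractf sum_divide_distrib sum_distrib_left)
    ultimately have "local_sum p \<phi> d' \<sigma> / fact m ^ d' - q * simplex_mean \<phi> \<sigma>
        = (\<Sum>C\<in>?F. S C / fact m ^ d - q * M C) / fact m + (\<Sum>C\<in>?L. S C) / fact m ^ Suc d"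
      by (simp add: d(1) add_divide_distrib diff_divide_distrib)
    also have "\<bar>\<dots>\<bar> \<le> \<bar>(\<Sum>C\<in>?F. S C / fact m ^ d - q * M C) / fact m\<bar> + \<bar>(\<Sum>C\<in>?L. S C) / fact m ^ Suc d\<bar>"
      by (rule abs_triangle_ineq)
    also have "\<bar>(\<Sum>C\<in>?F. S C / fact m ^ d - q * M C) / fact m\<bar> \<le> 2 * q * \<epsilon> + \<eta> / 2"
    proof -
      have "\<bar>\<Sum>C\<in>?F. S C / fact m ^ d - q * M C\<bar> \<le> (\<Sum>C\<in>?F. 2 * q * \<epsilon> + \<eta> / 2)"
        by (rule order_trans[OF sum_abs sum_mono]) (rule full)
      also have "\<dots> = fact m * (2 * q * \<epsilon> + \<eta> / 2)"
        by (simp add: cardF)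
      finally show ?thesis
        by (simp add: abs_divide pos_divide_le_eq mult.commute)
    qed
    also have "\<bar>(\<Sum>C\<in>?L. S C) / fact m ^ Suc d\<bar> \<le> \<eta> / 2"
      using low by (simp add: abs_divide)
    finally show "\<bar>local_sum p \<phi> d' \<sigma> / fact m ^ d' - q * simplex_mean \<phi> \<sigma>\<bar> \<le> 2 * q * \<epsilon> + \<eta>"
      by simp
  qed
qed

lemma local_sum_tendsto:
  fixes \<phi> :: "'v::real_vector \<Rightarrow> real"
  assumes K: "simplicial K" "\<sigma> \<in> K" and ms: "simplex_measurable \<phi> \<sigma>"
    and bound: "\<And>x. x \<in> convex hull \<sigma> \<Longrightarrow> \<bar>\<phi> x\<bar> \<le> B"
    and osc: "\<And>\<epsilon>. \<epsilon> > 0 \<Longrightarrow> \<exists>\<delta>>0. oscillation_le \<delta> \<epsilon> \<phi> \<sigma>"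
  shows "(\<lambda>d. local_sum p \<phi> d \<sigma> / fact (card \<sigma>) ^ d)
    \<longlonglongrightarrow> lim (local_density p (card \<sigma>)) * simplex_mean \<phi> \<sigma>"
proof (rule LIMSEQ_I)
  define m where "m = card \<sigma>"
  define q where "q = lim (local_density p m)"
  have m: "m > 0" unfolding m_def by (rule simplicialD(4)[OF K])
  have fin: "finite \<sigma>" "\<sigma> \<noteq> {}" by (rule simplicialD[OF K])+
  have B: "0 \<le> B" using bound[OF barycenter_in_hull[OF fin]] by linarith
  have lim: "local_density p m \<longlonglongrightarrow> q"
    using local_density_convergent[OF m] by (simp add: q_def convergent_LIMSEQ_iff)
  have q: "0 \<le> q"
    by (rule LIMSEQ_le_const[OF lim]) (simp add: local_density_nonneg)
  fix r :: real assume r: "0 < r"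
  \<comment> \<open>With \<open>q + 1\<close> in place of \<open>q\<close> the case
    \<open>q = 0\<close> is covered. The choice gives \<open>2 * q * \<epsilon> \<le> r / 2\<close>,
    which leaves room for \<eta> equal to \<open>r / 4\<close>.\<close>
  define \<epsilon> where "\<epsilon> = r / (4 * (q + 1))"
  have \<epsilon>: "0 < \<epsilon>" using r q by (simp add: \<epsilon>_def)
  have "2 * q * \<epsilon> \<le> 2 * (q + 1) * \<epsilon>"
    using \<epsilon> by (intro mult_right_mono) auto
  also have "\<dots> = r / 2" using q by (simp add: \<epsilon>_def field_simps)
  finally have small: "2 * q * \<epsilon> + r / 4 < r" using r by linarith
  obtain \<delta> where \<delta>: "\<delta> > 0" "oscillation_le \<delta> \<epsilon> \<phi> \<sigma>" using osc[OF \<epsilon>] by blast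
  \<comment> \<open>Enough averaging steps are taken to bring the initial distance 2 below the
    \<delta> of the test function.\<close>
  have "\<exists>k. (1 - 1 / real m) ^ k < \<delta> / 2"
    by (rule real_arch_pow_inv) (use \<delta>(1) m in simp_all)
  then obtain k where "(1 - 1 / real m) ^ k < \<delta> / 2" by blast
  then have k: "2 * (1 - 1 / real m) ^ k \<le> \<delta>" by linarith
  obtain D where D: "\<And>d \<sigma> (\<phi> :: 'v \<Rightarrow> real). d \<ge> D \<Longrightarrow>
      test_simplex m B (2 * (1 - 1 / real m) ^ k) \<epsilon> \<phi> \<sigma> \<Longrightarrow>
      \<bar>local_sum p \<phi> d \<sigma> / fact m ^ d - q * simplex_mean \<phi> \<sigma>\<bar> \<le> 2 * q * \<epsilon> + r / 4"
    using local_sum_close[OF m B less_imp_le[OF \<epsilon>], of "r / 4" k p] r unfolding q_def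
    by (metis zero_less_divide_iff zero_less_numeral)
  have test: "test_simplex m B (2 * (1 - 1 / real m) ^ k) \<epsilon> \<phi> \<sigma>"
    by (rule test_simplexI[OF K m_def[symmetric] ms bound oscillation_le_mono[OF \<delta>(2) k]])
  show "\<exists>D. \<forall>d\<ge>D. norm (local_sum p \<phi> d \<sigma> / fact (card \<sigma>) ^ d
      - lim (local_density p (card \<sigma>)) * simplex_mean \<phi> \<sigma>) < r"
    unfolding m_def[symmetric] q_def[symmetric] real_norm_def
  proof (intro exI[of _ D] allI impI)
    fix d assume "D \<le> d"
    then have "\<bar>local_sum p \<phi> d \<sigma> / fact m ^ d - q * simplex_mean \<phi> \<sigma>\<bar> \<le> 2 * q * \<epsilon> + r / 4"
      by (rule D[OF _ test])
    with small show "\<bar>local_sum p \<phi> d \<sigma> / fact m ^ d - q * simplex_mean \<phi> \<sigma>\<bar> < r" by linarith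
  qed
qed

lemma local_sum_lower_tendsto:
  fixes \<phi> :: "'v::real_vector \<Rightarrow> real"
  assumes K: "simplicial K" "\<sigma> \<in> K" and "card \<sigma> < n"
    and bound: "\<And>x. x \<in> convex hull \<sigma> \<Longrightarrow> \<bar>\<phi> x\<bar> \<le> B"
  shows "(\<lambda>d. local_sum p \<phi> d \<sigma> / fact n ^ d) \<longlonglongrightarrow> 0"
proof (rule Lim_null_comparison)
  show "(\<lambda>d. B * (local_count p d (card \<sigma>) / fact n ^ d)) \<longlonglongrightarrow> 0"
    by (rule tendsto_mult_right_zero[OF local_count_lower_tendsto[OF simplicialD(4)[OF K] assms(3)]])
  show "\<forall>\<^sub>F d in sequentially. norm (local_sum p \<phi> d \<sigma> / fact n ^ d) \<le> B * (local_count p d (card \<sigma>) / fact n ^ d)"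
  proof (rule always_eventually, rule allI)
    fix d
    have "\<bar>local_sum p \<phi> d \<sigma>\<bar> \<le> B * local_count p d (card \<sigma>)"
      using local_sum_diff_le[OF K, of \<phi> 0 B p d] bound by simp
    then show "norm (local_sum p \<phi> d \<sigma> / fact n ^ d) \<le> B * (local_count p d (card \<sigma>) / fact n ^ d)"
      by (simp add: abs_divide divide_right_mono)
  qed
qed

section \<open>The constant \<open>q\<close>\<close>

lemma geometric_complex_simplex:
  fixes S :: "'v::real_vector set"
  assumes "finite S" "\<not> affine_dependent S"
  shows "geometric_complex (Pow S - {{}})"
proof -
  have fin: "finite \<sigma>" if "\<sigma> \<subseteq> S" for \<sigma>
    using that assms(1) by (rule finite_subset)
  have "convex hull \<sigma> \<inter> convex hull \<tau> = convex hull (\<sigma> \<inter> \<tau>)" if st: "\<sigma> \<subseteq> S" "\<tau> \<subseteq> S" for \<sigma> \<tau>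
  proof
    show "convex hull (\<sigma> \<inter> \<tau>) \<subseteq> convex hull \<sigma> \<inter> convex hull \<tau>"
      using hull_mono[of "\<sigma> \<inter> \<tau>" \<sigma>] hull_mono[of "\<sigma> \<inter> \<tau>" \<tau>] by blast
    show "convex hull \<sigma> \<inter> convex hull \<tau> \<subseteq> convex hull (\<sigma> \<inter> \<tau>)"
    proof
      fix x assume x: "x \<in> convex hull \<sigma> \<inter> convex hull \<tau>"
      obtain u where u: "u \<in> simplex_weights \<sigma>" "x = (\<Sum>v\<in>\<sigma>. u v *\<^sub>R v)"
        using x unfolding convex_hull_simplex_weights[OF fin[OF st(1)]] by blast
      obtain w where w: "w \<in> simplex_weights \<tau>" "x = (\<Sum>v\<in>\<tau>. w v *\<^sub>R v)"
        using x unfolding convex_hull_simplex_weights[OF fin[OF st(2)]] by blast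
      note uS = simplex_weights_mono[OF st(1) assms(1) u(1)]
      note wS = simplex_weights_mono[OF st(2) assms(1) w(1)]
      have "u = w"
        by (rule affine_independent_weights_unique[OF assms uS(1) wS(1)])
           (simp only: uS(2) wS(2) u(2)[symmetric] w(2)[symmetric])
      then have z: "u v = 0" if "v \<notin> \<sigma> \<inter> \<tau>" for v
        using u(1) w(1) that by (auto simp: simplex_weights_def)
      have "sum u (\<sigma> \<inter> \<tau>) = sum u \<sigma>"
        by (rule sum.mono_neutral_left) (use fin[OF st(1)] z in auto)
      then have ui: "u \<in> simplex_weights (\<sigma> \<inter> \<tau>)"
        using u(1) z by (simp add: simplex_weights_def)
      show "x \<in> convex hull (\<sigma> \<inter> \<tau>)"
        unfolding convex_hull_simplex_weights[OF finite_Int[OF disjI1[OF fin[OF st(1)]]]]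
        using ui simplex_weights_mono(2)[OF Int_lower1 fin[OF st(1)] ui] u(2) by blast
    qed
  qed
  moreover have "\<not> affine_dependent \<sigma>" if "\<sigma> \<subseteq> S" for \<sigma>
    using that assms(2) affine_dependent_subset by blast
  ultimately show ?thesis
    unfolding geometric_complex_def using fin by (intro conjI ballI allI impI) (simp_all, blast)
qed

lemma lookup_scaleR: "Poly_Mapping.lookup (r *\<^sub>R x) i = r *\<^sub>R Poly_Mapping.lookup x i"
proof -
  have "{i. r *\<^sub>R Poly_Mapping.lookup x i \<noteq> 0} \<subseteq> {i. Poly_Mapping.lookup x i \<noteq> 0}" by auto
  then have "finite {i. r *\<^sub>R Poly_Mapping.lookup x i \<noteq> 0}"
    by (rule finite_subset) (rule finite_lookup)
  then show ?thesis
    by (simp add: scaleR_poly_mapping_def Abs_poly_mapping_inverse)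
qed

lemma affine_independent_unit_vectors:
  "\<not> affine_dependent ((\<lambda>i. Poly_Mapping.single i (1::real)) ` {..n::nat})"
proof
  let ?e = "\<lambda>i::nat. Poly_Mapping.single i (1::real)"
  have inj: "inj_on ?e {..n}"
    by (rule inj_onI) (metis lookup_single_eq lookup_single_not_eq zero_neq_one)
  assume "affine_dependent (?e ` {..n})"
  then obtain U where U: "\<exists>v\<in>?e ` {..n}. U v \<noteq> 0" "(\<Sum>v\<in>?e ` {..n}. U v *\<^sub>R v) = 0"
    by (subst (asm) affine_dependent_explicit_finite) auto
  have "U (?e j) = 0" if j: "j \<le> n" for j
  proof -
    have "0 = Poly_Mapping.lookup (\<Sum>v\<in>?e ` {..n}. U v *\<^sub>R v) j"
      unfolding U(2) by simp
    also have "\<dots> = (\<Sum>i\<le>n. U (?e i) * Poly_Mapping.lookup (?e i) j)"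
      by (simp add: sum.reindex[OF inj] lookup_sum lookup_scaleR)
    also have "\<dots> = (\<Sum>i\<le>n. if i = j then U (?e j) else 0)"
      by (intro sum.cong refl) (auto simp: lookup_single when_def)
    also have "\<dots> = U (?e j)" using j by simp
    finally show ?thesis by simp
  qed
  with U(1) show False by auto
qed

text \<open>Without a single complex of dimension \<open>n\<close> every real number would satisfy
  the condition in \<open>q_lim\<close>; the faces of a simplex on \<open>n + 1\<close> unit vectors
  provide one.\<close>

lemma exists_simplex_complex:
  "\<exists>L :: (nat \<Rightarrow>\<^sub>0 real) set set. finite L \<and> geometric_complex L \<and> complex_of_dim n L"
proof (intro exI conjI)
  let ?S = "(\<lambda>i. Poly_Mapping.single i (1::real)) ` {..n}"
  have "inj_on (\<lambda>i::nat. Poly_Mapping.single i (1::real)) {..n}"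
    by (rule inj_onI) (metis lookup_single_eq lookup_single_not_eq zero_neq_one)
  then have c: "card ?S = n + 1" by (simp add: card_image)
  show "finite (Pow ?S - {{}})" by simp
  show "geometric_complex (Pow ?S - {{}})"
    by (rule geometric_complex_simplex[OF _ affine_independent_unit_vectors]) simp
  have "card \<sigma> \<le> n + 1" if "\<sigma> \<subseteq> ?S" for \<sigma>
    using card_mono[OF _ that] c by simp
  moreover have "?S \<in> p_simplices n (Pow ?S - {{}})"
    using c by (auto simp: p_simplices_def)
  ultimately show "complex_of_dim n (Pow ?S - {{}})"
    unfolding complex_of_dim_def by blast
qed

lemma sum_iterated_Sd:
  fixes g :: "'v::real_vector set \<Rightarrow> real"
  assumes K: "simplicial K" and N: "N \<subseteq> K" "finite N"
  shows "(\<Sum>\<tau> | \<tau> \<in> (\<Union>\<sigma>\<in>N. carried d \<sigma>) \<and> card \<tau> = p + 1. g \<tau>)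
    = (\<Sum>\<sigma>\<in>N. \<Sum>\<tau>\<in>carried d \<sigma>. if card \<tau> = p + 1 then g \<tau> else 0)"
proof -
  have fin: "finite (carried d \<sigma>)" if "\<sigma> \<in> N" for \<sigma>
    using N that by (intro finite_carried simplicialD(1)[OF K]) blast
  have "(\<Sum>\<tau> | \<tau> \<in> (\<Union>\<sigma>\<in>N. carried d \<sigma>) \<and> card \<tau> = p + 1. g \<tau>)
      = (\<Sum>\<tau>\<in>(\<Union>\<sigma>\<in>N. carried d \<sigma>). if card \<tau> = p + 1 then g \<tau> else 0)"
    using N(2) fin by (intro sum.mono_neutral_cong_left) auto
  also have "\<dots> = (\<Sum>\<sigma>\<in>N. \<Sum>\<tau>\<in>carried d \<sigma>. if card \<tau> = p + 1 then g \<tau> else 0)"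
  proof (rule sum.UNION_disjoint[OF N(2)])
    show "\<forall>\<sigma>\<in>N. finite (carried d \<sigma>)" using fin by blast
    show "\<forall>\<sigma>\<in>N. \<forall>\<tau>\<in>N. \<sigma> \<noteq> \<tau> \<longrightarrow> carried d \<sigma> \<inter> carried d \<tau> = {}"
      using carried_disjoint[OF K] N(1) by blast
  qed
  finally show ?thesis .
qed

text \<open>Each top simplex of \<open>L\<close> contributes the same limit and the lower ones
  contribute 0, so the number of top simplices cancels.\<close>

lemma card_p_simplices_ratio_tendsto:
  fixes L :: "'v::real_vector set set"
  assumes L: "finite L" "geometric_complex L" "complex_of_dim n L"
  shows "(\<lambda>d. real (card (p_simplices p ((Sd ^^ d) L))) / (fact (n + 1) ^ d * real (card (p_simplices n L))))
    \<longlonglongrightarrow> lim (local_density p (n + 1))"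
proof -
  have K: "simplicial L" by (rule geometric_complex_imp_simplicial[OF L(2)])
  have le: "card \<sigma> \<le> n + 1" if "\<sigma> \<in> L" for \<sigma> using L(3) that by (simp add: complex_of_dim_def)
  let ?q = "lim (local_density p (n + 1))" and ?f = "real (card (p_simplices n L))"
  have "finite (p_simplices n L)" using L(1) by (simp add: p_simplices_def)
  then have f: "?f > 0" using L(3) by (simp add: complex_of_dim_def card_gt_0_iff)
  have card_eq: "real (card (p_simplices p ((Sd ^^ d) L))) = (\<Sum>\<sigma>\<in>L. local_count p d (card \<sigma>))" for d
  proof -
    have "real (card (p_simplices p ((Sd ^^ d) L))) = (\<Sum>\<tau> | \<tau> \<in> (\<Union>\<sigma>\<in>L. carried d \<sigma>) \<and> card \<tau> = p + 1. 1)"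
      unfolding iterated_Sd_eq_carried[OF K] p_simplices_def by simp
    also have "\<dots> = (\<Sum>\<sigma>\<in>L. local_sum p (\<lambda>_. 1) d \<sigma>)"
      unfolding sum_iterated_Sd[OF K order_refl L(1)] local_sum_def ..
    also have "\<dots> = (\<Sum>\<sigma>\<in>L. local_count p d (card \<sigma>))"
      using local_sum_1[OF K] by (intro sum.cong) auto
    finally show ?thesis .
  qed
  have lims: "(\<lambda>d. local_count p d (card \<sigma>) / fact (n + 1) ^ d) \<longlonglongrightarrow> (if card \<sigma> = n + 1 then ?q else 0)"
    if \<sigma>: "\<sigma> \<in> L" for \<sigma>
  proof (cases "card \<sigma> = n + 1")
    case True
    have "local_density p (n + 1) \<longlonglongrightarrow> ?q"
      using local_density_convergent[of "n + 1" p] by (simp add: convergent_LIMSEQ_iff)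
    then show ?thesis using True by (simp add: local_density_def[abs_def])
  next
    case False
    then show ?thesis
      using local_count_lower_tendsto[OF simplicialD(4)[OF K \<sigma>], of "n + 1" p] le[OF \<sigma>]
      by (simp del: fact_Suc)
  qed
  have "(\<lambda>d. (\<Sum>\<sigma>\<in>L. local_count p d (card \<sigma>) / fact (n + 1) ^ d) / ?f)
      \<longlonglongrightarrow> (\<Sum>\<sigma>\<in>L. if card \<sigma> = n + 1 then ?q else 0) / ?f"
    by (intro tendsto_divide tendsto_sum lims tendsto_const) (use f in auto)
  moreover have "(\<Sum>\<sigma>\<in>L. if card \<sigma> = n + 1 then ?q else 0) = ?f * ?q"
    using L(1) by (simp add: sum.If_cases p_simplices_def Int_def)
  ultimately show ?thesis
    using f unfolding card_eq by (simp add: sum_divide_distrib[symmetric])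
qed

lemma q_lim_eq: "q_lim p n = lim (local_density p (n + 1))"
  unfolding q_lim_def
proof (rule the_equality)
  fix l :: real
  assume l: "\<forall>L :: (nat \<Rightarrow>\<^sub>0 real) set set. finite L \<and> geometric_complex L \<and> complex_of_dim n L \<longrightarrow>
     (\<lambda>d. real (card (p_simplices p ((Sd ^^ d) L))) / (fact (n + 1) ^ d * real (card (p_simplices n L))))
       \<longlonglongrightarrow> l"
  obtain L :: "(nat \<Rightarrow>\<^sub>0 real) set set" where "finite L" "geometric_complex L" "complex_of_dim n L"
    using exists_simplex_complex by blast
  with l card_p_simplices_ratio_tendsto[of L n p] show "l = lim (local_density p (n + 1))"
    by (blast intro: LIMSEQ_unique)
qed (use card_p_simplices_ratio_tendsto in blast)

section \<open>Integration against sums of measures\<close>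

lemma space_sum_measure [simp]: "space (sum_measure N I M) = space N"
  and sets_sum_measure [simp, measurable_cong]: "sets (sum_measure N I M) = sets N"
  by (simp_all add: sum_measure_def)

lemma nn_integral_sum_measure:
  assumes M: "\<And>i. i \<in> I \<Longrightarrow> sets (M i) = sets N" and "f \<in> borel_measurable N"
  shows "(\<integral>\<^sup>+x. f x \<partial>sum_measure N I M) = (\<integral>\<^sup>+i. (\<integral>\<^sup>+x. f x \<partial>M i) \<partial>count_space I)"
  using assms(2)
proof (induction rule: borel_measurable_induct)
  case (cong f g)
  have "(\<integral>\<^sup>+x. f x \<partial>sum_measure N I M) = (\<integral>\<^sup>+x. g x \<partial>sum_measure N I M)"
    by (rule nn_integral_cong) (use cong in simp)
  moreover have "(\<integral>\<^sup>+x. f x \<partial>M i) = (\<integral>\<^sup>+x. g x \<partial>M i)" if "i \<in> I" for i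
    by (rule nn_integral_cong) (use cong sets_eq_imp_space_eq[OF M[OF that]] in simp)
  ultimately show ?case using cong by (simp cong: nn_integral_cong_simp)
next
  case (set A)
  have "(\<integral>\<^sup>+i. (\<integral>\<^sup>+x. indicator A x \<partial>M i) \<partial>count_space I) = (\<integral>\<^sup>+i. emeasure (M i) A \<partial>count_space I)"
    by (rule nn_integral_cong) (use set M in simp)
  then show ?case using emeasure_sum_measure[OF M set] set by simp
next
  case (mult f c)
  have m: "f \<in> borel_measurable (M i)" if "i \<in> I" for i
    using mult.hyps measurable_cong_sets[OF M[OF that] refl] by blast
  have "(\<integral>\<^sup>+i. (\<integral>\<^sup>+x. c * f x \<partial>M i) \<partial>count_space I) = (\<integral>\<^sup>+i. c * (\<integral>\<^sup>+x. f x \<partial>M i) \<partial>count_space I)"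
    by (rule nn_integral_cong) (simp add: nn_integral_cmult m)
  then show ?case using mult by (simp add: nn_integral_cmult)
next
  case (add f g)
  have m: "f \<in> borel_measurable (M i)" "g \<in> borel_measurable (M i)" if "i \<in> I" for i
    using add.hyps measurable_cong_sets[OF M[OF that] refl] by blast+
  have "(\<integral>\<^sup>+i. (\<integral>\<^sup>+x. g x + f x \<partial>M i) \<partial>count_space I)
      = (\<integral>\<^sup>+i. (\<integral>\<^sup>+x. g x \<partial>M i) + (\<integral>\<^sup>+x. f x \<partial>M i) \<partial>count_space I)"
    by (rule nn_integral_cong) (simp add: nn_integral_add m)
  then show ?case using add by (simp add: nn_integral_add)
next
  case (seq U)
  have m: "U j \<in> borel_measurable (M i)" if "i \<in> I" for i j
    using seq.hyps(1) measurable_cong_sets[OF M[OF that] refl] by blast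
  have "(\<integral>\<^sup>+i. (\<integral>\<^sup>+x. (SUP j. U j) x \<partial>M i) \<partial>count_space I)
      = (\<integral>\<^sup>+i. (SUP j. \<integral>\<^sup>+x. U j x \<partial>M i) \<partial>count_space I)"
    by (rule nn_integral_cong) (simp add: m seq.hyps nn_integral_monotone_convergence_SUP image_comp)
  also have "\<dots> = (SUP j. \<integral>\<^sup>+i. (\<integral>\<^sup>+x. U j x \<partial>M i) \<partial>count_space I)"
    using \<open>incseq U\<close>
    by (intro nn_integral_monotone_convergence_SUP)
       (auto simp: incseq_def le_fun_def intro!: nn_integral_mono)
  also have "\<dots> = (\<integral>\<^sup>+x. (SUP j. U j) x \<partial>sum_measure N I M)"
    using seq by (simp add: nn_integral_monotone_convergence_SUP image_comp)
  finally show ?case by simp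
qed

text \<open>An infinite sum of measures acts on \<open>f\<close> as a finite one as soon as
  \<open>f\<close> vanishes almost everywhere for all but finitely many of them.\<close>

lemma integral_sum_measure:
  fixes f :: "'a \<Rightarrow> real"
  assumes M: "\<And>i. i \<in> I \<Longrightarrow> sets (M i) = sets N" and f: "f \<in> borel_measurable N"
    and J: "finite J" "J \<subseteq> I" "\<And>i. i \<in> J \<Longrightarrow> integrable (M i) f"
    and zero: "\<And>i. i \<in> I \<Longrightarrow> i \<notin> J \<Longrightarrow> AE x in M i. f x = 0"
  shows "integrable (sum_measure N I M) f"
    and "(\<integral>x. f x \<partial>sum_measure N I M) = (\<Sum>i\<in>J. \<integral>x. f x \<partial>M i)"
proof -
  \<comment> \<open>\<open>h\<close> is later the absolute value, the identity and the negation: the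
    first for integrability, the others for the two parts of the integral. The condition
    \<open>h 0 = 0\<close> removes the terms outside \<open>J\<close>.\<close>
  have eq: "(\<integral>\<^sup>+x. ennreal (h (f x)) \<partial>sum_measure N I M) = (\<Sum>i\<in>J. \<integral>\<^sup>+x. ennreal (h (f x)) \<partial>M i)"
    if h: "h \<in> borel_measurable borel" "h 0 = 0" for h :: "real \<Rightarrow> real"
  proof -
    have "(\<integral>\<^sup>+x. ennreal (h (f x)) \<partial>sum_measure N I M) = (\<integral>\<^sup>+i. (\<integral>\<^sup>+x. ennreal (h (f x)) \<partial>M i) \<partial>count_space I)"
      by (rule nn_integral_sum_measure[OF M]) (use f h in measurable)
    also have "\<dots> = (\<Sum>i\<in>J. \<integral>\<^sup>+x. ennreal (h (f x)) \<partial>M i)"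
    proof (rule nn_integral_count_space'[OF J(1) _ J(2)])
      fix i assume i: "i \<in> I" "i \<notin> J"
      have "(\<integral>\<^sup>+x. ennreal (h (f x)) \<partial>M i) = (\<integral>\<^sup>+x. 0 \<partial>M i)"
        by (rule nn_integral_cong_AE, use zero[OF i] in eventually_elim) (simp add: h(2))
      then show "(\<integral>\<^sup>+x. ennreal (h (f x)) \<partial>M i) = 0" by simp
    qed
    finally show ?thesis .
  qed
  have fin: "(\<integral>\<^sup>+x. ennreal (f x) \<partial>M i) < \<top>" "(\<integral>\<^sup>+x. ennreal (- f x) \<partial>M i) < \<top>"
    "(\<integral>\<^sup>+x. ennreal \<bar>f x\<bar> \<partial>M i) < \<top>" if "i \<in> J" for i
  proof -
    show abs: "(\<integral>\<^sup>+x. ennreal \<bar>f x\<bar> \<partial>M i) < \<top>"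
      using J(3)[OF that] by (simp add: integrable_iff_bounded less_top)
    show "(\<integral>\<^sup>+x. ennreal (f x) \<partial>M i) < \<top>"
      by (rule le_less_trans[OF nn_integral_mono abs]) (simp add: ennreal_leI)
    show "(\<integral>\<^sup>+x. ennreal (- f x) \<partial>M i) < \<top>"
      by (rule le_less_trans[OF nn_integral_mono abs]) (simp add: ennreal_leI)
  qed
  have "(\<integral>\<^sup>+x. ennreal \<bar>f x\<bar> \<partial>sum_measure N I M) < \<top>"
    using eq[of "\<lambda>x. \<bar>x\<bar>"] J(1) fin(3) by (simp add: less_top)
  moreover have "f \<in> borel_measurable (sum_measure N I M)"
    unfolding measurable_cong_sets[OF sets_sum_measure refl] by (rule f)
  ultimately show int: "integrable (sum_measure N I M) f"
    by (simp add: integrable_iff_bounded less_top)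
  have e2r: "enn2real (\<Sum>i\<in>J. g i) = (\<Sum>i\<in>J. enn2real (g i))" if "\<And>i. i \<in> J \<Longrightarrow> g i < \<top>"
    for g :: "'b \<Rightarrow> ennreal"
    using enn2real_sum[OF that] by (simp add: o_def)
  show "(\<integral>x. f x \<partial>sum_measure N I M) = (\<Sum>i\<in>J. \<integral>x. f x \<partial>M i)"
    using eq[of "\<lambda>x. x"] eq[of uminus]
    by (simp add: real_lebesgue_integral_def[OF int] real_lebesgue_integral_def[OF J(3)]
        e2r fin sum_subtractf)
qed

lemma integral_scale_measure:
  fixes f :: "'a \<Rightarrow> real"
  assumes "0 \<le> r" and int: "integrable M f"
  shows "(\<integral>x. f x \<partial>scale_measure (ennreal r) M) = r * (\<integral>x. f x \<partial>M)"
proof -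
  have f: "f \<in> borel_measurable M" using int by simp
  have nn: "(\<integral>\<^sup>+x. ennreal (h x) \<partial>scale_measure (ennreal r) M) = ennreal r * (\<integral>\<^sup>+x. ennreal (h x) \<partial>M)"
    if "h \<in> borel_measurable M" for h
    by (rule nn_integral_scale_measure) (use that in measurable)
  have "(\<integral>\<^sup>+x. ennreal \<bar>f x\<bar> \<partial>scale_measure (ennreal r) M) < \<top>"
    using int f by (simp add: nn integrable_iff_bounded ennreal_mult_less_top less_top)
  then have int': "integrable (scale_measure (ennreal r) M) f"
    using f by (simp add: integrable_iff_bounded less_top measurable_cong_sets[OF sets_scale_measure refl])
  show ?thesis
    using f assms(1)
    by (simp add: real_lebesgue_integral_def[OF int] real_lebesgue_integral_def[OF int'] nn enn2real_mult
        right_diff_distrib)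
qed

section \<open>Continuous functions on the underlying space\<close>

lemma simplex_iso_weights:
  fixes \<sigma> :: "'v::real_vector set"
  assumes "finite \<sigma>" "\<sigma> \<noteq> {}" "x \<in> standard_simplex (card \<sigma> - 1)"
  obtains u where "u \<in> simplex_weights \<sigma>" "simplex_iso \<sigma> x = (\<Sum>v\<in>\<sigma>. u v *\<^sub>R v)"
    "\<And>i. i \<le> card \<sigma> - 1 \<Longrightarrow> u (vertex_enum \<sigma> i) = x i"
proof -
  let ?n = "card \<sigma> - 1"
  have b: "bij_betw (vertex_enum \<sigma>) {..?n} \<sigma>" by (rule bij_betw_vertex_enum[OF assms(1,2)])
  define u where "u v = (if v \<in> \<sigma> then x (inv_into {..?n} (vertex_enum \<sigma>) v) else 0)" for v
  have ue: "u (vertex_enum \<sigma> i) = x i" if "i \<le> ?n" for i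
    using that bij_betw_inv_into_left[OF b, of i] bij_betw_apply[OF b, of i] by (simp add: u_def)
  have "sum u \<sigma> = (\<Sum>i\<le>?n. u (vertex_enum \<sigma> i))"
    by (rule sum.reindex_bij_betw[OF b, symmetric])
  also have "\<dots> = 1" using ue assms(3) by (simp add: standard_simplex_def)
  finally have "u \<in> simplex_weights \<sigma>"
    using assms(3) by (simp add: simplex_weights_def u_def standard_simplex_def)
  moreover have "simplex_iso \<sigma> x = (\<Sum>v\<in>\<sigma>. u v *\<^sub>R v)"
    unfolding simplex_iso_def sum.reindex_bij_betw[OF b, of "\<lambda>v. u v *\<^sub>R v", symmetric] using ue by simp
  ultimately show ?thesis using ue by (rule that)
qed

lemma weights_simplex_iso:
  fixes \<sigma> :: "'v::real_vector set"
  assumes "finite \<sigma>" "\<sigma> \<noteq> {}" "u \<in> simplex_weights \<sigma>"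
  defines "x \<equiv> \<lambda>i. if i \<le> card \<sigma> - 1 then u (vertex_enum \<sigma> i) else 0"
  shows "x \<in> standard_simplex (card \<sigma> - 1)" "simplex_iso \<sigma> x = (\<Sum>v\<in>\<sigma>. u v *\<^sub>R v)"
proof -
  have b: "bij_betw (vertex_enum \<sigma>) {..card \<sigma> - 1} \<sigma>" by (rule bij_betw_vertex_enum[OF assms(1,2)])
  have "(\<Sum>i\<le>card \<sigma> - 1. x i) = sum u \<sigma>"
    unfolding x_def sum.reindex_bij_betw[OF b, of u, symmetric] by simp
  then show "x \<in> standard_simplex (card \<sigma> - 1)"
    using assms(3) by (intro standard_simplexI) (simp_all add: x_def simplex_weights_def)
  show "simplex_iso \<sigma> x = (\<Sum>v\<in>\<sigma>. u v *\<^sub>R v)"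
    unfolding simplex_iso_def x_def sum.reindex_bij_betw[OF b, of "\<lambda>v. u v *\<^sub>R v", symmetric] by simp
qed

lemma continuous_on_simplex_iso:
  assumes K: "geometric_complex K" "\<sigma> \<in> K"
    and \<phi>: "continuous_map (underlying_space K) euclideanreal \<phi>"
  shows "continuous_on (standard_simplex (card \<sigma> - 1)) (\<lambda>x. \<phi> (simplex_iso \<sigma> x))"
proof -
  let ?\<Delta> = "standard_simplex (card \<sigma> - 1)"
  have fin: "finite \<sigma>" "\<sigma> \<noteq> {}"
    using simplicialD[OF geometric_complex_imp_simplicial[OF K(1)] K(2)] by simp_all
  have iso: "simplex_iso \<sigma> x \<in> underlying_set K" if "x \<in> ?\<Delta>" for x
    using simplex_iso_image[OF fin] that K(2) unfolding underlying_set_def by blast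
  have "openin (top_of_set ?\<Delta>) {x \<in> topspace (top_of_set ?\<Delta>). \<phi> (simplex_iso \<sigma> x) \<in> U}" if "open U" for U
  proof -
    have "openin (underlying_space K) {y \<in> topspace (underlying_space K). \<phi> y \<in> U}"
      using \<phi> that unfolding continuous_map_def by simp
    then have "openin (top_of_set ?\<Delta>) {x \<in> ?\<Delta>. simplex_iso \<sigma> x \<in> {y \<in> topspace (underlying_space K). \<phi> y \<in> U}}"
      using K(2) unfolding openin_underlying_space by blast
    moreover have "{x \<in> ?\<Delta>. simplex_iso \<sigma> x \<in> {y \<in> topspace (underlying_space K). \<phi> y \<in> U}}
        = {x \<in> topspace (top_of_set ?\<Delta>). \<phi> (simplex_iso \<sigma> x) \<in> U}"
      using iso topspace_underlying_space[OF K(1)] by auto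
    ultimately show ?thesis by simp
  qed
  then have "continuous_map (top_of_set ?\<Delta>) euclidean (\<lambda>x. \<phi> (simplex_iso \<sigma> x))"
    unfolding continuous_map_def by simp
  then show ?thesis by simp
qed

lemma compact_standard_simplex: "compact (standard_simplex n)"
  using compactin_standard_simplex[of n] by (simp add: euclidean_product_topology)

lemma dist_fun_small:
  fixes e :: real
  assumes "0 < e"
  obtains \<delta> where "0 < \<delta>" "\<And>x y :: nat \<Rightarrow> real. (\<And>i. \<bar>x i - y i\<bar> \<le> \<delta>) \<Longrightarrow> dist x y < e"
proof -
  obtain N where N: "(1 / 2 :: real) ^ N < e / 2"
    using real_arch_pow_inv[of "e / 2" "1 / 2"] assms by auto
  \<comment> \<open>The product metric is at most twice the largest of the first coordinate
    distances plus a tail below \<open>e / 2\<close>, so \<open>e / 4\<close> suffices.\<close>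
  have "dist x y < e" if xy: "\<And>i. \<bar>x i - y i\<bar> \<le> e / 4" for x y :: "nat \<Rightarrow> real"
  proof -
    have "dist (x (from_nat n)) (y (from_nat n)) \<le> e / 4" for n
      using xy by (simp add: dist_real_def)
    then have "Max {dist (x (from_nat n)) (y (from_nat n)) |n. n \<le> N} \<le> e / 4"
      by (subst Max_le_iff) auto
    then show ?thesis
      using dist_fun_le_dist_first_terms[of x y N] N by linarith
  qed
  then show ?thesis using that[of "e / 4"] assms by simp
qed

text \<open>This is uniform continuity on the compact standard simplex: the l1 distance of weights
  dominates each coordinate difference, and uniformly small coordinate differences give a small
  product distance.\<close>

lemma continuous_on_oscillation:
  fixes \<sigma> :: "'v::real_vector set"
  assumes \<sigma>: "finite \<sigma>" "\<sigma> \<noteq> {}" and "0 < \<epsilon>"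
    and c: "continuous_on (standard_simplex (card \<sigma> - 1)) (\<lambda>x. \<phi> (simplex_iso \<sigma> x))"
  shows "\<exists>\<delta>>0. oscillation_le \<delta> \<epsilon> \<phi> \<sigma>"
proof -
  let ?\<Delta> = "standard_simplex (card \<sigma> - 1)"
  obtain e where e: "e > 0" "\<And>x y. x \<in> ?\<Delta> \<Longrightarrow> y \<in> ?\<Delta> \<Longrightarrow> dist y x < e \<Longrightarrow>
      dist (\<phi> (simplex_iso \<sigma> y)) (\<phi> (simplex_iso \<sigma> x)) < \<epsilon>"
    using compact_uniformly_continuous[OF c compact_standard_simplex] \<open>0 < \<epsilon>\<close>
    unfolding uniformly_continuous_on_def by blast
  obtain \<delta> where \<delta>: "0 < \<delta>" "\<And>x y :: nat \<Rightarrow> real. (\<And>i. \<bar>x i - y i\<bar> \<le> \<delta>) \<Longrightarrow> dist x y < e"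
    using dist_fun_small[OF e(1)] by blast
  have "oscillation_le \<delta> \<epsilon> \<phi> \<sigma>"
    unfolding oscillation_le_def
  proof (intro ballI impI)
    fix u w assume u: "u \<in> simplex_weights \<sigma>" and w: "w \<in> simplex_weights \<sigma>"
      and d: "(\<Sum>v\<in>\<sigma>. \<bar>u v - w v\<bar>) \<le> \<delta>"
    have uw: "\<bar>u v - w v\<bar> \<le> \<delta>" if "v \<in> \<sigma>" for v
      using member_le_sum[of v \<sigma> "\<lambda>v. \<bar>u v - w v\<bar>"] that \<sigma>(1) d by simp
    let ?x = "\<lambda>u i. if i \<le> card \<sigma> - 1 then u (vertex_enum \<sigma> i) else (0::real)"
    have "\<bar>?x u i - ?x w i\<bar> \<le> \<delta>" for i
      using uw[OF bij_betw_apply[OF bij_betw_vertex_enum[OF \<sigma>], of i]] \<delta>(1) by simp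
    then have "dist (?x u) (?x w) < e" by (rule \<delta>(2))
    then have "dist (\<phi> (simplex_iso \<sigma> (?x u))) (\<phi> (simplex_iso \<sigma> (?x w))) < \<epsilon>"
      by (rule e(2)[OF weights_simplex_iso(1)[OF \<sigma> w] weights_simplex_iso(1)[OF \<sigma> u]])
    then show "\<bar>\<phi> (\<Sum>v\<in>\<sigma>. u v *\<^sub>R v) - \<phi> (\<Sum>v\<in>\<sigma>. w v *\<^sub>R v)\<bar> \<le> \<epsilon>"
      unfolding weights_simplex_iso(2)[OF \<sigma> u] weights_simplex_iso(2)[OF \<sigma> w] by (simp add: dist_real_def)
  qed
  with \<delta>(1) show ?thesis by blast
qed

lemma borel_measurable_underlying:
  assumes "geometric_complex K" and \<phi>: "continuous_map (underlying_space K) euclideanreal \<phi>"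
  shows "\<phi> \<in> borel_measurable (underlying_borel K)"
proof (rule borel_measurableI)
  fix S :: "real set" assume "open S"
  then have "openin (underlying_space K) {y \<in> topspace (underlying_space K). \<phi> y \<in> S}"
    using \<phi> unfolding continuous_map_def by simp
  moreover have "{y \<in> topspace (underlying_space K). \<phi> y \<in> S} = \<phi> -` S \<inter> space (underlying_borel K)"
    using topspace_underlying_space[OF assms(1)] by auto
  ultimately show "\<phi> -` S \<inter> space (underlying_borel K) \<in> sets (underlying_borel K)"
    unfolding sets_underlying_borel by (intro sigma_sets.Basic) simp
qed

section \<open>Open stars and compact sets\<close>

definition open_star :: "'v::real_vector set set \<Rightarrow> 'v \<Rightarrow> 'v set" where
  "open_star K v = {y. \<exists>\<tau>\<in>K. \<exists>u\<in>simplex_weights \<tau>. y = (\<Sum>v\<in>\<tau>. u v *\<^sub>R v) \<and> u v > 0}"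

text \<open>Uniqueness of weights makes the coordinate at \<open>v\<close> well defined on the whole
  space. In each chart the star is therefore the set where the coordinate belonging to
  \<open>v\<close> is positive, or empty if \<open>v\<close> is not a vertex of that
  simplex.\<close>

lemma openin_open_star:
  assumes K: "simplicial K"
  shows "openin (underlying_space K) (open_star K v)"
  unfolding openin_underlying_space
proof (intro conjI ballI)
  show "open_star K v \<subseteq> underlying_set K"
  proof
    fix y assume "y \<in> open_star K v"
    then obtain \<tau> u where "\<tau> \<in> K" "u \<in> simplex_weights \<tau>" "y = (\<Sum>v\<in>\<tau>. u v *\<^sub>R v)"
      unfolding open_star_def by blast
    then show "y \<in> underlying_set K"
      unfolding underlying_set_def using convex_hull_simplex_weights[OF simplicialD(1)[OF K]] by blast
  qed
  fix \<sigma> assume \<sigma>: "\<sigma> \<in> K"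
  let ?n = "card \<sigma> - 1"
  let ?\<Delta> = "standard_simplex ?n"
  have fin: "finite \<sigma>" "\<sigma> \<noteq> {}" using simplicialD[OF K \<sigma>] by simp_all
  have b: "bij_betw (vertex_enum \<sigma>) {..?n} \<sigma>" by (rule bij_betw_vertex_enum[OF fin])
  have "{x \<in> ?\<Delta>. simplex_iso \<sigma> x \<in> open_star K v} = ?\<Delta> \<inter> (\<Union>i\<in>{i\<in>{..?n}. vertex_enum \<sigma> i = v}. {x. 0 < x i})"
  proof (rule Set.set_eqI)
    fix x
    show "x \<in> {x \<in> ?\<Delta>. simplex_iso \<sigma> x \<in> open_star K v}
        \<longleftrightarrow> x \<in> ?\<Delta> \<inter> (\<Union>i\<in>{i\<in>{..?n}. vertex_enum \<sigma> i = v}. {x. 0 < x i})"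
    proof (cases "x \<in> ?\<Delta>")
      case True
      obtain u where u: "u \<in> simplex_weights \<sigma>" "simplex_iso \<sigma> x = (\<Sum>v\<in>\<sigma>. u v *\<^sub>R v)"
        "\<And>i. i \<le> ?n \<Longrightarrow> u (vertex_enum \<sigma> i) = x i"
        using simplex_iso_weights[OF fin True] by blast
      have "simplex_iso \<sigma> x \<in> open_star K v \<longleftrightarrow> u v > 0"
      proof
        assume "simplex_iso \<sigma> x \<in> open_star K v"
        then obtain \<tau> w where w: "\<tau> \<in> K" "w \<in> simplex_weights \<tau>" "simplex_iso \<sigma> x = (\<Sum>v\<in>\<tau>. w v *\<^sub>R v)" "w v > 0"
          unfolding open_star_def by blast
        have "u = w"
          by (rule simplicial_weights_unique[OF K \<sigma> w(1) u(1) w(2)]) (simp only: u(2)[symmetric] w(3)[symmetric])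
        with w(4) show "u v > 0" by simp
      next
        assume "u v > 0"
        then show "simplex_iso \<sigma> x \<in> open_star K v"
          unfolding open_star_def using \<sigma> u(1,2) by blast
      qed
      also have "u v > 0 \<longleftrightarrow> (\<exists>i\<le>?n. vertex_enum \<sigma> i = v \<and> 0 < x i)"
      proof
        assume "u v > 0"
        then have "v \<in> \<sigma>" using u(1) by (force simp: simplex_weights_def)
        then have "v \<in> vertex_enum \<sigma> ` {..?n}" unfolding bij_betw_imp_surj_on[OF b] .
        then obtain i where "i \<le> ?n" "vertex_enum \<sigma> i = v" by auto
        with \<open>u v > 0\<close> u(3) show "\<exists>i\<le>?n. vertex_enum \<sigma> i = v \<and> 0 < x i" by auto
      qed (use u(3) in auto)
      finally show ?thesis using True by auto
    qed simp
  qed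
  moreover have "open (\<Union>i\<in>{i\<in>{..?n}. vertex_enum \<sigma> i = v}. {x :: nat \<Rightarrow> real. 0 < x i})"
    by (intro open_UN ballI open_Collect_less continuous_on_const continuous_on_product_coordinates)
  ultimately show "openin (top_of_set ?\<Delta>) {x \<in> ?\<Delta>. simplex_iso \<sigma> x \<in> open_star K v}"
    by (simp only: openin_open_Int)
qed

text \<open>The open stars cover the space, so finitely many of them cover \<open>Q\<close>, and a
  closed simplex that meets the star of \<open>v\<close> has \<open>v\<close> as a vertex. Local
  finiteness leaves finitely many such simplices for each \<open>v\<close>.\<close>

lemma finite_simplices_meeting_compact:
  assumes K: "simplicial K" "locally_finite_complex K" and Q: "compactin (underlying_space K) Q"
    and QK: "Q \<subseteq> underlying_set K"
  shows "finite {\<sigma>\<in>K. convex hull \<sigma> \<inter> Q \<noteq> {}}"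
proof -
  have cover: "underlying_set K \<subseteq> \<Union>(range (open_star K))"
  proof
    fix y assume "y \<in> underlying_set K"
    then obtain \<sigma> where \<sigma>: "\<sigma> \<in> K" "y \<in> convex hull \<sigma>" unfolding underlying_set_def by blast
    then obtain u where u: "u \<in> simplex_weights \<sigma>" "y = (\<Sum>v\<in>\<sigma>. u v *\<^sub>R v)"
      using convex_hull_simplex_weights[OF simplicialD(1)[OF K(1) \<sigma>(1)]] by blast
    have "\<exists>v. u v > 0"
    proof (rule ccontr)
      assume "\<nexists>v. u v > 0"
      then have "sum u \<sigma> \<le> 0" by (intro sum_nonpos) (simp add: not_less)
      then show False using u(1) by (simp add: simplex_weights_def)
    qed
    then show "y \<in> \<Union>(range (open_star K))"
      unfolding open_star_def using \<sigma>(1) u by blast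
  qed
  obtain \<F> where \<F>: "finite \<F>" "\<F> \<subseteq> range (open_star K)" "Q \<subseteq> \<Union>\<F>"
    using compactinD[OF Q, of "range (open_star K)"] openin_open_star[OF K(1)] cover QK by blast
  obtain F where F: "finite F" "\<F> = open_star K ` F"
    using finite_subset_image[OF \<F>(1,2)] by blast
  have "{\<sigma>\<in>K. convex hull \<sigma> \<inter> Q \<noteq> {}} \<subseteq> (\<Union>v\<in>F. {\<sigma>\<in>K. v \<in> \<sigma>})"
  proof
    fix \<sigma> assume "\<sigma> \<in> {\<sigma>\<in>K. convex hull \<sigma> \<inter> Q \<noteq> {}}"
    then obtain y where \<sigma>: "\<sigma> \<in> K" and y: "y \<in> convex hull \<sigma>" "y \<in> Q" by blast
    obtain u where u: "u \<in> simplex_weights \<sigma>" "y = (\<Sum>v\<in>\<sigma>. u v *\<^sub>R v)"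
      using y(1) convex_hull_simplex_weights[OF simplicialD(1)[OF K(1) \<sigma>]] by blast
    obtain v where v: "v \<in> F" "y \<in> open_star K v" using y(2) \<F>(3) F(2) by blast
    then obtain \<tau> w where w: "\<tau> \<in> K" "w \<in> simplex_weights \<tau>" "y = (\<Sum>v\<in>\<tau>. w v *\<^sub>R v)" "w v > 0"
      unfolding open_star_def by blast
    have "u = w"
      by (rule simplicial_weights_unique[OF K(1) \<sigma> w(1) u(1) w(2)]) (simp only: u(2)[symmetric] w(3)[symmetric])
    then have "v \<in> \<sigma>" using u(1) w(4) by (force simp: simplex_weights_def)
    then show "\<sigma> \<in> (\<Union>v\<in>F. {\<sigma>\<in>K. v \<in> \<sigma>})" using v(1) \<sigma> by blast
  qed
  moreover have "finite (\<Union>v\<in>F. {\<sigma>\<in>K. v \<in> \<sigma>})"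
    using F(1) K(2) by (simp add: locally_finite_complex_def)
  ultimately show ?thesis by (rule finite_subset)
qed

section \<open>Weak convergence\<close>

text \<open>The barycenter of each piece lies in the simplex carrying it, so the pieces carried by
  simplices outside \<open>N\<close> have their Dirac masses where \<phi> vanishes.\<close>

lemma integral_gamma:
  fixes \<phi> :: "'v::real_vector \<Rightarrow> real"
  assumes K: "geometric_complex K" and \<phi>: "\<phi> \<in> borel_measurable (underlying_borel K)"
    and N: "N \<subseteq> K" "finite N" "\<And>\<sigma> x. \<sigma> \<in> K - N \<Longrightarrow> x \<in> convex hull \<sigma> \<Longrightarrow> \<phi> x = 0"
  shows "(\<integral>x. \<phi> x \<partial>gamma n d p K) = (\<Sum>\<sigma>\<in>N. local_sum p \<phi> d \<sigma> / fact (n + 1) ^ d)"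
proof -
  have S: "simplicial K" by (rule geometric_complex_imp_simplicial[OF K])
  let ?I = "p_simplices p ((Sd ^^ d) K)" and ?M = "\<lambda>\<sigma>. return (underlying_borel K) (barycenter \<sigma>)"
  let ?J = "{\<tau>. \<tau> \<in> (\<Union>\<sigma>\<in>N. carried d \<sigma>) \<and> card \<tau> = p + 1}"
  have I: "?I = {\<tau>. \<tau> \<in> (\<Union>\<sigma>\<in>K. carried d \<sigma>) \<and> card \<tau> = p + 1}"
    unfolding p_simplices_def iterated_Sd_eq_carried[OF S] ..
  have bary: "barycenter \<tau> \<in> convex hull \<sigma>" if "\<sigma> \<in> K" "\<tau> \<in> carried d \<sigma>" for \<sigma> \<tau>
    using barycenter_carried_in_hull[OF simplicialD(1,2)[OF S that(1)] that(2)] .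
  have sp: "barycenter \<tau> \<in> space (underlying_borel K)" if "\<tau> \<in> ?I" for \<tau>
    using that bary unfolding I space_underlying_borel underlying_set_def by blast
  have J: "finite ?J" "?J \<subseteq> ?I"
  proof -
    have "finite (\<Union>\<sigma>\<in>N. carried d \<sigma>)"
      using N(1,2) by (intro finite_UN_I finite_carried simplicialD(1)[OF S]) auto
    then show "finite ?J" by (rule rev_finite_subset) blast
    show "?J \<subseteq> ?I" unfolding I using N(1) by blast
  qed
  have int: "integrable (?M \<tau>) \<phi>" if "\<tau> \<in> ?I" for \<tau>
  proof -
    interpret prob_space "?M \<tau>" by (rule prob_space_return[OF sp[OF that]])
    have "AE x in ?M \<tau>. norm (\<phi> x) \<le> \<bar>\<phi> (barycenter \<tau>)\<bar>"
      by (subst AE_return[OF sp[OF that]]) (use \<phi> in simp_all)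
    then show ?thesis
      by (rule integrable_const_bound) (use \<phi> in simp)
  qed
  have zero: "AE x in ?M \<tau>. \<phi> x = 0" if \<tau>: "\<tau> \<in> ?I" "\<tau> \<notin> ?J" for \<tau>
  proof -
    obtain \<sigma> where \<sigma>: "\<sigma> \<in> K" "\<tau> \<in> carried d \<sigma>" "card \<tau> = p + 1" using \<tau>(1) unfolding I by blast
    then have "\<sigma> \<notin> N" using \<tau>(2) by blast
    then have "\<phi> (barycenter \<tau>) = 0" using N(3)[of \<sigma>] \<sigma>(1) bary[OF \<sigma>(1,2)] by blast
    then show ?thesis
      by (subst AE_return[OF sp[OF \<tau>(1)]]) (use \<phi> in simp_all)
  qed
  note sums = integral_sum_measure[where M="?M" and I="?I" and J="?J" and N="underlying_borel K",
      OF sets_return \<phi> J int[OF subsetD[OF J(2)]] zero]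
  have "(\<integral>x. \<phi> x \<partial>gamma n d p K) = 1 / fact (n + 1) ^ d * (\<Sum>\<tau>\<in>?J. \<integral>x. \<phi> x \<partial>?M \<tau>)"
  proof -
    have "(\<integral>x. \<phi> x \<partial>gamma n d p K) = 1 / fact (n + 1) ^ d *
        (\<integral>x. \<phi> x \<partial>sum_measure (underlying_borel K) ?I ?M)"
      unfolding gamma_def by (rule integral_scale_measure[OF _ sums(1)]) simp_all
    also note sums(2)
    finally show ?thesis .
  qed
  also have "(\<Sum>\<tau>\<in>?J. \<integral>x. \<phi> x \<partial>?M \<tau>) = (\<Sum>\<tau>\<in>?J. \<phi> (barycenter \<tau>))"
    by (intro sum.cong refl integral_return[OF sp \<phi>]) (use J(2) in blast)
  also have "\<dots> = (\<Sum>\<sigma>\<in>N. local_sum p \<phi> d \<sigma>)"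
    unfolding local_sum_def by (rule sum_iterated_Sd[OF S N(1,2)])
  finally show ?thesis
    by (simp add: sum_divide_distrib)
qed

lemma integral_dvol:
  fixes \<phi> :: "'v::real_vector \<Rightarrow> real"
  assumes K: "geometric_complex K" and \<phi>: "\<phi> \<in> borel_measurable (underlying_borel K)"
    and N: "N \<subseteq> K" "finite N" "\<And>\<sigma> x. \<sigma> \<in> K - N \<Longrightarrow> x \<in> convex hull \<sigma> \<Longrightarrow> \<phi> x = 0"
    and bound: "\<And>\<sigma>. \<sigma> \<in> N \<Longrightarrow> \<exists>B. \<forall>x\<in>convex hull \<sigma>. \<bar>\<phi> x\<bar> \<le> B"
  shows "(\<integral>x. \<phi> x \<partial>dvol n K) = (\<Sum>\<sigma> | \<sigma> \<in> N \<and> card \<sigma> = n + 1. simplex_mean \<phi> \<sigma>)"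
proof -
  have S: "simplicial K" by (rule geometric_complex_imp_simplicial[OF K])
  let ?I = "p_simplices n K" and ?J = "{\<sigma>. \<sigma> \<in> N \<and> card \<sigma> = n + 1}"
  let ?M = "\<lambda>\<sigma>. distr (simplex_volume n) (underlying_borel K) (simplex_iso \<sigma>)"
  have I: "\<sigma> \<in> K \<and> finite \<sigma> \<and> \<sigma> \<noteq> {} \<and> card \<sigma> - 1 = n" if "\<sigma> \<in> ?I" for \<sigma>
    using that simplicialD[OF S, of \<sigma>] by (simp add: p_simplices_def)
  have iso: "simplex_iso \<sigma> \<in> simplex_volume n \<rightarrow>\<^sub>M underlying_borel K" if "\<sigma> \<in> ?I" for \<sigma>
    unfolding measurable_cong_sets[OF sets_simplex_volume refl]
    using simplex_iso_measurable[OF K, of \<sigma>] I[OF that] by simp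
  have hull: "simplex_iso \<sigma> x \<in> convex hull \<sigma>" if "\<sigma> \<in> ?I" "x \<in> standard_simplex n" for \<sigma> x
    using simplex_iso_image[of \<sigma>] I[OF that(1)] that(2) by blast
  have J: "finite ?J" "?J \<subseteq> ?I"
    using N(1,2) by (auto simp: p_simplices_def)
  have int: "integrable (?M \<sigma>) \<phi>" if \<sigma>: "\<sigma> \<in> ?J" for \<sigma>
  proof -
    have \<sigma>I: "\<sigma> \<in> ?I" using J(2) \<sigma> by blast
    obtain B where B: "\<And>x. x \<in> convex hull \<sigma> \<Longrightarrow> \<bar>\<phi> x\<bar> \<le> B" using bound \<sigma> by blast
    have "integrable (simplex_volume n) (\<lambda>x. \<phi> (simplex_iso \<sigma> x))"
    proof (rule simplex_volume_integrable)
      show "(\<lambda>x. \<phi> (simplex_iso \<sigma> x)) \<in> borel_measurable (restrict_space borel (standard_simplex n))"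
        using measurable_compose[OF iso[OF \<sigma>I] \<phi>] unfolding measurable_cong_sets[OF sets_simplex_volume refl] .
    qed (use B hull[OF \<sigma>I] in blast)
    then show ?thesis using integrable_distr_eq[OF iso[OF \<sigma>I] \<phi>] by simp
  qed
  have zero: "AE x in ?M \<sigma>. \<phi> x = 0" if "\<sigma> \<in> ?I" "\<sigma> \<notin> ?J" for \<sigma>
  proof -
    have "\<sigma> \<in> K - N" using that by (auto simp: p_simplices_def)
    then have "AE x in simplex_volume n. \<phi> (simplex_iso \<sigma> x) = 0"
      using N(3) hull[OF that(1)] by (intro AE_I2) (simp add: space_simplex_volume)
    moreover have "{x \<in> space (underlying_borel K). \<phi> x = 0} \<in> sets (underlying_borel K)"
      using \<phi> by measurable
    ultimately show ?thesis
      by (subst AE_distr_iff[OF iso[OF that(1)]])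
  qed
  have "(\<integral>x. \<phi> x \<partial>dvol n K) = (\<Sum>\<sigma>\<in>?J. \<integral>x. \<phi> x \<partial>?M \<sigma>)"
    unfolding dvol_def by (rule integral_sum_measure(2)[OF sets_distr \<phi> J int zero])
  also have "\<dots> = (\<Sum>\<sigma>\<in>?J. simplex_mean \<phi> \<sigma>)"
  proof (rule sum.cong[OF refl])
    fix \<sigma> assume "\<sigma> \<in> ?J"
    then have \<sigma>: "\<sigma> \<in> ?I" using J(2) by blast
    show "(\<integral>x. \<phi> x \<partial>?M \<sigma>) = simplex_mean \<phi> \<sigma>"
      unfolding integral_distr[OF iso[OF \<sigma>] \<phi>] simplex_mean_def using I[OF \<sigma>] by simp
  qed
  finally show ?thesis .
qed

text \<open>Both integrals are finite sums over the closed simplices that meet the support, and the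
  limit is taken term by term. The terms below dimension \<open>n\<close> tend to 0, in accordance
  with \<open>dvol\<close>, which sums over the simplices of dimension \<open>n\<close>.\<close>

theorem theorem4:
  fixes K :: "'v::real_vector set set" and n p :: nat and \<phi> :: "'v \<Rightarrow> real"
  assumes "geometric_complex K"
    and "locally_finite_complex K"
    and "complex_of_dim n K"
    and "p \<le> n"
    and "continuous_map (underlying_space K) euclideanreal \<phi>"
    and "compactin (underlying_space K)
           (underlying_space K closure_of {x \<in> underlying_set K. \<phi> x \<noteq> 0})"
  shows "(\<lambda>d. \<integral>x. \<phi> x \<partial>gamma n d p K) \<longlonglongrightarrow> q_lim p n * (\<integral>x. \<phi> x \<partial>dvol n K)"
proof -
  have S: "simplicial K" by (rule geometric_complex_imp_simplicial[OF assms(1)])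
  define Q where "Q = underlying_space K closure_of {x \<in> underlying_set K. \<phi> x \<noteq> 0}"
  define N where "N = {\<sigma>\<in>K. convex hull \<sigma> \<inter> Q \<noteq> {}}"
  have QK: "Q \<subseteq> underlying_set K"
    unfolding Q_def topspace_underlying_space[OF assms(1), symmetric] by (rule closure_of_subset_topspace)
  have N: "N \<subseteq> K" "finite N"
    using finite_simplices_meeting_compact[OF S assms(2) _ QK] assms(6) by (auto simp: N_def Q_def)
  have out: "\<phi> x = 0" if "\<sigma> \<in> K - N" "x \<in> convex hull \<sigma>" for \<sigma> x
  proof (rule ccontr)
    assume "\<phi> x \<noteq> 0"
    moreover have "x \<in> underlying_set K" using that by (auto simp: underlying_set_def)
    moreover have "{x \<in> underlying_set K. \<phi> x \<noteq> 0} \<subseteq> Q"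
      unfolding Q_def by (rule closure_of_subset) (simp add: topspace_underlying_space[OF assms(1)])
    ultimately have "x \<in> Q" by blast
    with that show False by (auto simp: N_def)
  qed
  have \<phi>: "\<phi> \<in> borel_measurable (underlying_borel K)"
    by (rule borel_measurable_underlying[OF assms(1,5)])
  have fin: "finite \<sigma>" "\<sigma> \<noteq> {}" if "\<sigma> \<in> K" for \<sigma>
    using simplicialD[OF S that] by simp_all
  have cont: "continuous_on (standard_simplex (card \<sigma> - 1)) (\<lambda>x. \<phi> (simplex_iso \<sigma> x))" if "\<sigma> \<in> K" for \<sigma>
    by (rule continuous_on_simplex_iso[OF assms(1) that assms(5)])
  have bound: "\<exists>B. \<forall>x\<in>convex hull \<sigma>. \<bar>\<phi> x\<bar> \<le> B" if \<sigma>: "\<sigma> \<in> K" for \<sigma>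
  proof -
    have "bounded ((\<lambda>x. \<phi> (simplex_iso \<sigma> x)) ` standard_simplex (card \<sigma> - 1))"
      by (rule compact_imp_bounded[OF compact_continuous_image[OF cont[OF \<sigma>] compact_standard_simplex]])
    then show ?thesis
      unfolding bounded_iff simplex_iso_image[OF fin[OF \<sigma>], symmetric] by auto
  qed
  have meas: "simplex_measurable \<phi> \<sigma>" if "\<sigma> \<in> K" for \<sigma>
    unfolding simplex_measurable_def
    by (rule measurable_compose[OF simplex_iso_measurable[OF assms(1) that] \<phi>])
  let ?q = "lim (local_density p (n + 1))"
  have lim: "(\<lambda>d. local_sum p \<phi> d \<sigma> / fact (n + 1) ^ d)
      \<longlonglongrightarrow> (if card \<sigma> = n + 1 then ?q * simplex_mean \<phi> \<sigma> else 0)" if "\<sigma> \<in> N" for \<sigma>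
  proof -
    have \<sigma>: "\<sigma> \<in> K" using that N(1) by blast
    obtain B where B: "\<And>x. x \<in> convex hull \<sigma> \<Longrightarrow> \<bar>\<phi> x\<bar> \<le> B" using bound[OF \<sigma>] by blast
    have osc: "\<exists>\<delta>>0. oscillation_le \<delta> \<epsilon> \<phi> \<sigma>" if "0 < \<epsilon>" for \<epsilon>
      by (rule continuous_on_oscillation[OF fin[OF \<sigma>] that cont[OF \<sigma>]])
    show ?thesis
    proof (cases "card \<sigma> = n + 1")
      case True
      then show ?thesis
        using local_sum_tendsto[OF S \<sigma> meas[OF \<sigma>] B osc, where p=p] by simp
    next
      case False
      then have "card \<sigma> < n + 1" using assms(3) \<sigma> by (fastforce simp: complex_of_dim_def)
      then show ?thesis
        using local_sum_lower_tendsto[OF S \<sigma> _ B, where n="n + 1" and p=p] False by simp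
    qed
  qed
  have "(\<lambda>d. \<Sum>\<sigma>\<in>N. local_sum p \<phi> d \<sigma> / fact (n + 1) ^ d)
      \<longlonglongrightarrow> (\<Sum>\<sigma>\<in>N. if card \<sigma> = n + 1 then ?q * simplex_mean \<phi> \<sigma> else 0)"
    by (rule tendsto_sum) (rule lim)
  also have "(\<Sum>\<sigma>\<in>N. if card \<sigma> = n + 1 then ?q * simplex_mean \<phi> \<sigma> else 0)
      = (\<Sum>\<sigma> | \<sigma> \<in> N \<and> card \<sigma> = n + 1. ?q * simplex_mean \<phi> \<sigma>)"
    using N(2) by (intro sum.mono_neutral_cong_right) auto
  also have "\<dots> = q_lim p n * (\<integral>x. \<phi> x \<partial>dvol n K)"
    unfolding q_lim_eq sum_distrib_left[symmetric]
    using integral_dvol[OF assms(1) \<phi> N out bound[OF subsetD[OF N(1)]]] by simp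
  also have "(\<lambda>d. \<Sum>\<sigma>\<in>N. local_sum p \<phi> d \<sigma> / fact (n + 1) ^ d) = (\<lambda>d. \<integral>x. \<phi> x \<partial>gamma n d p K)"
    by (rule ext) (rule integral_gamma[OF assms(1) \<phi> N out, symmetric])
  finally show ?thesis .
qed

end
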